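(* Let $k$ be a field of any characteristic, and let $\mathcal{A}$ be the universal unital algebra over $k$ generated by $a, a^{-1}, b$ subject to the two relations $a a^{-1} = 1 = a^{-1} a$. Then: (1) $\mathcal{A}$ is a quantum group, i.e. a Hopf algebra, with Hopf algebra structure given by $$\Delta(a) = a \otimes a, \qquad \Delta(b) = b \otimes a + 1 \otimes b,$$ $$S(a) = a^{-1}, \quad S(b) = -b a^{-1}, \qquad \epsilon(a) = 1, \quad \epsilon(b) = 0.$$ (2) The quantum group $\mathcal{A}$ admits an action $\alpha$ on the algebra $k[x]$ given by $$\alpha(x) = x \otimes a + 1 \otimes b.$$ The pair $(\mathcal{A}, \alpha)$ is the quantum automorphism group of $k[x]$, i.e. a universal object of the category $\mathcal{C}$: $(\mathcal{A}, \alpha)$ is an object of $\mathcal{C}$, and for every object $(\mathcal{A}_0, \alpha_0)$ of $\mathcal{C}$ there is a unique Hopf algebra morphism $\pi : \mathcal{A} \to \mathcal{A}_0$ with $\alpha_0 = (\mathrm{id} \otimes \pi)\alpha$. Moreover, $\mathcal{A}$ naturally contains the ordinary automorphism group $\mathrm{Aut}(k[x])$ as a subgroup: the assignment $a \mapsto s$, $b \mapsto t$ defines a surjective Hopf algebra morphism $\mathcal{A} \to \mathcal{O}(\mathrm{Aut}(k[x]))$.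
   Context: A quantum group is a Hopf algebra over $k$ (thought of as an algebra of noncommutative functions). An action of a quantum group $\mathcal{A}_0$ on a unital algebra $\mathcal{B}$ is a right coaction of the Hopf algebra on the algebra: a unital algebra homomorphism $\alpha_0 : \mathcal{B} \to \mathcal{B} \otimes \mathcal{A}_0$ with $(\mathrm{id} \otimes \Delta_0)\alpha_0 = (\alpha_0 \otimes \mathrm{id})\alpha_0$ and $(\mathrm{id} \otimes \epsilon_0)\alpha_0 = \mathrm{id}$, where $\Delta_0, \epsilon_0$ are the coproduct and counit of $\mathcal{A}_0$. The pair $(\mathcal{A}_0, \alpha_0)$ is then called a quantum transformation group over $\mathcal{B}$. A morphism from $(\mathcal{A}_1, \alpha_1)$ to $(\mathcal{A}_2, \alpha_2)$ is a Hopf algebra morphism $\pi : \mathcal{A}_2 \to \mathcal{A}_1$ with $\alpha_1 = (\mathrm{id} \otimes \pi)\alpha_2$. For $n \ge 0$, $k[x]_n \subset k[x]$ is the subspace of polynomials of degree at most $n$. $\mathcal{C}$ is the category of quantum transformation groups $(\mathcal{A}_0, \alpha_0)$ over $k[x]$ that leave every $k[x]_n$ invariant, i.e. $\alpha_0(k[x]_n) \subseteq k[x]_n \otimes \mathcal{A}_0$ for all $n \ge 0$, with the morphisms just described. The group $\mathrm{Aut}(k[x])$ of $k$-algebra automorphisms is the $ax+b$ group: every automorphism has the form $x \mapsto s x + t$ with $s, t \in k$, $s \ne 0$. Its Hopf algebra of coordinate functions is the commutative algebra $\mathcal{O}(\mathrm{Aut}(k[x])) = k[s, s^{-1}, t]$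 with $\Delta(s) = s \otimes s$, $\Delta(t) = t \otimes s + 1 \otimes t$, $\epsilon(s) = 1$, $\epsilon(t) = 0$, $S(s) = s^{-1}$, $S(t) = -t s^{-1}$. A quantum group contains another as a (quantum) subgroup when there is a surjective Hopf algebra morphism from the Hopf algebra of the former onto that of the latter. *)

theory Defs
  imports "HOL-Algebra.UnivPoly" "HOL-Algebra.QuotRing"
begin

section \<open>Noncommutative unital algebras over a field\<close>

text \<open>
  The locale \<^locale>\<open>algebra\<close> of the library demands a commutative multiplication, so the
  noncommutative notion is introduced here on the same record \<open>module\<close>.
\<close>

locale nc_algebra = K?: field K + module K A + A?: ring A
  for K (structure) and A (structure) +
  assumes smult_mult_left:
      "\<lbrakk>c \<in> carrier K; x \<in> carrier A; y \<in> carrier A\<rbrakk>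
        \<Longrightarrow> (c \<odot>\<^bsub>A\<^esub> x) \<otimes>\<^bsub>A\<^esub> y = c \<odot>\<^bsub>A\<^esub> (x \<otimes>\<^bsub>A\<^esub> y)"
    and smult_mult_right:
      "\<lbrakk>c \<in> carrier K; x \<in> carrier A; y \<in> carrier A\<rbrakk>
        \<Longrightarrow> x \<otimes>\<^bsub>A\<^esub> (c \<odot>\<^bsub>A\<^esub> y) = c \<odot>\<^bsub>A\<^esub> (x \<otimes>\<^bsub>A\<^esub> y)"

definition lin_maps ::
  "('k, 'm) ring_scheme \<Rightarrow> ('k, 'a, 'x) module_scheme \<Rightarrow> ('k, 'b, 'y) module_scheme \<Rightarrow> ('a \<Rightarrow> 'b) set"
  where "lin_maps K V W = {f \<in> carrier V \<rightarrow> carrier W.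
    (\<forall>x\<in>carrier V. \<forall>y\<in>carrier V. f (x \<oplus>\<^bsub>V\<^esub> y) = f x \<oplus>\<^bsub>W\<^esub> f y) \<and>
    (\<forall>c\<in>carrier K. \<forall>x\<in>carrier V. f (c \<odot>\<^bsub>V\<^esub> x) = c \<odot>\<^bsub>W\<^esub> f x)}"

definition alg_homs ::
  "('k, 'm) ring_scheme \<Rightarrow> ('k, 'a, 'x) module_scheme \<Rightarrow> ('k, 'b, 'y) module_scheme \<Rightarrow> ('a \<Rightarrow> 'b) set"
  where "alg_homs K A B = ring_hom A B \<inter> lin_maps K A B"

text \<open>The algebra homomorphism determined by the listed values on generators.\<close>

definition hom_ext ::
  "('k, 'm) ring_scheme \<Rightarrow> ('k, 'a, 'x) module_scheme \<Rightarrow> ('k, 'b, 'y) module_scheme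
    \<Rightarrow> ('a \<times> 'b) list \<Rightarrow> 'a \<Rightarrow> 'b"
  where "hom_ext K A B vs =
    (THE f. f \<in> alg_homs K A B \<and> f \<in> extensional (carrier A) \<and> (\<forall>(x, y) \<in> set vs. f x = y))"

definition lin_span ::
  "('k, 'm) ring_scheme \<Rightarrow> ('k, 'a, 'x) module_scheme \<Rightarrow> 'a set \<Rightarrow> 'a set"
  where "lin_span K V S = \<Inter>{U. submodule U K V \<and> S \<subseteq> U}"

definition base_alg :: "('k, 'm) ring_scheme \<Rightarrow> ('k, 'k) module"
  where "base_alg K =
    \<lparr>carrier = carrier K, mult = mult K, one = \<one>\<^bsub>K\<^esub>, zero = \<zero>\<^bsub>K\<^esub>, add = add K, smult = mult K\<rparr>"

definition opp_alg :: "('k, 'a, 'x) module_scheme \<Rightarrow> ('k, 'a, 'x) module_scheme"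
  where "opp_alg A = A\<lparr>mult := \<lambda>x y. y \<otimes>\<^bsub>A\<^esub> x\<rparr>"

definition alg_quot ::
  "('k, 'a, 'x) module_scheme \<Rightarrow> 'a set \<Rightarrow> ('k, 'a set) module"
  where "alg_quot A I =
    \<lparr>carrier = carrier (A Quot I), mult = mult (A Quot I), one = one (A Quot I),
     zero = zero (A Quot I), add = add (A Quot I),
     smult = (\<lambda>c X. \<Union>x\<in>X. I +>\<^bsub>A\<^esub> (c \<odot>\<^bsub>A\<^esub> x))\<rparr>"

section \<open>Monoid algebras and presentations\<close>

definition supp :: "('k, 'm) ring_scheme \<Rightarrow> ('w \<Rightarrow> 'k) \<Rightarrow> 'w set"
  where "supp K f = {w. f w \<noteq> \<zero>\<^bsub>K\<^esub>}"

definition monoid_alg ::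
  "('k, 'm) ring_scheme \<Rightarrow> ('w, 'n) monoid_scheme \<Rightarrow> ('k, 'w \<Rightarrow> 'k) module"
  where "monoid_alg K M =
    \<lparr>carrier = {f \<in> UNIV \<rightarrow> carrier K. supp K f \<subseteq> carrier M \<and> finite (supp K f)},
     mult = (\<lambda>f g w. \<Oplus>\<^bsub>K\<^esub>p \<in> {(u, v). u \<in> supp K f \<and> v \<in> supp K g \<and> u \<otimes>\<^bsub>M\<^esub> v = w}.
       f (fst p) \<otimes>\<^bsub>K\<^esub> g (snd p)),
     one = (\<lambda>w. if w = \<one>\<^bsub>M\<^esub> then \<one>\<^bsub>K\<^esub> else \<zero>\<^bsub>K\<^esub>),
     zero = (\<lambda>w. \<zero>\<^bsub>K\<^esub>),
     add = (\<lambda>f g w. f w \<oplus>\<^bsub>K\<^esub> g w),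
     smult = (\<lambda>c f w. c \<otimes>\<^bsub>K\<^esub> f w)\<rparr>"

definition basis_elt :: "('k, 'm) ring_scheme \<Rightarrow> 'w \<Rightarrow> 'w \<Rightarrow> 'k"
  where "basis_elt K u = (\<lambda>w. if w = u then \<one>\<^bsub>K\<^esub> else \<zero>\<^bsub>K\<^esub>)"

definition presented_alg ::
  "('k, 'm) ring_scheme \<Rightarrow> ('w, 'n) monoid_scheme \<Rightarrow> ('w \<Rightarrow> 'k) set \<Rightarrow> ('k, ('w \<Rightarrow> 'k) set) module"
  where "presented_alg K M R = alg_quot (monoid_alg K M) (Idl\<^bsub>monoid_alg K M\<^esub> R)"

definition presented_elt ::
  "('k, 'm) ring_scheme \<Rightarrow> ('w, 'n) monoid_scheme \<Rightarrow> ('w \<Rightarrow> 'k) set \<Rightarrow> 'w \<Rightarrow> ('w \<Rightarrow> 'k) set"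
  where "presented_elt K M R w = (Idl\<^bsub>monoid_alg K M\<^esub> R) +>\<^bsub>monoid_alg K M\<^esub> basis_elt K w"

section \<open>Tensor products\<close>

type_synonym ('k, 'a, 'b) tens = "('a \<times> 'b \<Rightarrow> 'k) set"

text \<open>
  \<open>A \<otimes> B\<close> is the usual quotient of the vector space with basis \<open>carrier A \<times> carrier B\<close> by the
  bilinearity relations.  That vector space is the monoid algebra of the product of the
  multiplicative monoids of \<open>A\<close> and \<open>B\<close>; multiplying a bilinearity relation by a basis vector
  gives another one, so the two-sided ideal they generate is just their linear span, and the
  quotient carries the multiplication \<open>(a \<otimes> b)(a' \<otimes> b') = aa' \<otimes> bb'\<close>.
\<close>

definition tensor_rels ::
  "('k, 'm) ring_scheme \<Rightarrow> ('k, 'a, 'x) module_scheme \<Rightarrow> ('k, 'b, 'y) module_scheme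
    \<Rightarrow> ('a \<times> 'b \<Rightarrow> 'k) set"
  where "tensor_rels K A B = (let F = monoid_alg K (A \<times>\<times> B); e = basis_elt K in
    {e (x \<oplus>\<^bsub>A\<^esub> x', y) \<ominus>\<^bsub>F\<^esub> (e (x, y) \<oplus>\<^bsub>F\<^esub> e (x', y)) |x x' y.
       x \<in> carrier A \<and> x' \<in> carrier A \<and> y \<in> carrier B} \<union>
    {e (x, y \<oplus>\<^bsub>B\<^esub> y') \<ominus>\<^bsub>F\<^esub> (e (x, y) \<oplus>\<^bsub>F\<^esub> e (x, y')) |x y y'.
       x \<in> carrier A \<and> y \<in> carrier B \<and> y' \<in> carrier B} \<union>
    {e (c \<odot>\<^bsub>A\<^esub> x, y) \<ominus>\<^bsub>F\<^esub> c \<odot>\<^bsub>F\<^esub> e (x, y) |c x y.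
       c \<in> carrier K \<and> x \<in> carrier A \<and> y \<in> carrier B} \<union>
    {e (x, c \<odot>\<^bsub>B\<^esub> y) \<ominus>\<^bsub>F\<^esub> c \<odot>\<^bsub>F\<^esub> e (x, y) |c x y.
       c \<in> carrier K \<and> x \<in> carrier A \<and> y \<in> carrier B})"

definition tensor ::
  "('k, 'm) ring_scheme \<Rightarrow> ('k, 'a, 'x) module_scheme \<Rightarrow> ('k, 'b, 'y) module_scheme
    \<Rightarrow> ('k, ('k, 'a, 'b) tens) module"
  where "tensor K A B = presented_alg K (A \<times>\<times> B) (tensor_rels K A B)"

definition ten ::
  "('k, 'm) ring_scheme \<Rightarrow> ('k, 'a, 'x) module_scheme \<Rightarrow> ('k, 'b, 'y) module_scheme
    \<Rightarrow> 'a \<Rightarrow> 'b \<Rightarrow> ('k, 'a, 'b) tens"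
  where "ten K A B x y = presented_elt K (A \<times>\<times> B) (tensor_rels K A B) (x, y)"

text \<open>
  The linear map \<open>A \<otimes> B \<rightarrow> W\<close> induced by a bilinear map \<open>\<beta>\<close>: elements of \<open>A \<otimes> B\<close> are cosets, and
  for bilinear \<open>\<beta>\<close> the value does not depend on the representative \<open>F\<close>.
\<close>

definition tensor_lift ::
  "('k, 'm) ring_scheme \<Rightarrow> ('k, 'c, 'z) module_scheme \<Rightarrow> ('a \<Rightarrow> 'b \<Rightarrow> 'c) \<Rightarrow> ('k, 'a, 'b) tens \<Rightarrow> 'c"
  where "tensor_lift K W \<beta> X =
    the_elem ((\<lambda>F. \<Oplus>\<^bsub>W\<^esub>p \<in> supp K F. F p \<odot>\<^bsub>W\<^esub> \<beta> (fst p) (snd p)) ` X)"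

text \<open>The map \<open>f \<otimes> g\<close> for linear maps \<open>f\<close> into \<open>A\<close> and \<open>g\<close> into \<open>B\<close>.\<close>

definition tensor_map ::
  "('k, 'm) ring_scheme \<Rightarrow> ('k, 'a, 'x) module_scheme \<Rightarrow> ('k, 'b, 'y) module_scheme
    \<Rightarrow> ('c \<Rightarrow> 'a) \<Rightarrow> ('d \<Rightarrow> 'b) \<Rightarrow> ('k, 'c, 'd) tens \<Rightarrow> ('k, 'a, 'b) tens"
  where "tensor_map K A B f g = tensor_lift K (tensor K A B) (\<lambda>x y. ten K A B (f x) (g y))"

text \<open>The canonical isomorphism \<open>(A \<otimes> B) \<otimes> C \<rightarrow> A \<otimes> (B \<otimes> C)\<close>.\<close>

definition tensor_assoc ::
  "('k, 'm) ring_scheme \<Rightarrow> ('k, 'a, 'x) module_scheme \<Rightarrow> ('k, 'b, 'y) module_scheme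
    \<Rightarrow> ('k, 'c, 'z) module_scheme
    \<Rightarrow> ('k, ('k, 'a, 'b) tens, 'c) tens \<Rightarrow> ('k, 'a, ('k, 'b, 'c) tens) tens"
  where "tensor_assoc K A B C = (let T = tensor K A (tensor K B C) in
    tensor_lift K T (\<lambda>u z. tensor_lift K T (\<lambda>x y. ten K A (tensor K B C) x (ten K B C y z)) u))"

section \<open>Hopf algebras, coactions and quantum transformation groups\<close>

record ('k, 'a) hopf = "('k, 'a) module" +
  comult :: "'a \<Rightarrow> ('k, 'a, 'a) tens"
  counit :: "'a \<Rightarrow> 'k"
  antipode :: "'a \<Rightarrow> 'a"

definition hopf_of ::
  "('k, 'a, 'x) module_scheme \<Rightarrow> ('a \<Rightarrow> ('k, 'a, 'a) tens) \<Rightarrow> ('a \<Rightarrow> 'k) \<Rightarrow> ('a \<Rightarrow> 'a) \<Rightarrow> ('k, 'a) hopf"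
  where "hopf_of A \<Delta> \<epsilon> S =
    \<lparr>carrier = carrier A, mult = mult A, one = one A, zero = zero A, add = add A,
     smult = smult A, comult = \<Delta>, counit = \<epsilon>, antipode = S\<rparr>"

locale hopf_algebra = nc_algebra K H
  for K :: "('k, 'm) ring_scheme" (structure) and H :: "('k, 'a, 'x) hopf_scheme" (structure) +
  assumes comult_hom: "comult H \<in> alg_homs K H (tensor K H H)"
    and counit_hom: "counit H \<in> alg_homs K H (base_alg K)"
    and coassoc: "h \<in> carrier H \<Longrightarrow>
      tensor_map K H (tensor K H H) id (comult H) (comult H h) =
      tensor_assoc K H H H (tensor_map K (tensor K H H) H (comult H) id (comult H h))"
    and counit_left: "h \<in> carrier H \<Longrightarrow>
      tensor_lift K H (\<lambda>x y. counit H x \<odot>\<^bsub>H\<^esub> y) (comult H h) = h"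
    and counit_right: "h \<in> carrier H \<Longrightarrow>
      tensor_lift K H (\<lambda>x y. counit H y \<odot>\<^bsub>H\<^esub> x) (comult H h) = h"
    and antipode_lin: "antipode H \<in> lin_maps K H H"
    and antipode_left: "h \<in> carrier H \<Longrightarrow>
      tensor_lift K H (\<lambda>x y. antipode H x \<otimes>\<^bsub>H\<^esub> y) (comult H h) = counit H h \<odot>\<^bsub>H\<^esub> \<one>\<^bsub>H\<^esub>"
    and antipode_right: "h \<in> carrier H \<Longrightarrow>
      tensor_lift K H (\<lambda>x y. x \<otimes>\<^bsub>H\<^esub> antipode H y) (comult H h) = counit H h \<odot>\<^bsub>H\<^esub> \<one>\<^bsub>H\<^esub>"

definition hopf_homs ::
  "('k, 'm) ring_scheme \<Rightarrow> ('k, 'a, 'x) hopf_scheme \<Rightarrow> ('k, 'b, 'y) hopf_scheme \<Rightarrow> ('a \<Rightarrow> 'b) set"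
  where "hopf_homs K H L = {\<pi> \<in> alg_homs K H L. \<forall>h\<in>carrier H.
    comult L (\<pi> h) = tensor_map K L L \<pi> \<pi> (comult H h) \<and>
    counit L (\<pi> h) = counit H h \<and>
    antipode L (\<pi> h) = \<pi> (antipode H h)}"

locale quantum_transformation_group = H: hopf_algebra K H + B: nc_algebra K B
  for K :: "('k, 'm) ring_scheme" (structure)
    and B :: "('k, 'b, 'y) module_scheme"
    and H :: "('k, 'a, 'x) hopf_scheme"
    and \<alpha> :: "'b \<Rightarrow> ('k, 'b, 'a) tens" +
  assumes coact_hom: "\<alpha> \<in> alg_homs K B (tensor K B H)"
    and coact_coassoc: "p \<in> carrier B \<Longrightarrow>
      tensor_map K B (tensor K H H) id (comult H) (\<alpha> p) =
      tensor_assoc K B H H (tensor_map K (tensor K B H) H \<alpha> id (\<alpha> p))"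
    and coact_counit: "p \<in> carrier B \<Longrightarrow>
      tensor_lift K B (\<lambda>q h. counit H h \<odot>\<^bsub>B\<^esub> q) (\<alpha> p) = p"

text \<open>Note the direction: a morphism \<open>(H\<^sub>1, \<alpha>\<^sub>1) \<rightarrow> (H\<^sub>2, \<alpha>\<^sub>2)\<close> is a map \<open>H\<^sub>2 \<rightarrow> H\<^sub>1\<close>.  Being maps between
  carriers, morphisms are normalised to be \<open>undefined\<close> off the carrier.\<close>

definition qtg_morphisms ::
  "('k, 'm) ring_scheme \<Rightarrow> ('k, 'b, 'y) module_scheme
    \<Rightarrow> ('k, 'a1, 'x1) hopf_scheme \<times> ('b \<Rightarrow> ('k, 'b, 'a1) tens)
    \<Rightarrow> ('k, 'a2, 'x2) hopf_scheme \<times> ('b \<Rightarrow> ('k, 'b, 'a2) tens) \<Rightarrow> ('a2 \<Rightarrow> 'a1) set"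
  where "qtg_morphisms K B = (\<lambda>(H1, \<alpha>1) (H2, \<alpha>2).
    {\<pi> \<in> hopf_homs K H2 H1 \<inter> extensional (carrier H2).
      \<forall>p\<in>carrier B. \<alpha>1 p = tensor_map K B H1 id \<pi> (\<alpha>2 p)})"

definition poly_upto :: "('k, 'm) ring_scheme \<Rightarrow> nat \<Rightarrow> (nat \<Rightarrow> 'k) set"
  where "poly_upto K n = {p \<in> carrier (UP K). deg K p \<le> n}"

definition poly_X :: "('k, 'm) ring_scheme \<Rightarrow> nat \<Rightarrow> 'k"
  where "poly_X K = monom (UP K) \<one>\<^bsub>K\<^esub> 1"

text \<open>
  \<open>k[x]\<^sub>n \<otimes> H\<close> is rendered as the subspace of \<open>k[x] \<otimes> H\<close> spanned by its elementary tensors, which is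
  legitimate over a field.
\<close>

definition poly_qtg ::
  "('k, 'm) ring_scheme \<Rightarrow> ('k, 'a, 'x) hopf_scheme \<times> ((nat \<Rightarrow> 'k) \<Rightarrow> ('k, nat \<Rightarrow> 'k, 'a) tens) \<Rightarrow> bool"
  where "poly_qtg K = (\<lambda>(H, \<alpha>). quantum_transformation_group K (UP K) H \<alpha> \<and>
    (\<forall>n. \<alpha> ` poly_upto K n \<subseteq>
      lin_span K (tensor K (UP K) H) {ten K (UP K) H p h |p h. p \<in> poly_upto K n \<and> h \<in> carrier H}))"

section \<open>The algebra generated by \<open>a\<close>, \<open>a\<^sup>-\<^sup>1\<close>, \<open>b\<close>\<close>

datatype gen = Gen_a | Gen_a_inv | Gen_b

definition words :: "gen list monoid"
  where "words = \<lparr>carrier = UNIV, mult = (@), one = []\<rparr>"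

definition QA_rels :: "('k, 'm) ring_scheme \<Rightarrow> (gen list \<Rightarrow> 'k) set"
  where "QA_rels K = (let F = monoid_alg K words in
    {basis_elt K [Gen_a, Gen_a_inv] \<ominus>\<^bsub>F\<^esub> \<one>\<^bsub>F\<^esub>, basis_elt K [Gen_a_inv, Gen_a] \<ominus>\<^bsub>F\<^esub> \<one>\<^bsub>F\<^esub>})"

definition QA_alg :: "('k, 'm) ring_scheme \<Rightarrow> ('k, (gen list \<Rightarrow> 'k) set) module"
  where "QA_alg K = presented_alg K words (QA_rels K)"

definition qa :: "('k, 'm) ring_scheme \<Rightarrow> (gen list \<Rightarrow> 'k) set"
  where "qa K = presented_elt K words (QA_rels K) [Gen_a]"

definition qa_inv :: "('k, 'm) ring_scheme \<Rightarrow> (gen list \<Rightarrow> 'k) set"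
  where "qa_inv K = presented_elt K words (QA_rels K) [Gen_a_inv]"

definition qb :: "('k, 'm) ring_scheme \<Rightarrow> (gen list \<Rightarrow> 'k) set"
  where "qb K = presented_elt K words (QA_rels K) [Gen_b]"

text \<open>The antipode is the algebra homomorphism to the opposite algebra, i.e. the
  antihomomorphism, with the given values.\<close>

definition QA :: "('k, 'm) ring_scheme \<Rightarrow> ('k, (gen list \<Rightarrow> 'k) set) hopf"
  where "QA K = (let A = QA_alg K; T = tensor K A A; t = ten K A A; a = qa K; b = qb K in
    hopf_of A
      (hom_ext K A T [(a, t a a), (b, t b a \<oplus>\<^bsub>T\<^esub> t \<one>\<^bsub>A\<^esub> b)])
      (hom_ext K A (base_alg K) [(a, \<one>\<^bsub>K\<^esub>), (b, \<zero>\<^bsub>K\<^esub>)])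
      (hom_ext K A (opp_alg A) [(a, qa_inv K), (b, \<ominus>\<^bsub>A\<^esub> (b \<otimes>\<^bsub>A\<^esub> qa_inv K))]))"

definition QA_act :: "('k, 'm) ring_scheme \<Rightarrow> (nat \<Rightarrow> 'k) \<Rightarrow> ('k, nat \<Rightarrow> 'k, (gen list \<Rightarrow> 'k) set) tens"
  where "QA_act K = (let P = UP K; A = QA K; T = tensor K P A in
    hom_ext K P T [(poly_X K, ten K P A (poly_X K) (qa K) \<oplus>\<^bsub>T\<^esub> ten K P A \<one>\<^bsub>P\<^esub> (qb K))])"

section \<open>Coordinate functions on the \<open>ax + b\<close> group\<close>

text \<open>\<open>k[s, s\<^sup>-\<^sup>1, t]\<close> is the monoid algebra of the monoid of exponents \<open>(i, j)\<close> of monomials \<open>s\<^sup>i t\<^sup>j\<close>.\<close>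

definition exponents :: "(int \<times> nat) monoid"
  where "exponents = \<lparr>carrier = UNIV, mult = (\<lambda>(i, j) (i', j'). (i + i', j + j')), one = (0, 0)\<rparr>"

definition OA_alg :: "('k, 'm) ring_scheme \<Rightarrow> ('k, int \<times> nat \<Rightarrow> 'k) module"
  where "OA_alg K = monoid_alg K exponents"

definition os :: "('k, 'm) ring_scheme \<Rightarrow> int \<times> nat \<Rightarrow> 'k"
  where "os K = basis_elt K (1, 0)"

definition os_inv :: "('k, 'm) ring_scheme \<Rightarrow> int \<times> nat \<Rightarrow> 'k"
  where "os_inv K = basis_elt K (-1, 0)"

definition ot :: "('k, 'm) ring_scheme \<Rightarrow> int \<times> nat \<Rightarrow> 'k"
  where "ot K = basis_elt K (0, 1)"

definition OA :: "('k, 'm) ring_scheme \<Rightarrow> ('k, int \<times> nat \<Rightarrow> 'k) hopf"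
  where "OA K = (let A = OA_alg K; T = tensor K A A; e = ten K A A; s = os K; t = ot K in
    hopf_of A
      (hom_ext K A T [(s, e s s), (t, e t s \<oplus>\<^bsub>T\<^esub> e \<one>\<^bsub>A\<^esub> t)])
      (hom_ext K A (base_alg K) [(s, \<one>\<^bsub>K\<^esub>), (t, \<zero>\<^bsub>K\<^esub>)])
      (hom_ext K A (opp_alg A) [(s, os_inv K), (t, \<ominus>\<^bsub>A\<^esub> (t \<otimes>\<^bsub>A\<^esub> os_inv K))]))"

end

theory Submission
  imports Defs
begin

text \<open>
  Homomorphisms out of \<open>A\<close>, \<open>k[s, s\<^sup>-\<^sup>1, t]\<close>, \<open>k[x]\<close> and tensor products are all obtained from linear
  extension along a monoid homomorphism, and two of them agree as soon as they agree on generators;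
  this reduces the Hopf algebra and coaction identities to the generators.  Only the antipode axioms,
  which are not identities between homomorphisms, need a separate argument: the elements satisfying
  them form a subalgebra.

  If \<open>\<alpha>\<^sub>0\<close> preserves the polynomials of degree at most 1, then \<open>\<alpha>\<^sub>0(x) = x \<otimes> u + 1 \<otimes> v\<close>.  Linear
  independence of \<open>1\<close> and \<open>x\<close> turns the coaction axioms into \<open>\<Delta>(u) = u \<otimes> u\<close>, \<open>\<epsilon>(u) = 1\<close>,
  \<open>\<Delta>(v) = v \<otimes> u + 1 \<otimes> v\<close>, \<open>\<epsilon>(v) = 0\<close>.  The antipode inverts the group-like \<open>u\<close>, so
  \<open>a \<mapsto> u\<close>, \<open>b \<mapsto> v\<close> defines the required morphism and is the only choice.
\<close>

text \<open>The coaction axioms, compared at \<open>1\<close> and \<open>x\<close>, determine the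
  coproduct and the counit of \<open>u\<close> and \<open>v\<close> but produce no equation relating
  \<open>u\<close> and \<open>v\<close> to each other. This is why the universal algebra is free
  apart from the inverse of \<open>a\<close>. The inverse itself is not visible in the coaction; it
  enters through the antipode of the target. Conversely a morphism has to respect antipodes as well,
  and this comes for free from the uniqueness of convolution inverses. The obstacle on the technical
  side is the tensor product. It is a quotient by a two-sided ideal, whereas a bilinear map induces
  a map that is only linear, so its vanishing on the whole ideal does not follow from its vanishing
  on the relations alone. Once this is settled, all work with tensors takes place on pure tensors.
  The free algebra and \<open>k[s, s', t]\<close> carry the same formulas on generators, so their
  Hopf axioms are proved once, for any algebra generated by an invertible element and one further
  element.\<close>

section \<open>Linear maps, homomorphisms and elementary constructions of algebras\<close>

lemma lin_mapsI:
  assumes "\<And>x. x \<in> carrier V \<Longrightarrow> f x \<in> carrier W"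
    and "\<And>x y. x \<in> carrier V \<Longrightarrow> y \<in> carrier V \<Longrightarrow> f (x \<oplus>\<^bsub>V\<^esub> y) = f x \<oplus>\<^bsub>W\<^esub> f y"
    and "\<And>c x. c \<in> carrier K \<Longrightarrow> x \<in> carrier V \<Longrightarrow> f (c \<odot>\<^bsub>V\<^esub> x) = c \<odot>\<^bsub>W\<^esub> f x"
  shows "f \<in> lin_maps K V W"
  using assms by (auto simp: lin_maps_def)

lemma lin_mapsD:
  assumes "f \<in> lin_maps K V W"
  shows "x \<in> carrier V \<Longrightarrow> f x \<in> carrier W"
    and "x \<in> carrier V \<Longrightarrow> y \<in> carrier V \<Longrightarrow> f (x \<oplus>\<^bsub>V\<^esub> y) = f x \<oplus>\<^bsub>W\<^esub> f y"
    and "c \<in> carrier K \<Longrightarrow> x \<in> carrier V \<Longrightarrow> f (c \<odot>\<^bsub>V\<^esub> x) = c \<odot>\<^bsub>W\<^esub> f x"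
  using assms by (auto simp: lin_maps_def)

lemma lin_maps_comp:
  "\<lbrakk>f \<in> lin_maps K U V; g \<in> lin_maps K V W\<rbrakk> \<Longrightarrow> (\<lambda>x. g (f x)) \<in> lin_maps K U W"
  by (auto simp: lin_maps_def Pi_def)

lemma lin_maps_zero:
  assumes "f \<in> lin_maps K V W" "abelian_group V" "abelian_group W"
  shows "f \<zero>\<^bsub>V\<^esub> = \<zero>\<^bsub>W\<^esub>"
proof -
  interpret V: abelian_group V by fact
  interpret W: abelian_group W by fact
  have "f \<zero>\<^bsub>V\<^esub> \<oplus>\<^bsub>W\<^esub> f \<zero>\<^bsub>V\<^esub> = f \<zero>\<^bsub>V\<^esub>"
    using lin_mapsD(2)[OF assms(1), of "\<zero>\<^bsub>V\<^esub>" "\<zero>\<^bsub>V\<^esub>"] by simp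
  then show ?thesis using lin_mapsD(1)[OF assms(1), of "\<zero>\<^bsub>V\<^esub>"] by (simp add: W.add.l_cancel_one)
qed

lemma lin_maps_uminus:
  assumes "f \<in> lin_maps K V W" "abelian_group V" "abelian_group W" "x \<in> carrier V"
  shows "f (\<ominus>\<^bsub>V\<^esub> x) = \<ominus>\<^bsub>W\<^esub> f x"
proof -
  interpret V: abelian_group V by fact
  interpret W: abelian_group W by fact
  have "f (\<ominus>\<^bsub>V\<^esub> x) \<oplus>\<^bsub>W\<^esub> f x = f (\<ominus>\<^bsub>V\<^esub> x \<oplus>\<^bsub>V\<^esub> x)"
    using assms(4) lin_mapsD(2)[OF assms(1)] by simp
  also have "\<dots> = \<zero>\<^bsub>W\<^esub>" using assms lin_maps_zero[OF assms(1-3)] by (simp add: V.l_neg)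
  finally show ?thesis using assms lin_mapsD(1)[OF assms(1)]
    by (simp add: W.add.inv_equality)
qed

lemma lin_maps_diff:
  assumes "f \<in> lin_maps K V W" "abelian_group V" "abelian_group W" "x \<in> carrier V" "y \<in> carrier V"
  shows "f (x \<ominus>\<^bsub>V\<^esub> y) = f x \<ominus>\<^bsub>W\<^esub> f y"
  using assms lin_mapsD(2)[OF assms(1)] lin_maps_uminus[OF assms(1-3)]
  by (simp add: a_minus_def abelian_group.a_inv_closed)

lemma alg_homsI:
  assumes "f \<in> lin_maps K A B"
    and "\<And>x y. x \<in> carrier A \<Longrightarrow> y \<in> carrier A \<Longrightarrow> f (x \<otimes>\<^bsub>A\<^esub> y) = f x \<otimes>\<^bsub>B\<^esub> f y"
    and "f \<one>\<^bsub>A\<^esub> = \<one>\<^bsub>B\<^esub>"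
  shows "f \<in> alg_homs K A B"
  using assms by (auto simp: alg_homs_def ring_hom_def lin_maps_def)

lemma alg_homsD:
  assumes "f \<in> alg_homs K A B"
  shows "x \<in> carrier A \<Longrightarrow> f x \<in> carrier B"
    and "x \<in> carrier A \<Longrightarrow> y \<in> carrier A \<Longrightarrow> f (x \<oplus>\<^bsub>A\<^esub> y) = f x \<oplus>\<^bsub>B\<^esub> f y"
    and "c \<in> carrier K \<Longrightarrow> x \<in> carrier A \<Longrightarrow> f (c \<odot>\<^bsub>A\<^esub> x) = c \<odot>\<^bsub>B\<^esub> f x"
    and "x \<in> carrier A \<Longrightarrow> y \<in> carrier A \<Longrightarrow> f (x \<otimes>\<^bsub>A\<^esub> y) = f x \<otimes>\<^bsub>B\<^esub> f y"
    and "f \<one>\<^bsub>A\<^esub> = \<one>\<^bsub>B\<^esub>"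
  using assms by (auto simp: alg_homs_def ring_hom_def lin_maps_def)

lemma alg_homs_lin: "f \<in> alg_homs K A B \<Longrightarrow> f \<in> lin_maps K A B"
  by (simp add: alg_homs_def)

lemma alg_homs_comp:
  "\<lbrakk>f \<in> alg_homs K A B; g \<in> alg_homs K B C\<rbrakk> \<Longrightarrow> (\<lambda>x. g (f x)) \<in> alg_homs K A C"
  by (auto simp: alg_homs_def ring_hom_def lin_maps_def Pi_def)

lemma alg_homs_id: "(\<lambda>x. x) \<in> alg_homs K A A"
  by (auto simp: alg_homs_def ring_hom_def lin_maps_def)

lemma nc_algebraI:
  assumes "field K" "module K A" "ring A"
    and "\<And>c x y. \<lbrakk>c \<in> carrier K; x \<in> carrier A; y \<in> carrier A\<rbrakk>
        \<Longrightarrow> (c \<odot>\<^bsub>A\<^esub> x) \<otimes>\<^bsub>A\<^esub> y = c \<odot>\<^bsub>A\<^esub> (x \<otimes>\<^bsub>A\<^esub> y)"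
    and "\<And>c x y. \<lbrakk>c \<in> carrier K; x \<in> carrier A; y \<in> carrier A\<rbrakk>
        \<Longrightarrow> x \<otimes>\<^bsub>A\<^esub> (c \<odot>\<^bsub>A\<^esub> y) = c \<odot>\<^bsub>A\<^esub> (x \<otimes>\<^bsub>A\<^esub> y)"
  shows "nc_algebra K A"
  using assms by (simp add: nc_algebra_def nc_algebra_axioms_def)

lemma nc_algebraD:
  assumes "nc_algebra K A"
  shows "field K" "cring K" "module K A" "ring A" "abelian_group A" "monoid A"
  using assms
  by (auto simp: nc_algebra_def field_def domain_def ring_def module_def)

text \<open>\<open>hom_ext\<close> and \<open>qtg_morphisms\<close> demand maps that are
  \<open>undefined\<close> off the carrier; this passes the homomorphism property on to the
  restricted map. The hypothesis \<open>nc_algebra K A\<close> supplies closure of the carrier, so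
  that sums, products and scalar multiples are evaluated inside it.\<close>

lemma alg_homs_cong:
  assumes "f \<in> alg_homs K A B" "\<And>x. x \<in> carrier A \<Longrightarrow> g x = f x" "nc_algebra K A"
  shows "g \<in> alg_homs K A B"
proof -
  interpret A: nc_algebra K A by fact
  show ?thesis
    by (intro alg_homsI lin_mapsI) (simp_all add: assms(2) alg_homsD[OF assms(1)])
qed

lemma nc_algebra_base: "field K \<Longrightarrow> nc_algebra K (base_alg K)"
proof -
  assume K: "field K"
  interpret field K by fact
  have ab: "abelian_group (base_alg K)"
    by (rule abelian_groupI) (auto simp: base_alg_def a_ac intro: bexI[where x="\<ominus>\<^bsub>K\<^esub> x" for x] l_neg)
  show ?thesis
    by (intro nc_algebraI[OF K] moduleI ringI monoidI ab is_cring)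
      (auto simp: base_alg_def m_ac l_distr r_distr)
qed

lemma nc_algebra_opp:
  assumes "nc_algebra K A"
  shows "nc_algebra K (opp_alg A)"
proof -
  interpret A: nc_algebra K A by fact
  have ab: "abelian_group (opp_alg A)"
    by (rule abelian_groupI)
      (auto simp: opp_alg_def A.a_ac intro: bexI[where x="\<ominus>\<^bsub>A\<^esub> x" for x] A.l_neg)
  show ?thesis
    by (intro nc_algebraI[OF A.K.field_axioms] moduleI ringI monoidI ab A.K.is_cring)
      (auto simp: opp_alg_def A.m_assoc A.l_distr A.r_distr A.smult_l_distr A.smult_r_distr
        A.smult_assoc1 A.smult_mult_left A.smult_mult_right)
qed

lemma nc_algebra_hopf_of:
  assumes "nc_algebra K A"
  shows "nc_algebra K (hopf_of A D e S)"
proof -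
  interpret A: nc_algebra K A by fact
  have ab: "abelian_group (hopf_of A D e S)"
    by (rule abelian_groupI)
      (auto simp: hopf_of_def A.a_ac intro: bexI[where x="\<ominus>\<^bsub>A\<^esub> x" for x] A.l_neg)
  show ?thesis
    by (intro nc_algebraI[OF A.K.field_axioms] moduleI ringI monoidI ab A.K.is_cring)
      (auto simp: hopf_of_def A.m_assoc A.l_distr A.r_distr A.smult_l_distr A.smult_r_distr
        A.smult_assoc1 A.smult_mult_left A.smult_mult_right)
qed

section \<open>Monoid algebras\<close>

text \<open>The sum is literally the one inside \<open>tensor_lift\<close>, so maps on tensor
  products and maps on presented algebras both arise as \<open>the_elem\<close> of the image of a
  coset under a linear extension.\<close>

definition lin_ext ::
  "('k, 'm) ring_scheme \<Rightarrow> ('k, 'c, 'z) module_scheme \<Rightarrow> ('w \<Rightarrow> 'c) \<Rightarrow> ('w \<Rightarrow> 'k) \<Rightarrow> 'c"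
  where "lin_ext K W \<phi> f = (\<Oplus>\<^bsub>W\<^esub>w \<in> supp K f. f w \<odot>\<^bsub>W\<^esub> \<phi> w)"

locale monoid_algebra = K?: field K + M?: monoid M for K (structure) and M (structure)
begin

abbreviation F where "F \<equiv> monoid_alg K M"

lemma carrier_iff:
  "f \<in> carrier F \<longleftrightarrow> (\<forall>w. f w \<in> carrier K) \<and> supp K f \<subseteq> carrier M \<and> finite (supp K f)"
  by (auto simp: monoid_alg_def)

lemma F_simps [simp]:
  "(f \<oplus>\<^bsub>F\<^esub> g) = (\<lambda>w. f w \<oplus> g w)" "\<zero>\<^bsub>F\<^esub> = (\<lambda>w. \<zero>)" "c \<odot>\<^bsub>F\<^esub> f = (\<lambda>w. c \<otimes> f w)"
  "\<one>\<^bsub>F\<^esub> = basis_elt K \<one>\<^bsub>M\<^esub>"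
  by (auto simp: monoid_alg_def basis_elt_def)

lemma zero_closed_F: "(\<lambda>w. \<zero>) \<in> carrier F"
  by (simp add: carrier_iff supp_def)

lemma add_closed_F: "f \<in> carrier F \<Longrightarrow> g \<in> carrier F \<Longrightarrow> (\<lambda>w. f w \<oplus> g w) \<in> carrier F"
proof -
  assume f: "f \<in> carrier F" and g: "g \<in> carrier F"
  have "supp K (\<lambda>w. f w \<oplus> g w) \<subseteq> supp K f \<union> supp K g" by (auto simp: supp_def)
  then show ?thesis using f g by (auto simp: carrier_iff intro: finite_subset)
qed

lemma smult_closed_F: "c \<in> carrier K \<Longrightarrow> f \<in> carrier F \<Longrightarrow> (\<lambda>w. c \<otimes> f w) \<in> carrier F"
proof -
  assume c: "c \<in> carrier K" and f: "f \<in> carrier F"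
  have "supp K (\<lambda>w. c \<otimes> f w) \<subseteq> supp K f" using c by (auto simp: supp_def)
  then show ?thesis using c f by (auto simp: carrier_iff intro: finite_subset)
qed

lemma basis_closed [simp]: "u \<in> carrier M \<Longrightarrow> basis_elt K u \<in> carrier F"
  by (auto simp: carrier_iff supp_def basis_elt_def)

text \<open>Peels one basis vector at a time off the support. The cases are written with bare
  functions because \<open>F_simps\<close> rewrites the operations of \<open>F\<close> into that
  form.\<close>

lemma induct [consumes 1, case_names zero add basis]:
  assumes f: "f \<in> carrier F"
    and 0: "P (\<lambda>w. \<zero>)"
    and add: "\<And>f g. \<lbrakk>f \<in> carrier F; g \<in> carrier F; P f; P g\<rbrakk> \<Longrightarrow> P (\<lambda>w. f w \<oplus> g w)"
    and basis: "\<And>c u. \<lbrakk>c \<in> carrier K; u \<in> carrier M\<rbrakk> \<Longrightarrow> P (\<lambda>w. c \<otimes> basis_elt K u w)"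
  shows "P f"
proof -
  have "finite S \<Longrightarrow> \<forall>f\<in>carrier F. supp K f = S \<longrightarrow> P f" for S
  proof (induction S rule: finite_induct)
    case empty
    have "f = (\<lambda>w. \<zero>)" if "supp K f = {}" for f using that by (auto simp: supp_def)
    then show ?case using 0 by auto
  next
    case (insert u S)
    show ?case
    proof (intro ballI impI)
      fix f assume f: "f \<in> carrier F" and s: "supp K f = insert u S"
      have u: "u \<in> carrier M" and fc: "\<And>w. f w \<in> carrier K" using f s by (auto simp: carrier_iff)
      define g where "g = f(u := \<zero>)"
      have gs: "supp K g = S" using s insert(2) by (auto simp: g_def supp_def)
      have g: "g \<in> carrier F" using f s gs by (auto simp: carrier_iff g_def)
      have "P g" using insert.IH g gs by blast
      then have "P (\<lambda>w. g w \<oplus> f u \<otimes> basis_elt K u w)"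
        using add[OF g smult_closed_F[OF _ basis_closed[OF u]] _ basis[OF _ u]] fc by blast
      moreover have "(\<lambda>w. g w \<oplus> f u \<otimes> basis_elt K u w) = f"
        using fc by (auto simp: g_def basis_elt_def)
      ultimately show "P f" by simp
    qed
  qed
  then show ?thesis using f by (auto simp: carrier_iff)
qed

text \<open>The defining sum ranges over pairs that depend on \<open>w\<close> and on both supports.
  Padding it with zeros to a rectangle gives different factors a common index set, which is what the
  distributive laws need.\<close>

lemma mult_expand:
  assumes f: "f \<in> carrier F" and g: "g \<in> carrier F"
    and S: "finite S" "supp K f \<subseteq> S" and T: "finite T" "supp K g \<subseteq> T"
  shows "(f \<otimes>\<^bsub>F\<^esub> g) w =
    (\<Oplus>p \<in> S \<times> T. if fst p \<otimes>\<^bsub>M\<^esub> snd p = w then f (fst p) \<otimes> g (snd p) else \<zero>)"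
proof -
  have fc: "\<And>w. f w \<in> carrier K" and gc: "\<And>w. g w \<in> carrier K" using f g by (auto simp: carrier_iff)
  have "(f \<otimes>\<^bsub>F\<^esub> g) w = (\<Oplus>p \<in> {(u, v). u \<in> supp K f \<and> v \<in> supp K g \<and> u \<otimes>\<^bsub>M\<^esub> v = w}.
      f (fst p) \<otimes> g (snd p))" by (simp add: monoid_alg_def)
  also have "\<dots> = (\<Oplus>p \<in> S \<times> T. if fst p \<otimes>\<^bsub>M\<^esub> snd p = w then f (fst p) \<otimes> g (snd p) else \<zero>)"
    using S T by (intro K.add.finprod_mono_neutral_cong_left)
      (auto simp: fc gc supp_def split: if_splits)
  finally show ?thesis .
qed

lemma mult_closed_F:
  assumes f: "f \<in> carrier F" and g: "g \<in> carrier F"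
  shows "f \<otimes>\<^bsub>F\<^esub> g \<in> carrier F"
proof -
  have fc: "\<And>w. f w \<in> carrier K" and gc: "\<And>w. g w \<in> carrier K" using f g by (auto simp: carrier_iff)
  let ?T = "(\<lambda>p. fst p \<otimes>\<^bsub>M\<^esub> snd p) ` (supp K f \<times> supp K g)"
  have fin: "finite (supp K f)" "finite (supp K g)" using f g by (auto simp: carrier_iff)
  note e = mult_expand[OF f g fin(1) order_refl fin(2) order_refl]
  have "supp K (f \<otimes>\<^bsub>F\<^esub> g) \<subseteq> ?T"
  proof
    fix w assume w: "w \<in> supp K (f \<otimes>\<^bsub>F\<^esub> g)"
    show "w \<in> ?T"
    proof (rule ccontr)
      assume "w \<notin> ?T"
      then have "(f \<otimes>\<^bsub>F\<^esub> g) w = \<zero>" unfolding e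
        by (intro K.add.finprod_one_eqI) auto
      then show False using w by (simp add: supp_def)
    qed
  qed
  moreover have "?T \<subseteq> carrier M" using f g by (auto simp: carrier_iff subset_iff)
  moreover have "finite ?T" using fin by simp
  moreover have "(f \<otimes>\<^bsub>F\<^esub> g) w \<in> carrier K" for w unfolding e
    by (intro K.finsum_closed) (auto simp: fc gc)
  ultimately show ?thesis unfolding carrier_iff by (meson finite_subset subset_trans)
qed

lemma basis_mult:
  assumes u: "u \<in> carrier M" and v: "v \<in> carrier M"
  shows "basis_elt K u \<otimes>\<^bsub>F\<^esub> basis_elt K v = basis_elt K (u \<otimes>\<^bsub>M\<^esub> v)"
proof
  fix w
  have s: "supp K (basis_elt K u) \<subseteq> {u}" for u by (auto simp: supp_def basis_elt_def)
  show "(basis_elt K u \<otimes>\<^bsub>F\<^esub> basis_elt K v) w = basis_elt K (u \<otimes>\<^bsub>M\<^esub> v) w"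
    by (subst mult_expand[OF basis_closed[OF u] basis_closed[OF v] _ s _ s])
      (auto simp: basis_elt_def)
qed

lemma F_l_distr:
  assumes "f \<in> carrier F" "g \<in> carrier F" "h \<in> carrier F"
  shows "(\<lambda>w. f w \<oplus> g w) \<otimes>\<^bsub>F\<^esub> h = (\<lambda>w. (f \<otimes>\<^bsub>F\<^esub> h) w \<oplus> (g \<otimes>\<^bsub>F\<^esub> h) w)"
proof
  fix w
  let ?S = "supp K f \<union> supp K g" let ?T = "supp K h"
  have c: "\<And>w. f w \<in> carrier K" "\<And>w. g w \<in> carrier K" "\<And>w. h w \<in> carrier K"
    and fin: "finite ?S" "finite ?T"
    using assms by (auto simp: carrier_iff)
  have s: "supp K (\<lambda>w. f w \<oplus> g w) \<subseteq> ?S" by (auto simp: supp_def)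
  show "((\<lambda>w. f w \<oplus> g w) \<otimes>\<^bsub>F\<^esub> h) w = (f \<otimes>\<^bsub>F\<^esub> h) w \<oplus> (g \<otimes>\<^bsub>F\<^esub> h) w"
    unfolding mult_expand[OF add_closed_F[OF assms(1,2)] assms(3) fin(1) s fin(2) order_refl]
      mult_expand[OF assms(1,3) fin(1) Un_upper1 fin(2) order_refl]
      mult_expand[OF assms(2,3) fin(1) Un_upper2 fin(2) order_refl]
    by (rule trans[OF K.finsum_cong'[OF refl] K.finsum_addf]) (auto simp: c K.l_distr)
qed

lemma F_r_distr:
  assumes "f \<in> carrier F" "g \<in> carrier F" "h \<in> carrier F"
  shows "h \<otimes>\<^bsub>F\<^esub> (\<lambda>w. f w \<oplus> g w) = (\<lambda>w. (h \<otimes>\<^bsub>F\<^esub> f) w \<oplus> (h \<otimes>\<^bsub>F\<^esub> g) w)"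
proof
  fix w
  let ?S = "supp K f \<union> supp K g" let ?T = "supp K h"
  have c: "\<And>w. f w \<in> carrier K" "\<And>w. g w \<in> carrier K" "\<And>w. h w \<in> carrier K"
    and fin: "finite ?S" "finite ?T"
    using assms by (auto simp: carrier_iff)
  have s: "supp K (\<lambda>w. f w \<oplus> g w) \<subseteq> ?S" by (auto simp: supp_def)
  show "(h \<otimes>\<^bsub>F\<^esub> (\<lambda>w. f w \<oplus> g w)) w = (h \<otimes>\<^bsub>F\<^esub> f) w \<oplus> (h \<otimes>\<^bsub>F\<^esub> g) w"
    unfolding mult_expand[OF assms(3) add_closed_F[OF assms(1,2)] fin(2) order_refl fin(1) s]
      mult_expand[OF assms(3,1) fin(2) order_refl fin(1) Un_upper1]
      mult_expand[OF assms(3,2) fin(2) order_refl fin(1) Un_upper2]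
    by (rule trans[OF K.finsum_cong'[OF refl] K.finsum_addf]) (auto simp: c K.r_distr)
qed

lemma F_smult_left:
  assumes "c \<in> carrier K" "f \<in> carrier F" "g \<in> carrier F"
  shows "(\<lambda>w. c \<otimes> f w) \<otimes>\<^bsub>F\<^esub> g = (\<lambda>w. c \<otimes> (f \<otimes>\<^bsub>F\<^esub> g) w)"
proof
  fix w
  have c: "\<And>w. f w \<in> carrier K" "\<And>w. g w \<in> carrier K"
    and fin: "finite (supp K f)" "finite (supp K g)"
    using assms by (auto simp: carrier_iff)
  have s: "supp K (\<lambda>w. c \<otimes> f w) \<subseteq> supp K f" using assms(1) by (auto simp: supp_def)
  show "((\<lambda>w. c \<otimes> f w) \<otimes>\<^bsub>F\<^esub> g) w = c \<otimes> (f \<otimes>\<^bsub>F\<^esub> g) w"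
    unfolding mult_expand[OF smult_closed_F[OF assms(1,2)] assms(3) fin(1) s fin(2) order_refl]
      mult_expand[OF assms(2,3) fin(1) order_refl fin(2) order_refl]
    by (subst K.finsum_rdistr)
      (use assms fin in \<open>auto simp: c K.m_assoc intro!: K.finsum_cong'\<close>)
qed

lemma F_smult_right:
  assumes "c \<in> carrier K" "f \<in> carrier F" "g \<in> carrier F"
  shows "f \<otimes>\<^bsub>F\<^esub> (\<lambda>w. c \<otimes> g w) = (\<lambda>w. c \<otimes> (f \<otimes>\<^bsub>F\<^esub> g) w)"
proof
  fix w
  have c: "\<And>w. f w \<in> carrier K" "\<And>w. g w \<in> carrier K"
    and fin: "finite (supp K f)" "finite (supp K g)"
    using assms by (auto simp: carrier_iff)
  have s: "supp K (\<lambda>w. c \<otimes> g w) \<subseteq> supp K g" using assms(1) by (auto simp: supp_def)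
  show "(f \<otimes>\<^bsub>F\<^esub> (\<lambda>w. c \<otimes> g w)) w = c \<otimes> (f \<otimes>\<^bsub>F\<^esub> g) w"
    unfolding mult_expand[OF assms(2) smult_closed_F[OF assms(1,3)] fin(1) order_refl fin(2) s]
      mult_expand[OF assms(2,3) fin(1) order_refl fin(2) order_refl]
    by (subst K.finsum_rdistr)
      (use assms fin in \<open>auto simp: c K.m_lcomm intro!: K.finsum_cong'\<close>)
qed

lemma abelian_group_F: "abelian_group F"
proof (rule abelian_groupI)
  fix f assume f: "f \<in> carrier F"
  have c: "f w \<in> carrier K" for w using f by (auto simp: carrier_iff)
  have "(\<lambda>w. \<ominus> \<one> \<otimes> f w) \<in> carrier F" using smult_closed_F[OF _ f, of "\<ominus> \<one>"] by simp
  moreover have "(\<lambda>w. \<ominus> \<one> \<otimes> f w) \<oplus>\<^bsub>F\<^esub> f = \<zero>\<^bsub>F\<^esub>"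
    using c by (simp add: K.l_minus K.l_neg)
  ultimately show "\<exists>g\<in>carrier F. g \<oplus>\<^bsub>F\<^esub> f = \<zero>\<^bsub>F\<^esub>" by blast
qed (auto simp: add_closed_F zero_closed_F, auto simp: carrier_iff K.a_ac)

text \<open>Both sides are linear in each argument, so the three inductions end in products of basis
  vectors, where the claim is associativity in the monoid.\<close>

lemma F_assoc:
  assumes "f \<in> carrier F" "g \<in> carrier F" "h \<in> carrier F"
  shows "f \<otimes>\<^bsub>F\<^esub> g \<otimes>\<^bsub>F\<^esub> h = f \<otimes>\<^bsub>F\<^esub> (g \<otimes>\<^bsub>F\<^esub> h)"
proof -
  have z: "(\<lambda>w. \<zero>) \<otimes>\<^bsub>F\<^esub> f = (\<lambda>w. \<zero>)" "f \<otimes>\<^bsub>F\<^esub> (\<lambda>w. \<zero>) = (\<lambda>w. \<zero>)" if "f \<in> carrier F" for f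
    by (auto simp: monoid_alg_def supp_def)
  have 1: "basis_elt K u \<otimes>\<^bsub>F\<^esub> basis_elt K v \<otimes>\<^bsub>F\<^esub> h = basis_elt K u \<otimes>\<^bsub>F\<^esub> (basis_elt K v \<otimes>\<^bsub>F\<^esub> h)"
    if "u \<in> carrier M" "v \<in> carrier M" for u v
    using assms(3)
    by (induction h rule: induct)
      (simp_all add: z F_r_distr F_smult_right mult_closed_F basis_mult that M.m_assoc)
  have 2: "basis_elt K u \<otimes>\<^bsub>F\<^esub> g \<otimes>\<^bsub>F\<^esub> h = basis_elt K u \<otimes>\<^bsub>F\<^esub> (g \<otimes>\<^bsub>F\<^esub> h)"
    if "u \<in> carrier M" for u
    using assms(2)
    by (induction g rule: induct)
      (simp_all add: z F_r_distr F_l_distr F_smult_right F_smult_left mult_closed_F 1 that assms)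
  show ?thesis
    using assms(1)
    by (induction f rule: induct)
      (simp_all add: z F_l_distr F_smult_left mult_closed_F 2 assms)
qed

lemma basis_one_l: "f \<in> carrier F \<Longrightarrow> basis_elt K \<one>\<^bsub>M\<^esub> \<otimes>\<^bsub>F\<^esub> f = f"
  by (induction f rule: induct)
    (simp_all add: F_r_distr F_smult_right basis_mult, simp add: monoid_alg_def supp_def)

lemma basis_one_r: "f \<in> carrier F \<Longrightarrow> f \<otimes>\<^bsub>F\<^esub> basis_elt K \<one>\<^bsub>M\<^esub> = f"
  by (induction f rule: induct)
    (simp_all add: F_l_distr F_smult_left basis_mult, simp add: monoid_alg_def supp_def)

lemma nc_algebra_F: "nc_algebra K F"
proof (rule nc_algebraI[OF K.field_axioms])
  show "ring F"
    by (intro ringI abelian_group_F monoidI)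
      (simp_all add: F_l_distr F_r_distr F_assoc mult_closed_F basis_one_l basis_one_r)
  show "module K F"
    by (intro moduleI abelian_group_F K.is_cring)
      (simp_all add: smult_closed_F, simp_all add: carrier_iff K.l_distr K.r_distr K.m_assoc)
qed (simp_all add: F_smult_left F_smult_right)

section \<open>Linear extension from a basis\<close>

lemma lin_ext_expand:
  assumes W: "module K W" and \<phi>: "\<And>u. u \<in> carrier M \<Longrightarrow> \<phi> u \<in> carrier W"
    and f: "f \<in> carrier F" and S: "finite S" "supp K f \<subseteq> S" "S \<subseteq> carrier M"
  shows "lin_ext K W \<phi> f = (\<Oplus>\<^bsub>W\<^esub>w \<in> S. f w \<odot>\<^bsub>W\<^esub> \<phi> w)"
proof -
  interpret W: module K W by fact
  have c: "f w \<in> carrier K" for w using f by (auto simp: carrier_iff)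
  show ?thesis unfolding lin_ext_def
    using S by (intro W.M.add.finprod_mono_neutral_cong_left) (auto simp: supp_def c \<phi> subset_iff)
qed

lemma lin_ext_lin:
  assumes W: "module K W" and \<phi>: "\<And>u. u \<in> carrier M \<Longrightarrow> \<phi> u \<in> carrier W"
  shows "lin_ext K W \<phi> \<in> lin_maps K F W"
proof (rule lin_mapsI)
  interpret W: module K W by fact
  fix f assume f: "f \<in> carrier F"
  then have c: "\<And>w. f w \<in> carrier K" and s: "supp K f \<subseteq> carrier M" "finite (supp K f)"
    by (auto simp: carrier_iff)
  show "lin_ext K W \<phi> f \<in> carrier W"
    unfolding lin_ext_def using c s \<phi> by (intro W.M.finsum_closed) auto
  {
    fix a assume a: "a \<in> carrier K"
    have s': "supp K (\<lambda>w. a \<otimes> f w) \<subseteq> supp K f" using a by (auto simp: supp_def)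
    have "lin_ext K W \<phi> (\<lambda>w. a \<otimes> f w) = (\<Oplus>\<^bsub>W\<^esub>w \<in> supp K f. (a \<otimes> f w) \<odot>\<^bsub>W\<^esub> \<phi> w)"
      by (rule lin_ext_expand[where \<phi>=\<phi>, OF W \<phi> smult_closed_F[OF a f] s(2) s' s(1)])
    also have "\<dots> = (\<Oplus>\<^bsub>W\<^esub>w \<in> supp K f. a \<odot>\<^bsub>W\<^esub> (f w \<odot>\<^bsub>W\<^esub> \<phi> w))"
      using a c s \<phi> by (intro W.M.finsum_cong') (auto simp: W.smult_assoc1 subset_iff)
    also have "\<dots> = a \<odot>\<^bsub>W\<^esub> lin_ext K W \<phi> f"
      unfolding lin_ext_def using a c s \<phi> by (intro W.finsum_smult_ldistr[symmetric]) auto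
    finally show "lin_ext K W \<phi> (a \<odot>\<^bsub>F\<^esub> f) = a \<odot>\<^bsub>W\<^esub> lin_ext K W \<phi> f" by simp
  }
  fix g assume g: "g \<in> carrier F"
  then have c': "\<And>w. g w \<in> carrier K" and s': "supp K g \<subseteq> carrier M" "finite (supp K g)"
    by (auto simp: carrier_iff)
  let ?S = "supp K f \<union> supp K g"
  have S: "finite ?S" "?S \<subseteq> carrier M" using s s' by auto
  have s'': "supp K (\<lambda>w. f w \<oplus> g w) \<subseteq> ?S" by (auto simp: supp_def)
  have "lin_ext K W \<phi> (\<lambda>w. f w \<oplus> g w) = (\<Oplus>\<^bsub>W\<^esub>w \<in> ?S. (f w \<oplus> g w) \<odot>\<^bsub>W\<^esub> \<phi> w)"
    by (rule lin_ext_expand[where \<phi>=\<phi>, OF W \<phi> add_closed_F[OF f g] S(1) s'' S(2)])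
  also have "\<dots> = (\<Oplus>\<^bsub>W\<^esub>w \<in> ?S. f w \<odot>\<^bsub>W\<^esub> \<phi> w \<oplus>\<^bsub>W\<^esub> g w \<odot>\<^bsub>W\<^esub> \<phi> w)"
    using c c' S \<phi> by (intro W.M.finsum_cong') (auto simp: W.smult_l_distr subset_iff)
  also have "\<dots> = (\<Oplus>\<^bsub>W\<^esub>w \<in> ?S. f w \<odot>\<^bsub>W\<^esub> \<phi> w) \<oplus>\<^bsub>W\<^esub> (\<Oplus>\<^bsub>W\<^esub>w \<in> ?S. g w \<odot>\<^bsub>W\<^esub> \<phi> w)"
    using c c' S \<phi> by (intro W.M.finsum_addf) auto
  also have "\<dots> = lin_ext K W \<phi> f \<oplus>\<^bsub>W\<^esub> lin_ext K W \<phi> g"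
    by (intro arg_cong2[where f="add W"] lin_ext_expand[symmetric, where \<phi>=\<phi>] W f g \<phi> S) auto
  finally show "lin_ext K W \<phi> (f \<oplus>\<^bsub>F\<^esub> g) = lin_ext K W \<phi> f \<oplus>\<^bsub>W\<^esub> lin_ext K W \<phi> g" by simp
qed

lemma lin_ext_basis:
  assumes W: "module K W" and \<phi>: "\<And>u. u \<in> carrier M \<Longrightarrow> \<phi> u \<in> carrier W" and u: "u \<in> carrier M"
  shows "lin_ext K W \<phi> (basis_elt K u) = \<phi> u"
proof -
  interpret W: module K W by fact
  have s: "supp K (basis_elt K u) \<subseteq> {u}" by (auto simp: supp_def basis_elt_def)
  show ?thesis
    by (subst lin_ext_expand[where \<phi>=\<phi>, OF W \<phi> basis_closed[OF u] _ s])
      (use u \<phi> in \<open>auto simp: basis_elt_def\<close>)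
qed

text \<open>Both sides of the product rule are bilinear, so it suffices to have it on pairs of basis
  vectors, where it is the hypothesis \<open>mult\<close>.\<close>

lemma lin_ext_hom:
  assumes B: "nc_algebra K B" and \<phi>: "\<And>u. u \<in> carrier M \<Longrightarrow> \<phi> u \<in> carrier B"
    and mult: "\<And>u v. u \<in> carrier M \<Longrightarrow> v \<in> carrier M \<Longrightarrow> \<phi> (u \<otimes>\<^bsub>M\<^esub> v) = \<phi> u \<otimes>\<^bsub>B\<^esub> \<phi> v"
    and one: "\<phi> \<one>\<^bsub>M\<^esub> = \<one>\<^bsub>B\<^esub>"
  shows "lin_ext K B \<phi> \<in> alg_homs K F B"
proof (rule alg_homsI)
  interpret B: nc_algebra K B by fact
  interpret F: nc_algebra K F by (rule nc_algebra_F)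
  let ?L = "lin_ext K B \<phi>"
  have W: "module K B" by unfold_locales
  show L: "?L \<in> lin_maps K F B" by (rule lin_ext_lin[where \<phi>=\<phi>, OF W \<phi>])
  note D = lin_mapsD[OF L, unfolded F_simps] and E = lin_ext_basis[where \<phi>=\<phi>, OF W \<phi>, simplified]
  have z: "?L (\<lambda>w. \<zero>) = \<zero>\<^bsub>B\<^esub>"
    using lin_maps_zero[OF L abelian_group_F B.is_abelian_group] by simp
  have zm: "(\<lambda>w. \<zero>) \<otimes>\<^bsub>F\<^esub> f = (\<lambda>w. \<zero>)" "f \<otimes>\<^bsub>F\<^esub> (\<lambda>w. \<zero>) = (\<lambda>w. \<zero>)" if "f \<in> carrier F" for f
    using F.l_null[OF that] F.r_null[OF that] by simp_all
  show "?L \<one>\<^bsub>F\<^esub> = \<one>\<^bsub>B\<^esub>" using one E[OF M.one_closed] by simp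
  fix f g assume f: "f \<in> carrier F" and g: "g \<in> carrier F"
  have 1: "?L (basis_elt K u \<otimes>\<^bsub>F\<^esub> g) = \<phi> u \<otimes>\<^bsub>B\<^esub> ?L g" if u: "u \<in> carrier M" for u
    using g
    by (induction g rule: induct)
      (simp_all add: z zm F_r_distr F_smult_right mult_closed_F smult_closed_F D E u \<phi> basis_mult mult
        B.r_distr B.smult_mult_right)
  show "?L (f \<otimes>\<^bsub>F\<^esub> g) = ?L f \<otimes>\<^bsub>B\<^esub> ?L g"
    using f
    by (induction f rule: induct)
      (simp_all add: z zm F_l_distr F_smult_left mult_closed_F smult_closed_F D E g \<phi> 1
        B.l_distr B.smult_mult_left)
qed

end

section \<open>Quotients and presentations\<close>

locale algebra_quotient = nc_algebra K A + I: ideal I A for K (structure) and A (structure) and I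
begin

abbreviation Q where "Q \<equiv> alg_quot A I"
abbreviation cls where "cls x \<equiv> I +>\<^bsub>A\<^esub> x"

text \<open>A ring ideal absorbs scalars because \<open>c\<close> acts as multiplication by the
  element \<open>c\<close> times one.\<close>

lemma smult_ideal: "c \<in> carrier K \<Longrightarrow> i \<in> I \<Longrightarrow> c \<odot>\<^bsub>A\<^esub> i \<in> I"
  using I.I_l_closed[of i "c \<odot>\<^bsub>A\<^esub> \<one>\<^bsub>A\<^esub>"] smult_mult_left[of c "\<one>\<^bsub>A\<^esub>" i] I.a_subset by auto

text \<open>The scalar action of \<open>alg_quot\<close> is a union over representatives; all sets
  in that union are the same coset, so it collapses.\<close>

lemma cls_smult:
  assumes c: "c \<in> carrier K" and x: "x \<in> carrier A"
  shows "(\<Union>y\<in>cls x. cls (c \<odot>\<^bsub>A\<^esub> y)) = cls (c \<odot>\<^bsub>A\<^esub> x)"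
proof -
  have "cls (c \<odot>\<^bsub>A\<^esub> y) = cls (c \<odot>\<^bsub>A\<^esub> x)" if y: "y \<in> cls x" for y
  proof -
    obtain i where i: "i \<in> I" "y = i \<oplus>\<^bsub>A\<^esub> x" using y by (auto simp: a_r_coset_def')
    then have "c \<odot>\<^bsub>A\<^esub> y = c \<odot>\<^bsub>A\<^esub> i \<oplus>\<^bsub>A\<^esub> c \<odot>\<^bsub>A\<^esub> x"
      using c x I.a_subset by (auto intro: smult_r_distr)
    then have "c \<odot>\<^bsub>A\<^esub> y \<in> cls (c \<odot>\<^bsub>A\<^esub> x)" using smult_ideal[OF c i(1)] by (auto simp: a_r_coset_def')
    then show ?thesis
      using I.a_repr_independence'[of "c \<odot>\<^bsub>A\<^esub> y" "c \<odot>\<^bsub>A\<^esub> x"] c x by simp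
  qed
  then show ?thesis using I.a_rcos_self[OF x] by blast
qed

lemma Q_carrier: "X \<in> carrier Q \<longleftrightarrow> (\<exists>x\<in>carrier A. X = cls x)"
  by (auto simp: alg_quot_def FactRing_simps)

lemma Q_simps:
  "x \<in> carrier A \<Longrightarrow> y \<in> carrier A \<Longrightarrow> cls x \<oplus>\<^bsub>Q\<^esub> cls y = cls (x \<oplus>\<^bsub>A\<^esub> y)"
  "x \<in> carrier A \<Longrightarrow> y \<in> carrier A \<Longrightarrow> cls x \<otimes>\<^bsub>Q\<^esub> cls y = cls (x \<otimes>\<^bsub>A\<^esub> y)"
  "c \<in> carrier K \<Longrightarrow> x \<in> carrier A \<Longrightarrow> c \<odot>\<^bsub>Q\<^esub> cls x = cls (c \<odot>\<^bsub>A\<^esub> x)"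
  "\<one>\<^bsub>Q\<^esub> = cls \<one>\<^bsub>A\<^esub>"
  "\<zero>\<^bsub>Q\<^esub> = cls \<zero>\<^bsub>A\<^esub>"
  using cls_smult I.rcoset_mult_add I.a_rcos_sum
    a_coset_add_zero[OF I.a_subset]
  by (simp_all add: alg_quot_def FactRing_def)

lemma nc_algebra_quot: "nc_algebra K Q"
proof -
  have ab: "abelian_group Q"
  proof (rule abelian_groupI)
    fix X assume "X \<in> carrier Q"
    then obtain x where x: "x \<in> carrier A" "X = cls x" by (auto simp: Q_carrier)
    then have "cls (\<ominus>\<^bsub>A\<^esub> x) \<oplus>\<^bsub>Q\<^esub> X = \<zero>\<^bsub>Q\<^esub>" by (simp add: Q_simps M.l_neg)
    moreover have "cls (\<ominus>\<^bsub>A\<^esub> x) \<in> carrier Q" using x(1) unfolding Q_carrier by blast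
    ultimately show "\<exists>Y\<in>carrier Q. Y \<oplus>\<^bsub>Q\<^esub> X = \<zero>\<^bsub>Q\<^esub>" by blast
  qed (auto simp: Q_carrier Q_simps M.a_ac)
  show ?thesis
    by (intro nc_algebraI[OF K.field_axioms] moduleI ringI monoidI ab K.is_cring)
      (auto simp: Q_carrier Q_simps A.m_assoc A.l_distr A.r_distr smult_l_distr smult_r_distr
        smult_assoc1 smult_mult_left smult_mult_right)
qed

lemma cls_hom: "cls \<in> alg_homs K A Q"
  by (intro alg_homsI lin_mapsI) (auto simp: Q_simps Q_carrier)

text \<open>A linear map vanishing on \<open>I\<close> is constant on each coset, so the image is a
  singleton and \<open>the_elem\<close> returns its only member.\<close>

lemma cls_lift:
  assumes L: "L \<in> lin_maps K A W" and W: "abelian_group W"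
    and I: "\<And>i. i \<in> I \<Longrightarrow> L i = \<zero>\<^bsub>W\<^esub>" and x: "x \<in> carrier A"
  shows "the_elem (L ` cls x) = L x"
proof -
  interpret W: abelian_group W by fact
  have "L y = L x" if y: "y \<in> cls x" for y
  proof -
    obtain i where i: "i \<in> I" "y = i \<oplus>\<^bsub>A\<^esub> x" using y by (auto simp: a_r_coset_def')
    then show ?thesis using lin_mapsD(2)[OF L, of i x] I[OF i(1)] x I.a_subset lin_mapsD(1)[OF L x]
      by auto
  qed
  then have "L ` cls x = {L x}" using I.a_rcos_self[OF x] by blast
  then show ?thesis by simp
qed

lemma quot_lift_lin:
  assumes L: "L \<in> lin_maps K A W" and W: "abelian_group W" and I: "\<And>i. i \<in> I \<Longrightarrow> L i = \<zero>\<^bsub>W\<^esub>"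
  shows "(\<lambda>X. the_elem (L ` X)) \<in> lin_maps K Q W"
  by (rule lin_mapsI) (auto simp: Q_carrier Q_simps cls_lift[OF L W I] lin_mapsD[OF L])

lemma quot_lift_hom:
  assumes L: "L \<in> alg_homs K A B" and B: "abelian_group B" and I: "\<And>i. i \<in> I \<Longrightarrow> L i = \<zero>\<^bsub>B\<^esub>"
  shows "(\<lambda>X. the_elem (L ` X)) \<in> alg_homs K Q B"
  by (rule alg_homsI[OF quot_lift_lin[OF alg_homs_lin[OF L] B I]])
    (auto simp: Q_carrier Q_simps cls_lift[OF alg_homs_lin[OF L] B I] alg_homsD[OF L])

end

section \<open>Algebras given by relations\<close>

locale presentation = monoid_algebra K M
  for K :: "('k, 'm) ring_scheme" (structure) and M :: "('w, 'n) monoid_scheme" (structure) +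
  fixes R :: "('w \<Rightarrow> 'k) set"
  assumes rels: "R \<subseteq> carrier (monoid_alg K M)"
begin

abbreviation P where "P \<equiv> presented_alg K M R"
abbreviation e where "e \<equiv> presented_elt K M R"

lemma ideal_rels: "ideal (Idl\<^bsub>F\<^esub> R) F"
  using ring.genideal_ideal[OF nc_algebraD(4)[OF nc_algebra_F] rels] .

lemma quotient: "algebra_quotient K F (Idl\<^bsub>F\<^esub> R)"
  by (intro algebra_quotient.intro nc_algebra_F ideal_rels)

lemma nc_algebra_P: "nc_algebra K P"
  unfolding presented_alg_def by (rule algebra_quotient.nc_algebra_quot[OF quotient])

lemma cls_hom_P: "(+>\<^bsub>F\<^esub>) (Idl\<^bsub>F\<^esub> R) \<in> alg_homs K F P"
  unfolding presented_alg_def by (rule algebra_quotient.cls_hom[OF quotient])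

lemma e_closed: "u \<in> carrier M \<Longrightarrow> e u \<in> carrier P"
  unfolding presented_elt_def by (rule alg_homsD(1)[OF cls_hom_P]) simp

lemma e_mult: "u \<in> carrier M \<Longrightarrow> v \<in> carrier M \<Longrightarrow> e (u \<otimes>\<^bsub>M\<^esub> v) = e u \<otimes>\<^bsub>P\<^esub> e v"
  unfolding presented_elt_def by (simp add: alg_homsD(4)[OF cls_hom_P, symmetric] basis_mult)

lemma e_one: "e \<one>\<^bsub>M\<^esub> = \<one>\<^bsub>P\<^esub>"
  unfolding presented_elt_def using alg_homsD(5)[OF cls_hom_P] by simp

lemma P_induct [consumes 1, case_names zero add basis]:
  assumes X: "X \<in> carrier P"
    and 0: "Q \<zero>\<^bsub>P\<^esub>"
    and add: "\<And>X Y. \<lbrakk>X \<in> carrier P; Y \<in> carrier P; Q X; Q Y\<rbrakk> \<Longrightarrow> Q (X \<oplus>\<^bsub>P\<^esub> Y)"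
    and basis: "\<And>c u. \<lbrakk>c \<in> carrier K; u \<in> carrier M\<rbrakk> \<Longrightarrow> Q (c \<odot>\<^bsub>P\<^esub> e u)"
  shows "Q X"
proof -
  let ?c = "(+>\<^bsub>F\<^esub>) (Idl\<^bsub>F\<^esub> R)"
  note D = alg_homsD[OF cls_hom_P]
  have "Q (?c f)" if "f \<in> carrier F" for f
    using that
  proof (induction f rule: induct)
    case zero
    show ?case
      using 0 lin_maps_zero[OF alg_homs_lin[OF cls_hom_P] abelian_group_F nc_algebraD(5)[OF nc_algebra_P]]
      by simp
  next
    case (add f g)
    then show ?case using assms(3)[of "?c f" "?c g"] D(1,2)[of f] D(1)[of g] by simp
  next
    case (basis c u)
    then show ?case using assms(4)[of c u] D(3)[of c "basis_elt K u"] by (simp add: presented_elt_def)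
  qed
  then show ?thesis
    using X algebra_quotient.Q_carrier[OF quotient] by (auto simp: presented_alg_def)
qed

text \<open>The kernel of a homomorphism is an ideal, so vanishing on the relations \<open>R\<close>
  already gives vanishing on the ideal they generate.\<close>

lemma lift_hom:
  assumes B: "nc_algebra K B" and \<phi>: "\<And>u. u \<in> carrier M \<Longrightarrow> \<phi> u \<in> carrier B"
    and mult: "\<And>u v. u \<in> carrier M \<Longrightarrow> v \<in> carrier M \<Longrightarrow> \<phi> (u \<otimes>\<^bsub>M\<^esub> v) = \<phi> u \<otimes>\<^bsub>B\<^esub> \<phi> v"
    and one: "\<phi> \<one>\<^bsub>M\<^esub> = \<one>\<^bsub>B\<^esub>"
    and rel: "\<And>r. r \<in> R \<Longrightarrow> lin_ext K B \<phi> r = \<zero>\<^bsub>B\<^esub>"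
  obtains f where "f \<in> alg_homs K P B" "\<And>u. u \<in> carrier M \<Longrightarrow> f (e u) = \<phi> u"
proof -
  interpret B: nc_algebra K B by fact
  interpret F: nc_algebra K F by (rule nc_algebra_F)
  let ?L = "lin_ext K B \<phi>"
  have L: "?L \<in> alg_homs K F B" by (rule lin_ext_hom[where \<phi>=\<phi>, OF B \<phi> mult one])
  have "ring_hom_ring F B ?L"
    using L by (intro ring_hom_ringI2 F.ring_axioms B.ring_axioms) (simp add: alg_homs_def)
  then have "ideal (a_kernel F B ?L) F" by (rule ring_hom_ring.kernel_is_ideal)
  moreover have "R \<subseteq> a_kernel F B ?L" using rels rel by (auto simp: a_kernel_def')
  ultimately have "Idl\<^bsub>F\<^esub> R \<subseteq> a_kernel F B ?L" by (rule F.genideal_minimal)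
  then have I: "?L i = \<zero>\<^bsub>B\<^esub>" if "i \<in> Idl\<^bsub>F\<^esub> R" for i using that by (auto simp: a_kernel_def')
  let ?f = "\<lambda>X. the_elem (?L ` X)"
  show ?thesis
  proof
    show "?f \<in> alg_homs K P B" unfolding presented_alg_def
      by (rule algebra_quotient.quot_lift_hom[OF quotient L B.is_abelian_group I])
    fix u assume u: "u \<in> carrier M"
    show "?f (e u) = \<phi> u"
      unfolding presented_elt_def
      using algebra_quotient.cls_lift[OF quotient alg_homs_lin[OF L] B.is_abelian_group I] u
        lin_ext_basis[where \<phi>=\<phi>, OF nc_algebraD(3)[OF B] \<phi> u]
      by simp
  qed
qed

end

section \<open>Tensor products\<close>

definition bilin_maps ::
  "('k, 'm) ring_scheme \<Rightarrow> ('k, 'a, 'x) module_scheme \<Rightarrow> ('k, 'b, 'y) module_scheme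
    \<Rightarrow> ('k, 'c, 'z) module_scheme \<Rightarrow> ('a \<Rightarrow> 'b \<Rightarrow> 'c) set"
  where "bilin_maps K A B W = {\<beta>.
    (\<forall>x\<in>carrier A. \<beta> x \<in> lin_maps K B W) \<and> (\<forall>y\<in>carrier B. (\<lambda>x. \<beta> x y) \<in> lin_maps K A W)}"

lemma bilin_mapsI:
  assumes "\<And>x y. x \<in> carrier A \<Longrightarrow> y \<in> carrier B \<Longrightarrow> \<beta> x y \<in> carrier W"
    and "\<And>x x' y. x \<in> carrier A \<Longrightarrow> x' \<in> carrier A \<Longrightarrow> y \<in> carrier B
      \<Longrightarrow> \<beta> (x \<oplus>\<^bsub>A\<^esub> x') y = \<beta> x y \<oplus>\<^bsub>W\<^esub> \<beta> x' y"
    and "\<And>x y y'. x \<in> carrier A \<Longrightarrow> y \<in> carrier B \<Longrightarrow> y' \<in> carrier B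
      \<Longrightarrow> \<beta> x (y \<oplus>\<^bsub>B\<^esub> y') = \<beta> x y \<oplus>\<^bsub>W\<^esub> \<beta> x y'"
    and "\<And>c x y. c \<in> carrier K \<Longrightarrow> x \<in> carrier A \<Longrightarrow> y \<in> carrier B
      \<Longrightarrow> \<beta> (c \<odot>\<^bsub>A\<^esub> x) y = c \<odot>\<^bsub>W\<^esub> \<beta> x y"
    and "\<And>c x y. c \<in> carrier K \<Longrightarrow> x \<in> carrier A \<Longrightarrow> y \<in> carrier B
      \<Longrightarrow> \<beta> x (c \<odot>\<^bsub>B\<^esub> y) = c \<odot>\<^bsub>W\<^esub> \<beta> x y"
  shows "\<beta> \<in> bilin_maps K A B W"
  using assms by (auto simp: bilin_maps_def lin_maps_def)

lemma bilin_mapsD: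
  assumes "\<beta> \<in> bilin_maps K A B W"
  shows "x \<in> carrier A \<Longrightarrow> y \<in> carrier B \<Longrightarrow> \<beta> x y \<in> carrier W"
    and "x \<in> carrier A \<Longrightarrow> x' \<in> carrier A \<Longrightarrow> y \<in> carrier B
      \<Longrightarrow> \<beta> (x \<oplus>\<^bsub>A\<^esub> x') y = \<beta> x y \<oplus>\<^bsub>W\<^esub> \<beta> x' y"
    and "x \<in> carrier A \<Longrightarrow> y \<in> carrier B \<Longrightarrow> y' \<in> carrier B
      \<Longrightarrow> \<beta> x (y \<oplus>\<^bsub>B\<^esub> y') = \<beta> x y \<oplus>\<^bsub>W\<^esub> \<beta> x y'"
    and "c \<in> carrier K \<Longrightarrow> x \<in> carrier A \<Longrightarrow> y \<in> carrier B
      \<Longrightarrow> \<beta> (c \<odot>\<^bsub>A\<^esub> x) y = c \<odot>\<^bsub>W\<^esub> \<beta> x y"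
    and "c \<in> carrier K \<Longrightarrow> x \<in> carrier A \<Longrightarrow> y \<in> carrier B
      \<Longrightarrow> \<beta> x (c \<odot>\<^bsub>B\<^esub> y) = c \<odot>\<^bsub>W\<^esub> \<beta> x y"
  using assms by (auto simp: bilin_maps_def lin_maps_def)

locale tensor_product = A: nc_algebra K A + B: nc_algebra K B
  for K (structure) and A and B
begin

abbreviation T where "T \<equiv> tensor K A B"
abbreviation tp (infixl "\<bullet>" 75) where "x \<bullet> y \<equiv> ten K A B x y"

sublocale F: monoid_algebra K "A \<times>\<times> B"
  by (intro monoid_algebra.intro A.K.field_axioms DirProd_monoid A.monoid_axioms B.monoid_axioms)

lemma basis_closed: "x \<in> carrier A \<Longrightarrow> y \<in> carrier B \<Longrightarrow> basis_elt K (x, y) \<in> carrier F.F"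
  by (rule F.basis_closed) simp

lemma rel_closed: "tensor_rels K A B \<subseteq> carrier F.F"
proof -
  interpret FF: nc_algebra K F.F by (rule F.nc_algebra_F)
  note FF.minus_closed[intro] FF.a_closed[intro] basis_closed[intro] FF.smult_closed[intro]
  show ?thesis
    unfolding tensor_rels_def Let_def
    by (auto simp del: F.F_simps)
qed

sublocale P: presentation K "A \<times>\<times> B" "tensor_rels K A B"
  by (intro presentation.intro presentation_axioms.intro rel_closed F.monoid_algebra_axioms)

lemma T_eq: "tensor K A B = P.P" by (simp add: tensor_def)

lemma nc_algebra_T: "nc_algebra K T"
  unfolding T_eq by (rule P.nc_algebra_P)

lemma ten_closed [simp]: "x \<in> carrier A \<Longrightarrow> y \<in> carrier B \<Longrightarrow> x \<bullet> y \<in> carrier T"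
  unfolding T_eq ten_def by (rule P.e_closed) simp

lemma ten_mult:
  "\<lbrakk>x \<in> carrier A; y \<in> carrier B; x' \<in> carrier A; y' \<in> carrier B\<rbrakk>
    \<Longrightarrow> x \<bullet> y \<otimes>\<^bsub>T\<^esub> x' \<bullet> y' = (x \<otimes>\<^bsub>A\<^esub> x') \<bullet> (y \<otimes>\<^bsub>B\<^esub> y')"
  unfolding T_eq ten_def by (subst P.e_mult[symmetric]) simp_all

lemma ten_one: "\<one>\<^bsub>A\<^esub> \<bullet> \<one>\<^bsub>B\<^esub> = \<one>\<^bsub>T\<^esub>"
  unfolding T_eq ten_def using P.e_one by simp

lemma lin_ext_rels:
  assumes \<beta>: "\<beta> \<in> bilin_maps K A B W" and W: "module K W" and f: "f \<in> Idl\<^bsub>F.F\<^esub> (tensor_rels K A B)"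
  shows "lin_ext K W (\<lambda>p. \<beta> (fst p) (snd p)) f = \<zero>\<^bsub>W\<^esub>"
proof -
  interpret W: module K W by fact
  interpret FF: nc_algebra K F.F by (rule F.nc_algebra_F)
  let ?\<phi> = "\<lambda>p. \<beta> (fst p) (snd p)"
  let ?L = "lin_ext K W ?\<phi>"
  note bD = bilin_mapsD[OF \<beta>]
  have \<phi>: "?\<phi> u \<in> carrier W" if "u \<in> carrier (A \<times>\<times> B)" for u using that by (auto simp: bD)
  have L: "?L \<in> lin_maps K F.F W" by (rule F.lin_ext_lin[where \<phi>="?\<phi>", OF W \<phi>])
  have Lb: "?L (basis_elt K (x, y)) = \<beta> x y" if "x \<in> carrier A" "y \<in> carrier B" for x y
    using F.lin_ext_basis[where \<phi>="?\<phi>" and u="(x, y)", OF W \<phi>] that by simp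
  note LD = lin_mapsD[OF L] and L0 = lin_maps_zero[OF L FF.is_abelian_group W.abelian_group_axioms]
    and Lm = lin_maps_diff[OF L FF.is_abelian_group W.abelian_group_axioms]
  \<comment> \<open>The kernel of \<open>?L\<close> need not be an ideal; \<open>N\<close> is the largest ideal inside it.\<close>
  define N where "N = {f \<in> carrier F.F. \<forall>g\<in>carrier F.F. \<forall>h\<in>carrier F.F.
    ?L (g \<otimes>\<^bsub>F.F\<^esub> f \<otimes>\<^bsub>F.F\<^esub> h) = \<zero>\<^bsub>W\<^esub>}"
  have "ideal N F.F"
  proof (rule idealI[OF FF.ring_axioms])
    show "subgroup N (add_monoid F.F)"
    proof (rule FF.add.subgroupI)
      show "N \<subseteq> carrier F.F" by (auto simp: N_def)
      have "\<zero>\<^bsub>F.F\<^esub> \<in> N" unfolding N_def by (simp del: F.F_simps add: L0)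
      then show "N \<noteq> {}" by blast
      show "\<ominus>\<^bsub>F.F\<^esub> a \<in> N" if "a \<in> N" for a
        using that unfolding N_def
        by (simp del: F.F_simps add: FF.l_minus FF.r_minus
            lin_maps_uminus[OF L FF.is_abelian_group W.abelian_group_axioms])
      show "a \<oplus>\<^bsub>F.F\<^esub> b \<in> N" if "a \<in> N" "b \<in> N" for a b
        using that unfolding N_def by (simp del: F.F_simps add: FF.l_distr FF.r_distr LD)
    qed
    show "x \<otimes>\<^bsub>F.F\<^esub> a \<in> N" if "a \<in> N" "x \<in> carrier F.F" for a x
      using that unfolding N_def by (simp del: F.F_simps add: FF.m_assoc[symmetric])
    show "a \<otimes>\<^bsub>F.F\<^esub> x \<in> N" if "a \<in> N" "x \<in> carrier F.F" for a x
    proof -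
      have a: "a \<in> carrier F.F" "\<And>g h. g \<in> carrier F.F \<Longrightarrow> h \<in> carrier F.F \<Longrightarrow>
          ?L (g \<otimes>\<^bsub>F.F\<^esub> a \<otimes>\<^bsub>F.F\<^esub> h) = \<zero>\<^bsub>W\<^esub>"
        using that(1) by (auto simp: N_def)
      have "g \<otimes>\<^bsub>F.F\<^esub> (a \<otimes>\<^bsub>F.F\<^esub> x) \<otimes>\<^bsub>F.F\<^esub> h = g \<otimes>\<^bsub>F.F\<^esub> a \<otimes>\<^bsub>F.F\<^esub> (x \<otimes>\<^bsub>F.F\<^esub> h)"
        if "g \<in> carrier F.F" "h \<in> carrier F.F" for g h
        using that a(1) \<open>x \<in> carrier F.F\<close> by (simp add: FF.m_assoc del: F.F_simps)
      then show ?thesis using a that(2) by (simp add: N_def del: F.F_simps)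
    qed
  qed
  \<comment> \<open>Linearity in the outer factors reduces membership in \<open>N\<close> to
    multiplication by basis vectors on both sides.\<close>
  moreover have N: "f \<in> N" if f: "f \<in> carrier F.F"
    and z: "\<And>u v u' v'. \<lbrakk>u \<in> carrier A; u' \<in> carrier B; v \<in> carrier A; v' \<in> carrier B\<rbrakk> \<Longrightarrow>
      ?L (basis_elt K (u, u') \<otimes>\<^bsub>F.F\<^esub> f \<otimes>\<^bsub>F.F\<^esub> basis_elt K (v, v')) = \<zero>\<^bsub>W\<^esub>" for f
  proof -
    have z': "?L (basis_elt K p \<otimes>\<^bsub>F.F\<^esub> f \<otimes>\<^bsub>F.F\<^esub> basis_elt K q) = \<zero>\<^bsub>W\<^esub>"
      if "p \<in> carrier (A \<times>\<times> B)" "q \<in> carrier (A \<times>\<times> B)" for p q using that z by auto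
    have 1: "?L (basis_elt K p \<otimes>\<^bsub>F.F\<^esub> f \<otimes>\<^bsub>F.F\<^esub> h) = \<zero>\<^bsub>W\<^esub>"
      if p: "p \<in> carrier (A \<times>\<times> B)" and h: "h \<in> carrier F.F" for p h
      using h unfolding F.F_simps[symmetric]
      by (induction h rule: F.induct[unfolded F.F_simps[symmetric], consumes 1])
        (simp_all del: F.F_simps add: FF.r_distr FF.smult_mult_right LD f z'[OF p] L0 F.basis_closed[OF p])
    have "?L (g \<otimes>\<^bsub>F.F\<^esub> f \<otimes>\<^bsub>F.F\<^esub> h) = \<zero>\<^bsub>W\<^esub>" if h: "h \<in> carrier F.F" and g: "g \<in> carrier F.F" for g h
      using g unfolding F.F_simps[symmetric]
      by (induction g rule: F.induct[unfolded F.F_simps[symmetric], consumes 1])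
        (simp_all del: F.F_simps add: FF.l_distr FF.smult_mult_left LD f h 1 L0)
    then show ?thesis using f by (simp add: N_def)
  qed
  have "tensor_rels K A B \<subseteq> N"
  proof
    fix r assume r: "r \<in> tensor_rels K A B"
    note bm = F.basis_mult[of "(p, q)" "(p', q')" for p q p' q', simplified]
    note s = FF.minus_eq FF.l_minus FF.r_minus FF.l_distr FF.r_distr FF.smult_mult_left FF.smult_mult_right
      A.l_distr A.r_distr B.l_distr B.r_distr A.smult_mult_left A.smult_mult_right
      B.smult_mult_left B.smult_mult_right basis_closed bm Lb LD bD
      lin_maps_uminus[OF L FF.is_abelian_group W.abelian_group_axioms]
    from r show "r \<in> N"
      unfolding tensor_rels_def Let_def
    proof (elim UnE CollectE exE conjE)
      show ?thesis if "r = basis_elt K (x \<oplus>\<^bsub>A\<^esub> x', y) \<ominus>\<^bsub>F.F\<^esub> (basis_elt K (x, y) \<oplus>\<^bsub>F.F\<^esub> basis_elt K (x', y))"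
        "x \<in> carrier A" "x' \<in> carrier A" "y \<in> carrier B" for x x' y
        by (rule N) (insert that, simp_all del: F.F_simps add: s W.M.r_neg)
      show ?thesis if "r = basis_elt K (x, y \<oplus>\<^bsub>B\<^esub> y') \<ominus>\<^bsub>F.F\<^esub> (basis_elt K (x, y) \<oplus>\<^bsub>F.F\<^esub> basis_elt K (x, y'))"
        "x \<in> carrier A" "y \<in> carrier B" "y' \<in> carrier B" for x y y'
        by (rule N) (insert that, simp_all del: F.F_simps add: s W.M.r_neg)
      show ?thesis if "r = basis_elt K (c \<odot>\<^bsub>A\<^esub> x, y) \<ominus>\<^bsub>F.F\<^esub> c \<odot>\<^bsub>F.F\<^esub> basis_elt K (x, y)"
        "c \<in> carrier K" "x \<in> carrier A" "y \<in> carrier B" for c x y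
        by (rule N) (insert that, simp_all del: F.F_simps add: s W.M.r_neg)
      show ?thesis if "r = basis_elt K (x, c \<odot>\<^bsub>B\<^esub> y) \<ominus>\<^bsub>F.F\<^esub> c \<odot>\<^bsub>F.F\<^esub> basis_elt K (x, y)"
        "c \<in> carrier K" "x \<in> carrier A" "y \<in> carrier B" for c x y
        by (rule N) (insert that, simp_all del: F.F_simps add: s W.M.r_neg)
    qed
  qed
  ultimately have "Idl\<^bsub>F.F\<^esub> (tensor_rels K A B) \<subseteq> N" by (intro FF.genideal_minimal)
  then have "f \<in> N" using f by blast
  \<comment> \<open>Taking both outer factors to be one turns membership in \<open>N\<close> into
    the vanishing of the extension at \<open>f\<close> itself.\<close>
  then have "?L (\<one>\<^bsub>F.F\<^esub> \<otimes>\<^bsub>F.F\<^esub> f \<otimes>\<^bsub>F.F\<^esub> \<one>\<^bsub>F.F\<^esub>) = \<zero>\<^bsub>W\<^esub>" and "f \<in> carrier F.F"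
    unfolding N_def using FF.one_closed by blast+
  then show ?thesis by (simp del: F.F_simps)
qed

lemma tensor_lift_lin:
  assumes \<beta>: "\<beta> \<in> bilin_maps K A B W" and W: "module K W"
  shows "tensor_lift K W \<beta> \<in> lin_maps K T W"
proof -
  let ?\<phi> = "\<lambda>p. \<beta> (fst p) (snd p)"
  have \<phi>: "?\<phi> u \<in> carrier W" if "u \<in> carrier (A \<times>\<times> B)" for u using that by (auto simp: bilin_mapsD[OF \<beta>])
  have "(\<lambda>X. the_elem (lin_ext K W ?\<phi> ` X)) \<in> lin_maps K T W"
    unfolding T_eq presented_alg_def
    by (rule algebra_quotient.quot_lift_lin[OF P.quotient])
      (use W \<phi> in \<open>auto intro!: F.lin_ext_lin lin_ext_rels[OF \<beta> W] simp: module_def\<close>)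
  then show ?thesis by (simp add: tensor_lift_def[abs_def] lin_ext_def[abs_def])
qed

lemma tensor_lift_ten:
  assumes \<beta>: "\<beta> \<in> bilin_maps K A B W" and W: "module K W" and x: "x \<in> carrier A" and y: "y \<in> carrier B"
  shows "tensor_lift K W \<beta> (x \<bullet> y) = \<beta> x y"
proof -
  let ?\<phi> = "\<lambda>p. \<beta> (fst p) (snd p)"
  have \<phi>: "?\<phi> u \<in> carrier W" if "u \<in> carrier (A \<times>\<times> B)" for u using that by (auto simp: bilin_mapsD[OF \<beta>])
  have "the_elem (lin_ext K W ?\<phi> ` (x \<bullet> y)) = lin_ext K W ?\<phi> (basis_elt K (x, y))"
    unfolding ten_def presented_elt_def
    by (rule algebra_quotient.cls_lift[OF P.quotient])
      (use W \<phi> x y in \<open>auto intro!: F.lin_ext_lin lin_ext_rels[OF \<beta> W] F.basis_closed simp: module_def\<close>)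
  also have "\<dots> = \<beta> x y"
    using F.lin_ext_basis[where \<phi>="?\<phi>" and u="(x, y)", OF W \<phi>] x y by simp
  finally show ?thesis by (simp add: tensor_lift_def lin_ext_def[abs_def])
qed

lemma ten_bilin: "ten K A B \<in> bilin_maps K A B T"
proof -
  interpret FF: nc_algebra K F.F by (rule F.nc_algebra_F)
  interpret I: ideal "Idl\<^bsub>F.F\<^esub> (tensor_rels K A B)" F.F by (rule P.ideal_rels)
  let ?c = "(+>\<^bsub>F.F\<^esub>) (Idl\<^bsub>F.F\<^esub> (tensor_rels K A B))"
  note D = alg_homsD[OF P.cls_hom_P, folded T_eq]
  have eq: "?c f = ?c g" if "f \<ominus>\<^bsub>F.F\<^esub> g \<in> tensor_rels K A B" "f \<in> carrier F.F" "g \<in> carrier F.F" for f g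
  proof -
    have "f \<ominus>\<^bsub>F.F\<^esub> g \<in> Idl\<^bsub>F.F\<^esub> (tensor_rels K A B)"
      using FF.genideal_self[OF rel_closed] that by blast
    then show ?thesis using that FF.quotient_eq_iff_same_a_r_cos[OF P.ideal_rels] by blast
  qed
  note b = basis_closed
  show ?thesis
  proof (rule bilin_mapsI)
    fix x x' y assume h: "x \<in> carrier A" "x' \<in> carrier A" "y \<in> carrier B"
    have "?c (basis_elt K (x \<oplus>\<^bsub>A\<^esub> x', y)) = ?c (basis_elt K (x, y) \<oplus>\<^bsub>F.F\<^esub> basis_elt K (x', y))"
      by (rule eq) (use h b in \<open>auto simp: tensor_rels_def Let_def simp del: F.F_simps\<close>)
    then show "(x \<oplus>\<^bsub>A\<^esub> x') \<bullet> y = x \<bullet> y \<oplus>\<^bsub>T\<^esub> x' \<bullet> y"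
      using h b by (simp add: ten_def presented_elt_def D del: F.F_simps)
  next
    fix x y y' assume h: "x \<in> carrier A" "y \<in> carrier B" "y' \<in> carrier B"
    have "?c (basis_elt K (x, y \<oplus>\<^bsub>B\<^esub> y')) = ?c (basis_elt K (x, y) \<oplus>\<^bsub>F.F\<^esub> basis_elt K (x, y'))"
      by (rule eq) (use h b in \<open>auto simp: tensor_rels_def Let_def simp del: F.F_simps\<close>)
    then show "x \<bullet> (y \<oplus>\<^bsub>B\<^esub> y') = x \<bullet> y \<oplus>\<^bsub>T\<^esub> x \<bullet> y'"
      using h b by (simp add: ten_def presented_elt_def D del: F.F_simps)
  next
    fix c x y assume h: "c \<in> carrier K" "x \<in> carrier A" "y \<in> carrier B"
    have "?c (basis_elt K (c \<odot>\<^bsub>A\<^esub> x, y)) = ?c (c \<odot>\<^bsub>F.F\<^esub> basis_elt K (x, y))"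
      by (rule eq) (use h b in \<open>auto simp: tensor_rels_def Let_def simp del: F.F_simps\<close>)
    then show "(c \<odot>\<^bsub>A\<^esub> x) \<bullet> y = c \<odot>\<^bsub>T\<^esub> x \<bullet> y"
      using h b by (simp add: ten_def presented_elt_def D del: F.F_simps)
    have "?c (basis_elt K (x, c \<odot>\<^bsub>B\<^esub> y)) = ?c (c \<odot>\<^bsub>F.F\<^esub> basis_elt K (x, y))"
      by (rule eq) (use h b in \<open>auto simp: tensor_rels_def Let_def simp del: F.F_simps\<close>)
    then show "x \<bullet> (c \<odot>\<^bsub>B\<^esub> y) = c \<odot>\<^bsub>T\<^esub> x \<bullet> y"
      using h b by (simp add: ten_def presented_elt_def D del: F.F_simps)
  qed simp
qed

text \<open>Every tensor is a sum of pure tensors: scalars are absorbed into the left factor, and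
  zero is the pure tensor of two zeros.\<close>

lemma T_induct [consumes 1, case_names add ten]:
  assumes X: "X \<in> carrier T"
    and add: "\<And>X Y. \<lbrakk>X \<in> carrier T; Y \<in> carrier T; Q X; Q Y\<rbrakk> \<Longrightarrow> Q (X \<oplus>\<^bsub>T\<^esub> Y)"
    and ten: "\<And>x y. \<lbrakk>x \<in> carrier A; y \<in> carrier B\<rbrakk> \<Longrightarrow> Q (x \<bullet> y)"
  shows "Q X"
proof -
  interpret T: nc_algebra K T by (rule nc_algebra_T)
  note b = bilin_mapsD[OF ten_bilin]
  have c: "c \<odot>\<^bsub>T\<^esub> ten K A B x y = (c \<odot>\<^bsub>A\<^esub> x) \<bullet> y"
    if "c \<in> carrier K" "x \<in> carrier A" "y \<in> carrier B" for c x y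
    using b(4) that by simp
  have z: "\<zero>\<^bsub>T\<^esub> = \<zero>\<^bsub>A\<^esub> \<bullet> \<zero>\<^bsub>B\<^esub>"
    using c[of \<zero> "\<zero>\<^bsub>A\<^esub>" "\<zero>\<^bsub>B\<^esub>"] by simp
  show ?thesis
    using X unfolding T_eq
  proof (induction X rule: P.P_induct)
    case zero
    show ?case using z ten[of "\<zero>\<^bsub>A\<^esub>" "\<zero>\<^bsub>B\<^esub>"] by (simp add: T_eq)
  next
    case (add X Y)
    then show ?case using assms(2)[of X Y] by (simp add: T_eq)
  next
    case (basis k u)
    then obtain x y where u: "u = (x, y)" "x \<in> carrier A" "y \<in> carrier B" by auto
    then show ?case using c[OF basis(1) u(2,3)] ten[of "k \<odot>\<^bsub>A\<^esub> x" y] basis(1) by (simp add: ten_def T_eq)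
  qed
qed

text \<open>The hypothesis \<open>mult\<close> is the product rule on pure tensors; both sides of
  the rule are additive in each tensor, so one induction per argument extends it.\<close>

lemma tensor_lift_hom:
  assumes \<beta>: "\<beta> \<in> bilin_maps K A B C" and C: "nc_algebra K C"
    and mult: "\<And>x y x' y'. \<lbrakk>x \<in> carrier A; y \<in> carrier B; x' \<in> carrier A; y' \<in> carrier B\<rbrakk>
      \<Longrightarrow> \<beta> (x \<otimes>\<^bsub>A\<^esub> x') (y \<otimes>\<^bsub>B\<^esub> y') = \<beta> x y \<otimes>\<^bsub>C\<^esub> \<beta> x' y'"
    and one: "\<beta> \<one>\<^bsub>A\<^esub> \<one>\<^bsub>B\<^esub> = \<one>\<^bsub>C\<^esub>"
  shows "tensor_lift K C \<beta> \<in> alg_homs K T C"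
proof (rule alg_homsI)
  interpret T: nc_algebra K T by (rule nc_algebra_T)
  interpret C: nc_algebra K C by fact
  let ?L = "tensor_lift K C \<beta>"
  show L: "?L \<in> lin_maps K T C" by (rule tensor_lift_lin[OF \<beta> nc_algebraD(3)[OF C]])
  note E = tensor_lift_ten[OF \<beta> nc_algebraD(3)[OF C]] and D = lin_mapsD[OF L] and bD = bilin_mapsD[OF \<beta>]
  show "?L \<one>\<^bsub>T\<^esub> = \<one>\<^bsub>C\<^esub>" using E[of "\<one>\<^bsub>A\<^esub>" "\<one>\<^bsub>B\<^esub>"] one by (simp add: ten_one)
  fix X Y assume X: "X \<in> carrier T" and Y: "Y \<in> carrier T"
  have 1: "?L (x \<bullet> y \<otimes>\<^bsub>T\<^esub> Y) = ?L (x \<bullet> y) \<otimes>\<^bsub>C\<^esub> ?L Y" if "x \<in> carrier A" "y \<in> carrier B" for x y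
    using Y by (induction Y rule: T_induct)
      (simp_all add: that D E bD T.r_distr C.r_distr ten_mult mult)
  show "?L (X \<otimes>\<^bsub>T\<^esub> Y) = ?L X \<otimes>\<^bsub>C\<^esub> ?L Y"
    using X by (induction X rule: T_induct) (simp_all add: Y D T.l_distr C.l_distr 1)
qed

lemma lin_maps_eqI:
  assumes "f \<in> lin_maps K T W" "g \<in> lin_maps K T W"
    and "\<And>x y. \<lbrakk>x \<in> carrier A; y \<in> carrier B\<rbrakk> \<Longrightarrow> f (x \<bullet> y) = g (x \<bullet> y)" and "X \<in> carrier T"
  shows "f X = g X"
  using assms(4) by (induction X rule: T_induct) (simp_all add: assms(3) lin_mapsD[OF assms(1)] lin_mapsD[OF assms(2)])

text \<open>Makes the tensor square of the coordinate ring a legitimate target for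
  \<open>OA_alg_hom_exists\<close>, which asks for a commutative codomain.\<close>

lemma T_comm:
  assumes A: "comm_monoid A" and B: "comm_monoid B" and "X \<in> carrier T" "Y \<in> carrier T"
  shows "X \<otimes>\<^bsub>T\<^esub> Y = Y \<otimes>\<^bsub>T\<^esub> X"
proof -
  interpret T: nc_algebra K T by (rule nc_algebra_T)
  have 1: "x \<bullet> y \<otimes>\<^bsub>T\<^esub> Y = Y \<otimes>\<^bsub>T\<^esub> x \<bullet> y" if "x \<in> carrier A" "y \<in> carrier B" for x y
    using assms(4) by (induction Y rule: T_induct)
      (simp_all add: that T.r_distr T.l_distr ten_mult comm_monoid.m_comm[OF A] comm_monoid.m_comm[OF B])
  show ?thesis
    using assms(3) by (induction X rule: T_induct) (simp_all add: assms(4) T.r_distr T.l_distr 1)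
qed

end

lemma tensor_productI: "nc_algebra K A \<Longrightarrow> nc_algebra K B \<Longrightarrow> tensor_product K A B"
  by (simp add: tensor_product_def)

lemma nc_algebra_tensor: "nc_algebra K A \<Longrightarrow> nc_algebra K B \<Longrightarrow> nc_algebra K (tensor K A B)"
  by (rule tensor_product.nc_algebra_T[OF tensor_productI])

section \<open>Tensor products of maps\<close>

lemma tensor_map_bilin:
  assumes "nc_algebra K A" "nc_algebra K B" "f \<in> lin_maps K C A" "g \<in> lin_maps K D B"
  shows "(\<lambda>x y. ten K A B (f x) (g y)) \<in> bilin_maps K C D (tensor K A B)"
proof -
  note D = bilin_mapsD[OF tensor_product.ten_bilin[OF tensor_productI[OF assms(1,2)]]]
  show ?thesis
    by (rule bilin_mapsI) (simp_all add: D lin_mapsD[OF assms(3)] lin_mapsD[OF assms(4)])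
qed

context
  fixes K :: "('k, 'm) ring_scheme"
    and A :: "('k, 'a, 'x) module_scheme" and B :: "('k, 'b, 'y) module_scheme"
    and C :: "('k, 'c, 'z) module_scheme" and D :: "('k, 'd, 'w) module_scheme"
  assumes A: "nc_algebra K A" and B: "nc_algebra K B" and C: "nc_algebra K C" and D: "nc_algebra K D"
begin

lemma tensor_map_ten:
  assumes "f \<in> lin_maps K C A" "g \<in> lin_maps K D B" "x \<in> carrier C" "y \<in> carrier D"
  shows "tensor_map K A B f g (ten K C D x y) = ten K A B (f x) (g y)"
  unfolding tensor_map_def
  by (rule tensor_product.tensor_lift_ten[OF tensor_productI[OF C D] tensor_map_bilin[OF A B assms(1,2)]
      nc_algebraD(3)[OF nc_algebra_tensor[OF A B]] assms(3,4)])

lemma tensor_map_lin: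
  assumes "f \<in> lin_maps K C A" "g \<in> lin_maps K D B"
  shows "tensor_map K A B f g \<in> lin_maps K (tensor K C D) (tensor K A B)"
  unfolding tensor_map_def
  by (rule tensor_product.tensor_lift_lin[OF tensor_productI[OF C D] tensor_map_bilin[OF A B assms(1,2)]
      nc_algebraD(3)[OF nc_algebra_tensor[OF A B]]])

lemma tensor_map_hom:
  assumes "f \<in> alg_homs K C A" "g \<in> alg_homs K D B"
  shows "tensor_map K A B f g \<in> alg_homs K (tensor K C D) (tensor K A B)"
  unfolding tensor_map_def
  by (rule tensor_product.tensor_lift_hom[OF tensor_productI[OF C D]
        tensor_map_bilin[OF A B alg_homs_lin alg_homs_lin, OF assms] nc_algebra_tensor[OF A B]])
    (simp_all add: alg_homsD[OF assms(1)] alg_homsD[OF assms(2)]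
      tensor_product.ten_mult[OF tensor_productI[OF A B]] tensor_product.ten_one[OF tensor_productI[OF A B]])

end

section \<open>The associativity isomorphism\<close>

context
  fixes K :: "('k, 'm) ring_scheme"
    and A :: "('k, 'a, 'x) module_scheme" and B :: "('k, 'b, 'y) module_scheme"
    and C :: "('k, 'c, 'z) module_scheme"
  assumes A: "nc_algebra K A" and B: "nc_algebra K B" and C: "nc_algebra K C"
begin

interpretation AB: tensor_product K A B by (rule tensor_productI[OF A B])
interpretation BC: tensor_product K B C by (rule tensor_productI[OF B C])
interpretation A_BC: tensor_product K A BC.T by (rule tensor_productI[OF A BC.nc_algebra_T])
interpretation AB_C: tensor_product K AB.T C by (rule tensor_productI[OF AB.nc_algebra_T C])

private abbreviation inner where
  "inner z \<equiv> \<lambda>x y. ten K A BC.T x (ten K B C y z)"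

private lemma inner_bilin: "z \<in> carrier C \<Longrightarrow> inner z \<in> bilin_maps K A B A_BC.T"
  by (rule bilin_mapsI)
    (simp_all add: bilin_mapsD[OF BC.ten_bilin] bilin_mapsD[OF A_BC.ten_bilin])

private lemma module_A_BC: "module K A_BC.T"
  by (rule nc_algebraD(3)[OF A_BC.nc_algebra_T])

text \<open>Linearity in \<open>u\<close> is that of the inner lift. The variable \<open>z\<close>
  is a parameter of the map being lifted, so linearity in it is tested on pure tensors
  \<open>u\<close>, where the lift can be evaluated.\<close>

private lemma outer_bilin:
  "(\<lambda>u z. tensor_lift K A_BC.T (inner z) u) \<in> bilin_maps K AB.T C A_BC.T"
proof -
  interpret T: nc_algebra K A_BC.T by (rule A_BC.nc_algebra_T)
  note L = AB.tensor_lift_lin[OF inner_bilin module_A_BC]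
    and E = AB.tensor_lift_ten[OF inner_bilin module_A_BC]
  note bb = bilin_mapsD[OF BC.ten_bilin] bilin_mapsD[OF A_BC.ten_bilin]
  show ?thesis
  proof (rule bilin_mapsI)
    fix u z z' assume "u \<in> carrier AB.T" and z: "z \<in> carrier C" "z' \<in> carrier C"
    then show "tensor_lift K A_BC.T (inner (z \<oplus>\<^bsub>C\<^esub> z')) u =
      tensor_lift K A_BC.T (inner z) u \<oplus>\<^bsub>A_BC.T\<^esub> tensor_lift K A_BC.T (inner z') u"
      by (induction u rule: AB.T_induct)
        (simp_all add: E lin_mapsD[OF L] bb T.add.m_ac)
  next
    fix c u z assume "u \<in> carrier AB.T" and z: "z \<in> carrier C" "c \<in> carrier K"
    then show "tensor_lift K A_BC.T (inner (c \<odot>\<^bsub>C\<^esub> z)) u =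
      c \<odot>\<^bsub>A_BC.T\<^esub> tensor_lift K A_BC.T (inner z) u"
      by (induction u rule: AB.T_induct)
        (simp_all add: E lin_mapsD[OF L] bb T.smult_r_distr)
  qed (simp_all add: lin_mapsD[OF L])
qed

lemma tensor_assoc_ten:
  assumes "x \<in> carrier A" "y \<in> carrier B" "z \<in> carrier C"
  shows "tensor_assoc K A B C (ten K (tensor K A B) C (ten K A B x y) z) =
    ten K A (tensor K B C) x (ten K B C y z)"
  unfolding tensor_assoc_def Let_def
  by (simp add: AB_C.tensor_lift_ten[OF outer_bilin module_A_BC] assms
      AB.tensor_lift_ten[OF inner_bilin module_A_BC])

lemma tensor_assoc_hom:
  "tensor_assoc K A B C \<in> alg_homs K (tensor K (tensor K A B) C) (tensor K A (tensor K B C))"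
  unfolding tensor_assoc_def Let_def
proof (rule AB_C.tensor_lift_hom[OF outer_bilin A_BC.nc_algebra_T])
  interpret T: nc_algebra K A_BC.T by (rule A_BC.nc_algebra_T)
  note L = AB.tensor_lift_lin[OF inner_bilin module_A_BC]
    and E = AB.tensor_lift_ten[OF inner_bilin module_A_BC]
  show "tensor_lift K A_BC.T (inner \<one>\<^bsub>C\<^esub>) \<one>\<^bsub>AB.T\<^esub> = \<one>\<^bsub>A_BC.T\<^esub>"
    unfolding AB.ten_one[symmetric] by (simp add: E BC.ten_one A_BC.ten_one)
  fix u z u' z' assume u: "u \<in> carrier AB.T" "u' \<in> carrier AB.T" and z: "z \<in> carrier C" "z' \<in> carrier C"
  have 1: "tensor_lift K A_BC.T (inner (z \<otimes>\<^bsub>C\<^esub> z')) (ten K A B x y \<otimes>\<^bsub>AB.T\<^esub> u') =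
    tensor_lift K A_BC.T (inner z) (ten K A B x y) \<otimes>\<^bsub>A_BC.T\<^esub> tensor_lift K A_BC.T (inner z') u'"
    if "x \<in> carrier A" "y \<in> carrier B" for x y
    using u(2) by (induction u' rule: AB.T_induct)
      (simp_all add: that z E lin_mapsD[OF L] AB_C.A.r_distr T.r_distr AB.ten_mult BC.ten_mult A_BC.ten_mult)
  show "tensor_lift K A_BC.T (inner (z \<otimes>\<^bsub>C\<^esub> z')) (u \<otimes>\<^bsub>AB.T\<^esub> u') =
    tensor_lift K A_BC.T (inner z) u \<otimes>\<^bsub>A_BC.T\<^esub> tensor_lift K A_BC.T (inner z') u'"
    using u(1) by (induction u rule: AB.T_induct)
      (simp_all add: z u(2) 1 lin_mapsD[OF L] AB_C.A.l_distr T.l_distr)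
qed

end

section \<open>Generators and Hopf algebras\<close>

lemma id_alg_homs: "id \<in> alg_homs K A A"
  by (simp add: id_def alg_homs_id)

text \<open>\<open>hom_ext\<close> is a definite description: it has content only when a
  homomorphism with the listed values exists and is determined by them on the carrier. Being
  extensional, it is then the restriction of any such \<open>f\<close>.\<close>

lemma hom_ext_eqI:
  assumes A: "nc_algebra K A" and f: "f \<in> alg_homs K A B" "\<And>x y. (x, y) \<in> set vs \<Longrightarrow> f x = y"
    and vs: "\<And>x y. (x, y) \<in> set vs \<Longrightarrow> x \<in> carrier A"
    and unique: "\<And>g x. \<lbrakk>g \<in> alg_homs K A B; \<And>x y. (x, y) \<in> set vs \<Longrightarrow> g x = y; x \<in> carrier A\<rbrakk> \<Longrightarrow> g x = f x"
  shows "hom_ext K A B vs = restrict f (carrier A)"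
  unfolding hom_ext_def
proof (rule the_equality)
  show "restrict f (carrier A) \<in> alg_homs K A B \<and> restrict f (carrier A) \<in> extensional (carrier A) \<and>
      (\<forall>(x, y)\<in>set vs. restrict f (carrier A) x = y)"
    using alg_homs_cong[OF f(1) _ A, of "restrict f (carrier A)"] f(2) vs by auto
next
  fix g assume g: "g \<in> alg_homs K A B \<and> g \<in> extensional (carrier A) \<and> (\<forall>(x, y)\<in>set vs. g x = y)"
  show "g = restrict f (carrier A)"
  proof (rule extensionalityI[where A="carrier A"])
    fix x assume x: "x \<in> carrier A"
    have "g x = f x" by (rule unique) (use g x in auto)
    then show "g x = restrict f (carrier A) x" using x by simp
  qed (use g in auto)
qed

lemma mult_bilin:
  assumes A: "nc_algebra K A" and f: "f \<in> lin_maps K V A" and g: "g \<in> lin_maps K W A"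
  shows "(\<lambda>x y. f x \<otimes>\<^bsub>A\<^esub> g y) \<in> bilin_maps K V W A"
proof -
  interpret A: nc_algebra K A by fact
  show ?thesis
    by (rule bilin_mapsI) (simp_all add: lin_mapsD[OF f] lin_mapsD[OF g] A.l_distr A.r_distr
        A.smult_mult_left A.smult_mult_right)
qed

text \<open>Both argument orders occur, since the left and the right counit axioms take the scalar
  from different tensor factors. The coefficient functionals of \<open>k[x]\<close> are a further
  instance.\<close>

lemma scalar_bilin:
  assumes A: "nc_algebra K A" and f: "f \<in> lin_maps K V (base_alg K)" and g: "g \<in> lin_maps K W A"
  shows "(\<lambda>x y. f x \<odot>\<^bsub>A\<^esub> g y) \<in> bilin_maps K V W A" "(\<lambda>y x. f x \<odot>\<^bsub>A\<^esub> g y) \<in> bilin_maps K W V A"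
proof -
  interpret A: nc_algebra K A by fact
  have fc: "f x \<in> carrier K" if "x \<in> carrier V" for x
    using lin_mapsD(1)[OF f that] by (simp add: base_alg_def)
  note fD = lin_mapsD(2,3)[OF f, unfolded base_alg_def, simplified]
  have comm: "c \<odot>\<^bsub>A\<^esub> (d \<odot>\<^bsub>A\<^esub> x) = d \<odot>\<^bsub>A\<^esub> (c \<odot>\<^bsub>A\<^esub> x)"
    if "c \<in> carrier K" "d \<in> carrier K" "x \<in> carrier A" for c d x
    using that by (simp add: A.smult_assoc1[symmetric] A.K.m_comm)
  show "(\<lambda>x y. f x \<odot>\<^bsub>A\<^esub> g y) \<in> bilin_maps K V W A" "(\<lambda>y x. f x \<odot>\<^bsub>A\<^esub> g y) \<in> bilin_maps K W V A"
    by (rule bilin_mapsI; simp add: fc fD lin_mapsD[OF g] A.smult_l_distr A.smult_r_distr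
        A.smult_assoc1 comm)+
qed

section \<open>Algebras generated by an invertible element and one further element\<close>

text \<open>Generation is recorded as an induction principle over arbitrary predicates, the form in
  which it is applied. Zero and negatives are covered by scalar multiples.\<close>

definition alg_generated ::
  "('k, 'm) ring_scheme \<Rightarrow> ('k, 'a, 'x) module_scheme \<Rightarrow> 'a set \<Rightarrow> bool"
  where "alg_generated K A G \<longleftrightarrow> (\<forall>P. (\<forall>g\<in>G. P g) \<and> P \<one>\<^bsub>A\<^esub> \<and>
    (\<forall>x\<in>carrier A. \<forall>y\<in>carrier A. P x \<longrightarrow> P y \<longrightarrow> P (x \<oplus>\<^bsub>A\<^esub> y)) \<and>
    (\<forall>x\<in>carrier A. \<forall>y\<in>carrier A. P x \<longrightarrow> P y \<longrightarrow> P (x \<otimes>\<^bsub>A\<^esub> y)) \<and>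
    (\<forall>c\<in>carrier K. \<forall>x\<in>carrier A. P x \<longrightarrow> P (c \<odot>\<^bsub>A\<^esub> x)) \<longrightarrow> (\<forall>x\<in>carrier A. P x))"

lemma alg_generated_induct:
  assumes "alg_generated K A G" "x \<in> carrier A"
    and "\<And>g. g \<in> G \<Longrightarrow> P g" "P \<one>\<^bsub>A\<^esub>"
    and "\<And>x y. \<lbrakk>x \<in> carrier A; y \<in> carrier A; P x; P y\<rbrakk> \<Longrightarrow> P (x \<oplus>\<^bsub>A\<^esub> y)"
    and "\<And>x y. \<lbrakk>x \<in> carrier A; y \<in> carrier A; P x; P y\<rbrakk> \<Longrightarrow> P (x \<otimes>\<^bsub>A\<^esub> y)"
    and "\<And>c x. \<lbrakk>c \<in> carrier K; x \<in> carrier A; P x\<rbrakk> \<Longrightarrow> P (c \<odot>\<^bsub>A\<^esub> x)"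
  shows "P x"
  using assms(1)[unfolded alg_generated_def, rule_format, of P] assms(2-) by blast

text \<open>The common shape of \<open>QA_alg\<close> and \<open>OA_alg\<close>. Whether
  \<open>a\<close> and \<open>b\<close> commute is left open, so that one proof of the Hopf axioms
  serves both.\<close>

locale affine_algebra = nc_algebra K A for K (structure) and A (structure) +
  fixes a a' b
  assumes gens_closed [simp, intro]: "a \<in> carrier A" "a' \<in> carrier A" "b \<in> carrier A"
    and inv [simp]: "a \<otimes>\<^bsub>A\<^esub> a' = \<one>\<^bsub>A\<^esub>" "a' \<otimes>\<^bsub>A\<^esub> a = \<one>\<^bsub>A\<^esub>"
    and generated: "alg_generated K A {a, a', b}"
begin

text \<open>The value at \<open>a'\<close> is forced by \<open>c = c (f a) (f a') = f a'\<close>.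
  Hence \<open>a\<close> and \<open>b\<close> alone determine a homomorphism, and structure maps can
  be computed at \<open>a'\<close> without being prescribed there.\<close>

lemma hom_inverse:
  assumes B: "monoid B" and f: "f \<in> alg_homs K A B" and c: "c \<in> carrier B" "c \<otimes>\<^bsub>B\<^esub> f a = \<one>\<^bsub>B\<^esub>"
  shows "f a' = c"
proof -
  interpret B: monoid B by fact
  note D = alg_homsD[OF f]
  have "c \<otimes>\<^bsub>B\<^esub> f a \<otimes>\<^bsub>B\<^esub> f a' = c \<otimes>\<^bsub>B\<^esub> (f a \<otimes>\<^bsub>B\<^esub> f a')"
    using c by (intro B.m_assoc) (auto simp: D)
  then show ?thesis using c D(4)[of a a', symmetric] D(1)[of a'] D(5) by simp
qed

lemma hom_eq:
  assumes B: "monoid B" and f: "f \<in> alg_homs K A B" and g: "g \<in> alg_homs K A B"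
    and "f a = g a" "f b = g b" and x: "x \<in> carrier A"
  shows "f x = g x"
proof -
  have "f a' = g a'"
    using alg_homsD(4)[OF g, of a' a] alg_homsD(5)[OF g] \<open>f a = g a\<close>
    by (intro hom_inverse[OF B f]) (auto simp: alg_homsD[OF g])
  then show ?thesis
    by (intro alg_generated_induct[OF generated x, of "\<lambda>x. f x = g x"])
      (use assms in \<open>auto simp: alg_homsD[OF f] alg_homsD[OF g]\<close>)
qed

lemma hom_ext:
  assumes B: "monoid B" and f: "f \<in> alg_homs K A B" "f a = y" "f b = z"
  shows "hom_ext K A B [(a, y), (b, z)] = restrict f (carrier A)"
  by (rule hom_ext_eqI) (use hom_eq[OF B _ f(1)] nc_algebra_axioms f in \<open>auto\<close>)

end

section \<open>Hopf axioms from the values on generators\<close>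

text \<open>The structure maps are assumed only to be homomorphisms with the prescribed values;
  coassociativity, counit and antipode axioms become theorems. Mapping to the opposite algebra, the
  antipode reverses products.\<close>

locale affine_bialgebra = affine_algebra K H a a' b
  for K :: "('k, 'm) ring_scheme" (structure) and H :: "('k, 'a, 'x) hopf_scheme" (structure) and a a' b +
  assumes comult_hom: "comult H \<in> alg_homs K H (tensor K H H)"
    and comult_a: "comult H a = ten K H H a a"
    and comult_b: "comult H b = ten K H H b a \<oplus>\<^bsub>tensor K H H\<^esub> ten K H H \<one>\<^bsub>H\<^esub> b"
    and counit_hom: "counit H \<in> alg_homs K H (base_alg K)"
    and counit_a: "counit H a = \<one>"
    and counit_b: "counit H b = \<zero>"
    and antipode_hom: "antipode H \<in> alg_homs K H (opp_alg H)"
    and antipode_a: "antipode H a = a'"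
    and antipode_b: "antipode H b = \<ominus>\<^bsub>H\<^esub> (b \<otimes>\<^bsub>H\<^esub> a')"
begin

sublocale HH: tensor_product K H H
  by (intro tensor_productI nc_algebra_axioms)

lemma nc_HH: "nc_algebra K HH.T" by (rule HH.nc_algebra_T)

lemma antipodeD:
  "x \<in> carrier H \<Longrightarrow> antipode H x \<in> carrier H"
  "x \<in> carrier H \<Longrightarrow> y \<in> carrier H \<Longrightarrow> antipode H (x \<oplus>\<^bsub>H\<^esub> y) = antipode H x \<oplus>\<^bsub>H\<^esub> antipode H y"
  "c \<in> carrier K \<Longrightarrow> x \<in> carrier H \<Longrightarrow> antipode H (c \<odot>\<^bsub>H\<^esub> x) = c \<odot>\<^bsub>H\<^esub> antipode H x"
  "x \<in> carrier H \<Longrightarrow> y \<in> carrier H \<Longrightarrow> antipode H (x \<otimes>\<^bsub>H\<^esub> y) = antipode H y \<otimes>\<^bsub>H\<^esub> antipode H x"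
  "antipode H \<one>\<^bsub>H\<^esub> = \<one>\<^bsub>H\<^esub>"
  using alg_homsD[OF antipode_hom] by (simp_all add: opp_alg_def)

lemma antipode_lin: "antipode H \<in> lin_maps K H H"
  by (rule lin_mapsI) (simp_all add: antipodeD)

lemma counitD:
  "x \<in> carrier H \<Longrightarrow> counit H x \<in> carrier K"
  "x \<in> carrier H \<Longrightarrow> y \<in> carrier H \<Longrightarrow> counit H (x \<oplus>\<^bsub>H\<^esub> y) = counit H x \<oplus> counit H y"
  "c \<in> carrier K \<Longrightarrow> x \<in> carrier H \<Longrightarrow> counit H (c \<odot>\<^bsub>H\<^esub> x) = c \<otimes> counit H x"
  "x \<in> carrier H \<Longrightarrow> y \<in> carrier H \<Longrightarrow> counit H (x \<otimes>\<^bsub>H\<^esub> y) = counit H x \<otimes> counit H y"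
  "counit H \<one>\<^bsub>H\<^esub> = \<one>"
  using alg_homsD[OF counit_hom] by (simp_all add: base_alg_def)

lemma comult_a': "comult H a' = ten K H H a' a'"
  by (rule hom_inverse[OF nc_algebraD(6)[OF nc_HH] comult_hom])
    (simp_all add: comult_a HH.ten_mult HH.ten_one)

lemma counit_a': "counit H a' = \<one>"
  by (rule hom_inverse[OF nc_algebraD(6)[OF nc_algebra_base] counit_hom])
    (simp_all add: counit_a, simp_all add: base_alg_def K.field_axioms)

lemma antipode_a': "antipode H a' = a"
  by (rule hom_inverse[OF nc_algebraD(6)[OF nc_algebra_opp[where K=K]] antipode_hom])
    (simp_all add: antipode_a nc_algebra_axioms, simp_all add: opp_alg_def)

interpretation T: nc_algebra K HH.T by (rule nc_HH)
interpretation HHr: tensor_product K H HH.T by (intro tensor_productI nc_algebra_axioms nc_HH)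
interpretation HHl: tensor_product K HH.T H by (intro tensor_productI nc_algebra_axioms nc_HH)
interpretation Tr: nc_algebra K HHr.T by (rule HHr.nc_algebra_T)
interpretation Tl: nc_algebra K HHl.T by (rule HHl.nc_algebra_T)

text \<open>Both sides are algebra homomorphisms, so generators suffice: in either bracketing
  \<open>a\<close> goes to \<open>a \<otimes> a \<otimes> a\<close>, and \<open>b\<close> to
  \<open>b \<otimes> a \<otimes> a + 1 \<otimes> b \<otimes> a + 1 \<otimes> 1 \<otimes>
  b\<close>.\<close>

lemma coassoc:
  assumes h: "h \<in> carrier H"
  shows "tensor_map K H (tensor K H H) id (comult H) (comult H h) =
      tensor_assoc K H H H (tensor_map K (tensor K H H) H (comult H) id (comult H h))"
proof -
  note N = nc_algebra_axioms
  note lin = alg_homs_lin[OF id_alg_homs] alg_homs_lin[OF comult_hom]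
  note hr = tensor_map_hom[OF N nc_HH N N id_alg_homs comult_hom]
    and hl = tensor_map_hom[OF nc_HH N N N comult_hom id_alg_homs]
    and ha = tensor_assoc_hom[OF N N N]
  note tr = tensor_map_ten[OF N nc_HH N N lin(1,2)] and tl = tensor_map_ten[OF nc_HH N N N lin(2,1)]
    and ta = tensor_assoc_ten[OF N N N]
  note b = bilin_mapsD[OF HH.ten_bilin] bilin_mapsD[OF HHr.ten_bilin] bilin_mapsD[OF HHl.ten_bilin]
  note D = alg_homsD[OF comult_hom] alg_homsD[OF hr[unfolded id_def]] alg_homsD[OF hl[unfolded id_def]] alg_homsD[OF ha]
  show ?thesis
    unfolding id_def
  proof (rule hom_eq[OF nc_algebraD(6)[OF HHr.nc_algebra_T] _ _ _ _ h])
    show "(\<lambda>h. tensor_map K H HH.T (\<lambda>x. x) (comult H) (comult H h)) \<in> alg_homs K H HHr.T"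
      by (rule alg_homs_comp[OF comult_hom hr[unfolded id_def]])
    show "(\<lambda>h. tensor_assoc K H H H (tensor_map K HH.T H (comult H) (\<lambda>x. x) (comult H h))) \<in> alg_homs K H HHr.T"
      by (rule alg_homs_comp[OF alg_homs_comp[OF comult_hom hl[unfolded id_def]] ha])
  qed (simp_all add: comult_a comult_b tr[unfolded id_def] tl[unfolded id_def] ta D b HH.ten_one[symmetric] Tr.add.m_assoc)
qed

text \<open>The contraction is itself a homomorphism, because scalars are central and \<epsilon> is
  multiplicative. At \<open>b\<close> the first summand of the coproduct is killed by
  \<open>\<epsilon>(b) = 0\<close>.\<close>

lemma counit_left:
  assumes h: "h \<in> carrier H"
  shows "tensor_lift K H (\<lambda>x y. counit H x \<odot>\<^bsub>H\<^esub> y) (comult H h) = h"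
proof -
  note N = nc_algebra_axioms
  have bi: "(\<lambda>x y. counit H x \<odot>\<^bsub>H\<^esub> y) \<in> bilin_maps K H H H"
    by (rule scalar_bilin(1)[OF N alg_homs_lin[OF counit_hom] alg_homs_lin[OF alg_homs_id]])
  have L: "tensor_lift K H (\<lambda>x y. counit H x \<odot>\<^bsub>H\<^esub> y) \<in> alg_homs K HH.T H"
    by (rule HH.tensor_lift_hom[OF bi N])
      (simp_all add: counitD smult_mult_left smult_mult_right smult_assoc1[symmetric] K.m_comm)
  show ?thesis
    by (rule hom_eq[OF nc_algebraD(6)[OF N] alg_homs_comp[OF comult_hom L] alg_homs_id _ _ h])
      (simp_all add: comult_a comult_b alg_homsD[OF L] HH.tensor_lift_ten[OF bi nc_algebraD(3)[OF N]]
        counit_a counit_b counitD)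
qed

lemma counit_right:
  assumes h: "h \<in> carrier H"
  shows "tensor_lift K H (\<lambda>x y. counit H y \<odot>\<^bsub>H\<^esub> x) (comult H h) = h"
proof -
  note N = nc_algebra_axioms
  have bi: "(\<lambda>x y. counit H y \<odot>\<^bsub>H\<^esub> x) \<in> bilin_maps K H H H"
    by (rule scalar_bilin(2)[OF N alg_homs_lin[OF counit_hom] alg_homs_lin[OF alg_homs_id]])
  have L: "tensor_lift K H (\<lambda>x y. counit H y \<odot>\<^bsub>H\<^esub> x) \<in> alg_homs K HH.T H"
    by (rule HH.tensor_lift_hom[OF bi N])
      (simp_all add: counitD smult_mult_left smult_mult_right smult_assoc1[symmetric] K.m_comm)
  show ?thesis
    by (rule hom_eq[OF nc_algebraD(6)[OF N] alg_homs_comp[OF comult_hom L] alg_homs_id _ _ h])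
      (simp_all add: comult_a comult_b alg_homsD[OF L] HH.tensor_lift_ten[OF bi nc_algebraD(3)[OF N]]
        counit_a counit_b counitD)
qed

text \<open>The contraction \<open>?L\<close> need not be multiplicative, but the axiom still passes
  to products: \<open>?L (\<Delta>(x) \<Delta>(y)) = \<epsilon>(x) ?L (\<Delta>(y)) = \<epsilon>(x)
  \<epsilon>(y) 1\<close>.\<close>

lemma antipode_left:
  assumes h: "h \<in> carrier H"
  shows "tensor_lift K H (\<lambda>x y. antipode H x \<otimes>\<^bsub>H\<^esub> y) (comult H h) = counit H h \<odot>\<^bsub>H\<^esub> \<one>\<^bsub>H\<^esub>"
proof -
  note N = nc_algebra_axioms
  let ?L = "tensor_lift K H (\<lambda>x y. antipode H x \<otimes>\<^bsub>H\<^esub> y)"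
  have bi: "(\<lambda>x y. antipode H x \<otimes>\<^bsub>H\<^esub> y) \<in> bilin_maps K H H H"
    by (rule mult_bilin[OF N antipode_lin alg_homs_lin[OF alg_homs_id]])
  note L = lin_mapsD[OF HH.tensor_lift_lin[OF bi nc_algebraD(3)[OF N]]]
    and E = HH.tensor_lift_ten[OF bi nc_algebraD(3)[OF N]] and C = alg_homsD[OF comult_hom]
  \<comment> \<open>Reversal of products puts \<open>S(x)\<close> outermost:
    \<open>S(x' x) y' y = S(x) (S(x') y') y\<close>.\<close>
  have 1: "?L (X \<otimes>\<^bsub>HH.T\<^esub> ten K H H x y) = antipode H x \<otimes>\<^bsub>H\<^esub> ?L X \<otimes>\<^bsub>H\<^esub> y"
    if "X \<in> carrier HH.T" and xy: "x \<in> carrier H" "y \<in> carrier H" for X x y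
    using that(1) by (induction X rule: HH.T_induct)
      (simp_all add: L E xy T.l_distr r_distr l_distr HH.ten_mult antipodeD m_assoc)
  \<comment> \<open>For a pure tensor \<open>X\<close>, the axiom for \<open>g\<close> collapses the
    middle factor to the scalar \<open>\<epsilon>(g)\<close>, which then moves to the front.\<close>
  have 2: "?L (comult H g \<otimes>\<^bsub>HH.T\<^esub> X) = counit H g \<odot>\<^bsub>H\<^esub> ?L X"
    if X: "X \<in> carrier HH.T" and g: "g \<in> carrier H" "?L (comult H g) = counit H g \<odot>\<^bsub>H\<^esub> \<one>\<^bsub>H\<^esub>" for X g
    using X by (induction X rule: HH.T_induct)
      (simp_all add: L E C g 1 T.r_distr smult_r_distr smult_mult_left smult_mult_right counitD antipodeD)
  show ?thesis
  proof (rule alg_generated_induct[OF generated h])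
    fix g assume "g \<in> {a, a', b}"
    \<comment> \<open>At \<open>b\<close> the sum is \<open>- b a' a + b\<close>, which vanishes in
      accordance with \<open>\<epsilon>(b) = 0\<close>.\<close>
    then show "?L (comult H g) = counit H g \<odot>\<^bsub>H\<^esub> \<one>\<^bsub>H\<^esub>"
      by (auto simp: comult_a comult_b comult_a' L E antipode_a antipode_a' antipode_b counit_a counit_a'
          counit_b antipodeD l_minus m_assoc M.l_neg)
  next
    show "?L (comult H \<one>\<^bsub>H\<^esub>) = counit H \<one>\<^bsub>H\<^esub> \<odot>\<^bsub>H\<^esub> \<one>\<^bsub>H\<^esub>"
      by (simp add: C HH.ten_one[symmetric] E antipodeD counitD)
  qed (simp_all add: C L 2 counitD smult_l_distr smult_assoc1)
qed

text \<open>Mirror image of the left axiom: \<open>S(y)\<close> now ends up on the far right, so it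
  is a coproduct in the right factor that collapses. At \<open>b\<close> the sum is
  \<open>b a' - b a'\<close>.\<close>

lemma antipode_right:
  assumes h: "h \<in> carrier H"
  shows "tensor_lift K H (\<lambda>x y. x \<otimes>\<^bsub>H\<^esub> antipode H y) (comult H h) = counit H h \<odot>\<^bsub>H\<^esub> \<one>\<^bsub>H\<^esub>"
proof -
  note N = nc_algebra_axioms
  let ?L = "tensor_lift K H (\<lambda>x y. x \<otimes>\<^bsub>H\<^esub> antipode H y)"
  have bi: "(\<lambda>x y. x \<otimes>\<^bsub>H\<^esub> antipode H y) \<in> bilin_maps K H H H"
    by (rule mult_bilin[OF N alg_homs_lin[OF alg_homs_id] antipode_lin])
  note L = lin_mapsD[OF HH.tensor_lift_lin[OF bi nc_algebraD(3)[OF N]]]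
    and E = HH.tensor_lift_ten[OF bi nc_algebraD(3)[OF N]] and C = alg_homsD[OF comult_hom]
  have 1: "?L (ten K H H x y \<otimes>\<^bsub>HH.T\<^esub> X) = x \<otimes>\<^bsub>H\<^esub> ?L X \<otimes>\<^bsub>H\<^esub> antipode H y"
    if "X \<in> carrier HH.T" and xy: "x \<in> carrier H" "y \<in> carrier H" for X x y
    using that(1) by (induction X rule: HH.T_induct)
      (simp_all add: L E xy T.r_distr r_distr l_distr HH.ten_mult antipodeD m_assoc)
  have 2: "?L (X \<otimes>\<^bsub>HH.T\<^esub> comult H g) = counit H g \<odot>\<^bsub>H\<^esub> ?L X"
    if X: "X \<in> carrier HH.T" and g: "g \<in> carrier H" "?L (comult H g) = counit H g \<odot>\<^bsub>H\<^esub> \<one>\<^bsub>H\<^esub>" for X g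
    using X by (induction X rule: HH.T_induct)
      (simp_all add: L E C g 1 T.l_distr smult_r_distr smult_mult_left smult_mult_right counitD antipodeD)
  show ?thesis
  proof (rule alg_generated_induct[OF generated h])
    fix g assume "g \<in> {a, a', b}"
    then show "?L (comult H g) = counit H g \<odot>\<^bsub>H\<^esub> \<one>\<^bsub>H\<^esub>"
      by (auto simp: comult_a comult_b comult_a' L E antipode_a antipode_a' antipode_b counit_a counit_a'
          counit_b antipodeD M.r_neg)
  next
    show "?L (comult H \<one>\<^bsub>H\<^esub>) = counit H \<one>\<^bsub>H\<^esub> \<odot>\<^bsub>H\<^esub> \<one>\<^bsub>H\<^esub>"
      by (simp add: C HH.ten_one[symmetric] E antipodeD counitD)
  next
    \<comment> \<open>The right factor collapses before the left one, giving
      \<open>\<epsilon>(y) \<epsilon>(x)\<close>; commutativity of the field restores the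
      order.\<close>
    fix x y assume "x \<in> carrier H" "y \<in> carrier H"
      "?L (comult H x) = counit H x \<odot>\<^bsub>H\<^esub> \<one>\<^bsub>H\<^esub>" "?L (comult H y) = counit H y \<odot>\<^bsub>H\<^esub> \<one>\<^bsub>H\<^esub>"
    then show "?L (comult H (x \<otimes>\<^bsub>H\<^esub> y)) = counit H (x \<otimes>\<^bsub>H\<^esub> y) \<odot>\<^bsub>H\<^esub> \<one>\<^bsub>H\<^esub>"
      by (simp add: C 2 counitD smult_assoc1[symmetric] K.m_comm)
  qed (simp_all add: C L counitD smult_l_distr smult_assoc1)
qed

lemma hopf_algebra: "hopf_algebra K H"
  by (intro hopf_algebra.intro nc_algebra_axioms hopf_algebra_axioms.intro comult_hom counit_hom
      coassoc counit_left counit_right antipode_lin antipode_left antipode_right)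

end

text \<open>\<open>S\<^sub>L \<circ> \<pi>\<close> and \<open>\<pi> \<circ> S\<^sub>H\<close> are both convolution inverses of \<open>\<pi>\<close>.\<close>

lemma bialgebra_hom_antipode:
  fixes H :: "('k, 'a, 'x) hopf_scheme" and L :: "('k, 'b, 'y) hopf_scheme"
  assumes H: "hopf_algebra K H" and L: "hopf_algebra K L" and \<pi>: "\<pi> \<in> alg_homs K H L"
    and comult: "\<And>h. h \<in> carrier H \<Longrightarrow> comult L (\<pi> h) = tensor_map K L L \<pi> \<pi> (comult H h)"
    and counit: "\<And>h. h \<in> carrier H \<Longrightarrow> counit L (\<pi> h) = counit H h"
    and h: "h \<in> carrier H"
  shows "antipode L (\<pi> h) = \<pi> (antipode H h)"
proof -
  interpret H: hopf_algebra K H by fact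
  interpret L: hopf_algebra K L by fact
  have NH: "nc_algebra K H" and NL: "nc_algebra K L" by unfold_locales
  interpret HH: tensor_product K H H by (intro tensor_productI NH)
  interpret LL: tensor_product K L L by (intro tensor_productI NL)
  have NHH: "nc_algebra K HH.T" by (rule HH.nc_algebra_T)
  interpret Hr: tensor_product K H HH.T by (intro tensor_productI NH NHH)
  interpret Hl: tensor_product K HH.T H by (intro tensor_productI NH NHH)
  note mL = nc_algebraD(3)[OF NL] and mH = nc_algebraD(3)[OF NH]
  note p = alg_homsD[OF \<pi>] and pl = alg_homs_lin[OF \<pi>]
  note C = alg_homsD[OF H.comult_hom] and idl = alg_homs_lin[OF id_alg_homs]
    and Cl = alg_homs_lin[OF H.comult_hom]
  have eps: "counit H x \<in> carrier K" if "x \<in> carrier H" for x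
    using alg_homsD(1)[OF H.counit_hom that] by (simp add: base_alg_def)
  \<comment> \<open>\<open>f\<close> will be a left and \<open>k\<close> a right convolution inverse
    of \<pi>, hence they coincide.\<close>
  define f where "f = (\<lambda>x. antipode L (\<pi> x))"
  define k where "k = (\<lambda>x. \<pi> (antipode H x))"
  have f: "f \<in> lin_maps K H L" unfolding f_def by (rule lin_maps_comp[OF pl L.antipode_lin])
  have k: "k \<in> lin_maps K H L" unfolding k_def by (rule lin_maps_comp[OF H.antipode_lin pl])
  note fD = lin_mapsD[OF f] and kD = lin_mapsD[OF k]
  define m1 where "m1 = tensor_lift K L (\<lambda>x y. f x \<otimes>\<^bsub>L\<^esub> \<pi> y)"
  define m2 where "m2 = tensor_lift K L (\<lambda>y z. \<pi> y \<otimes>\<^bsub>L\<^esub> k z)"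
  note b1 = mult_bilin[OF NL f pl] and b2 = mult_bilin[OF NL pl k]
  have m1: "m1 \<in> lin_maps K HH.T L" unfolding m1_def by (rule HH.tensor_lift_lin[OF b1 mL])
  have m2: "m2 \<in> lin_maps K HH.T L" unfolding m2_def by (rule HH.tensor_lift_lin[OF b2 mL])
  note m1e = HH.tensor_lift_ten[OF b1 mL, folded m1_def]
    and m2e = HH.tensor_lift_ten[OF b2 mL, folded m2_def]
  \<comment> \<open>\<open>P1\<close> and \<open>P2\<close> are the two bracketings of the threefold
    convolution of \<open>f\<close>, \<pi> and \<open>k\<close>, as linear maps on the two
    bracketings of the triple tensor product.\<close>
  define P1 where "P1 = tensor_lift K L (\<lambda>u z. m1 u \<otimes>\<^bsub>L\<^esub> k z)"
  define P2 where "P2 = tensor_lift K L (\<lambda>x w. f x \<otimes>\<^bsub>L\<^esub> m2 w)"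
  note B1 = mult_bilin[OF NL m1 k] and B2 = mult_bilin[OF NL f m2]
  have P1: "P1 \<in> lin_maps K Hl.T L" unfolding P1_def by (rule Hl.tensor_lift_lin[OF B1 mL])
  have P2: "P2 \<in> lin_maps K Hr.T L" unfolding P2_def by (rule Hr.tensor_lift_lin[OF B2 mL])
  note P1e = Hl.tensor_lift_ten[OF B1 mL, folded P1_def]
    and P2e = Hr.tensor_lift_ten[OF B2 mL, folded P2_def]
  note assoc = tensor_assoc_hom[OF NH NH NH] and assoc_ten = tensor_assoc_ten[OF NH NH NH]
  have A: "P2 (tensor_assoc K H H H X) = P1 X" if X: "X \<in> carrier Hl.T" for X
  proof (rule Hl.lin_maps_eqI[OF lin_maps_comp[OF alg_homs_lin[OF assoc] P2] P1 _ X])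
    fix u z assume u: "u \<in> carrier HH.T" and z: "z \<in> carrier H"
    have 1: "(\<lambda>u. ten K HH.T H u z) \<in> lin_maps K HH.T Hl.T"
      using Hl.ten_bilin z by (simp add: bilin_maps_def)
    show "P2 (tensor_assoc K H H H (ten K HH.T H u z)) = P1 (ten K HH.T H u z)"
      by (rule HH.lin_maps_eqI[OF lin_maps_comp[OF 1 lin_maps_comp[OF alg_homs_lin[OF assoc] P2]]
            lin_maps_comp[OF 1 P1] _ u])
        (simp add: z assoc_ten P1e P2e m1e m2e fD kD p L.m_assoc)
  qed
  \<comment> \<open>\<open>f\<close> convolved with \<pi> is trivial: the left antipode axiom of
    \<open>L\<close> is pulled back along \<pi>, which respects coproduct and counit.\<close>
  have conv1: "m1 (comult H x) = counit H x \<odot>\<^bsub>L\<^esub> \<one>\<^bsub>L\<^esub>" if x: "x \<in> carrier H" for x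
  proof -
    have bi: "(\<lambda>x y. antipode L x \<otimes>\<^bsub>L\<^esub> y) \<in> bilin_maps K L L L"
      by (rule mult_bilin[OF NL L.antipode_lin alg_homs_lin[OF alg_homs_id]])
    have "m1 X = tensor_lift K L (\<lambda>x y. antipode L x \<otimes>\<^bsub>L\<^esub> y) (tensor_map K L L \<pi> \<pi> X)"
      if "X \<in> carrier HH.T" for X
      by (rule HH.lin_maps_eqI[OF m1 lin_maps_comp[OF tensor_map_lin[OF NL NL NH NH pl pl]
              LL.tensor_lift_lin[OF bi mL]] _ that])
        (simp add: m1e tensor_map_ten[OF NL NL NH NH pl pl] LL.tensor_lift_ten[OF bi mL] f_def p)
    then show ?thesis
      using L.antipode_left[of "\<pi> x"] x by (simp add: C p comult[symmetric] counit)
  qed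
  \<comment> \<open>\<pi> convolved with \<open>k\<close> is trivial: the right antipode axiom of
    \<open>H\<close> is pushed forward along \<pi>.\<close>
  have conv2: "m2 (comult H x) = counit H x \<odot>\<^bsub>L\<^esub> \<one>\<^bsub>L\<^esub>" if x: "x \<in> carrier H" for x
  proof -
    have bi: "(\<lambda>x y. x \<otimes>\<^bsub>H\<^esub> antipode H y) \<in> bilin_maps K H H H"
      by (rule mult_bilin[OF NH alg_homs_lin[OF alg_homs_id] H.antipode_lin])
    have "m2 X = \<pi> (tensor_lift K H (\<lambda>x y. x \<otimes>\<^bsub>H\<^esub> antipode H y) X)"
      if "X \<in> carrier HH.T" for X
      by (rule HH.lin_maps_eqI[OF m2 lin_maps_comp[OF HH.tensor_lift_lin[OF bi mH] pl] _ that])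
        (simp add: m2e HH.tensor_lift_ten[OF bi mH] k_def p lin_mapsD[OF H.antipode_lin])
    then show ?thesis
      using H.antipode_right[of x] x by (simp add: C p eps)
  qed
  have bl: "(\<lambda>x y. counit H x \<odot>\<^bsub>H\<^esub> y) \<in> bilin_maps K H H H"
    by (rule scalar_bilin(1)[OF NH alg_homs_lin[OF H.counit_hom] alg_homs_lin[OF alg_homs_id]])
  have br: "(\<lambda>x y. counit H y \<odot>\<^bsub>H\<^esub> x) \<in> bilin_maps K H H H"
    by (rule scalar_bilin(2)[OF NH alg_homs_lin[OF H.counit_hom] alg_homs_lin[OF alg_homs_id]])
  \<comment> \<open>\<open>R\<close> and \<open>L\<close> replace the trivial convolution by the
    counit, so that the counit axioms of \<open>H\<close> leave \<open>f h\<close> on one side and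
    \<open>k h\<close> on the other.\<close>
  have R: "P2 (tensor_map K H HH.T id (comult H) X) = f (tensor_lift K H (\<lambda>x y. counit H y \<odot>\<^bsub>H\<^esub> x) X)"
    if "X \<in> carrier HH.T" for X
    by (rule HH.lin_maps_eqI[OF lin_maps_comp[OF tensor_map_lin[OF NH NHH NH NH idl Cl] P2]
          lin_maps_comp[OF HH.tensor_lift_lin[OF br mH] f] _ that])
      (simp add: tensor_map_ten[OF NH NHH NH NH idl Cl] HH.tensor_lift_ten[OF br mH] P2e C conv2 fD eps
        L.smult_mult_right)
  have L: "P1 (tensor_map K HH.T H (comult H) id X) = k (tensor_lift K H (\<lambda>x y. counit H x \<odot>\<^bsub>H\<^esub> y) X)"
    if "X \<in> carrier HH.T" for X
    by (rule HH.lin_maps_eqI[OF lin_maps_comp[OF tensor_map_lin[OF NHH NH NH NH Cl idl] P1]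
          lin_maps_comp[OF HH.tensor_lift_lin[OF bl mH] k] _ that])
      (simp add: tensor_map_ten[OF NHH NH NH NH Cl idl] HH.tensor_lift_ten[OF bl mH] P1e C conv1 kD eps
        L.smult_mult_left)
  have "f h = P2 (tensor_map K H HH.T id (comult H) (comult H h))"
    using h by (simp add: R C H.counit_right)
  also have "\<dots> = P1 (tensor_map K HH.T H (comult H) id (comult H h))"
    using h lin_mapsD(1)[OF tensor_map_lin[OF NHH NH NH NH Cl idl]] by (simp add: H.coassoc A C)
  also have "\<dots> = k h" using h by (simp add: L C H.counit_left)
  finally show ?thesis by (simp add: f_def k_def)
qed

text \<open>Only \<Delta> and \<epsilon> have to be matched on generators, being identities between
  homomorphisms; compatibility with the antipodes is then automatic.\<close>

lemma (in affine_bialgebra) hopf_homsI: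
  fixes L :: "('k, 'b, 'y) hopf_scheme"
  assumes L: "hopf_algebra K L" and \<pi>: "\<pi> \<in> alg_homs K H L"
    and "comult L (\<pi> a) = ten K L L (\<pi> a) (\<pi> a)"
    and "comult L (\<pi> b) = ten K L L (\<pi> b) (\<pi> a) \<oplus>\<^bsub>tensor K L L\<^esub> ten K L L \<one>\<^bsub>L\<^esub> (\<pi> b)"
    and "counit L (\<pi> a) = \<one>" "counit L (\<pi> b) = \<zero>"
  shows "\<pi> \<in> hopf_homs K H L"
proof -
  interpret L: hopf_algebra K L by fact
  have NH: "nc_algebra K H" and NL: "nc_algebra K L" by unfold_locales
  have m: "monoid (tensor K L L)" "monoid (base_alg K)"
    by (intro nc_algebraD(6)[where K=K] nc_algebra_tensor nc_algebra_base NL K.field_axioms)+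
  have pp: "tensor_map K L L \<pi> \<pi> \<in> alg_homs K HH.T (tensor K L L)"
    by (rule tensor_map_hom[OF NL NL NH NH \<pi> \<pi>])
  note pt = tensor_map_ten[OF NL NL NH NH alg_homs_lin[OF \<pi>] alg_homs_lin[OF \<pi>]]
  have 1: "comult L (\<pi> h) = tensor_map K L L \<pi> \<pi> (comult H h)" if "h \<in> carrier H" for h
    by (rule hom_eq[OF m(1) alg_homs_comp[OF \<pi> L.comult_hom] alg_homs_comp[OF comult_hom pp] _ _ that])
      (simp_all add: assms pt alg_homsD[OF pp] alg_homsD[OF \<pi>] comult_a comult_b)
  have 2: "counit L (\<pi> h) = counit H h" if "h \<in> carrier H" for h
    by (rule hom_eq[OF m(2) alg_homs_comp[OF \<pi> L.counit_hom] counit_hom _ _ that])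
      (simp_all add: assms counit_a counit_b)
  show ?thesis
    using bialgebra_hom_antipode[OF hopf_algebra L \<pi> 1 2] 1 2 \<pi> by (simp add: hopf_homs_def)
qed

section \<open>Polynomials\<close>

context
  fixes K :: "('k, 'm) ring_scheme"
  assumes K: "field K"
begin

interpretation K: field K by (rule K)
interpretation UP: UP_cring K "UP K"
  by (intro UP_cring.intro K.is_cring)

text \<open>\<open>k[x]\<close> is treated as the monoid algebra of the natural numbers under
  addition, so that linear extension applies to it.\<close>

private abbreviation (input) "N \<equiv> \<lparr>carrier = UNIV, monoid.mult = (+), one = (0::nat)\<rparr>"

interpretation F: monoid_algebra K N
  by (intro monoid_algebra.intro K monoidI) auto

lemma nc_algebra_UP: "nc_algebra K (UP K)"
proof (rule nc_algebraI[OF K])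
  show "x \<otimes>\<^bsub>UP K\<^esub> (c \<odot>\<^bsub>UP K\<^esub> y) = c \<odot>\<^bsub>UP K\<^esub> (x \<otimes>\<^bsub>UP K\<^esub> y)"
    if "c \<in> carrier K" "x \<in> carrier (UP K)" "y \<in> carrier (UP K)" for c x y
    using that UP.UP_m_comm[of x "c \<odot>\<^bsub>UP K\<^esub> y"] UP.UP_m_comm[of y x] by (simp add: UP.UP_smult_assoc2)
qed (auto intro: algebra.module[OF UP.UP_algebra] UP.UP_ring simp: UP.UP_smult_assoc2)

lemma poly_X_closed: "poly_X K \<in> carrier (UP K)"
  by (simp add: poly_X_def)

text \<open>\<open>bound\<close> asks for a degree beyond which the coefficients vanish; for a set
  of natural numbers, boundedness is finiteness.\<close>

private lemma UP_carrier: "p \<in> carrier (UP K) \<longleftrightarrow> p \<in> carrier F.F"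
proof -
  have "(\<forall>i\<in>supp K p. i \<le> n) \<longleftrightarrow> bound \<zero>\<^bsub>K\<^esub> n p" for n
    by (auto simp: supp_def bound_def) (metis not_le)
  then have "finite (supp K p) \<longleftrightarrow> (\<exists>n. bound \<zero>\<^bsub>K\<^esub> n p)"
    unfolding finite_nat_set_iff_bounded_le by simp
  then show ?thesis by (auto simp: F.carrier_iff UP_def up_def)
qed

private lemma UP_fun:
  "p \<in> carrier (UP K) \<Longrightarrow> q \<in> carrier (UP K) \<Longrightarrow> p \<oplus>\<^bsub>UP K\<^esub> q = (\<lambda>i. p i \<oplus>\<^bsub>K\<^esub> q i)"
  "c \<in> carrier K \<Longrightarrow> p \<in> carrier (UP K) \<Longrightarrow> c \<odot>\<^bsub>UP K\<^esub> p = (\<lambda>i. c \<otimes>\<^bsub>K\<^esub> p i)"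
  "\<zero>\<^bsub>UP K\<^esub> = (\<lambda>i. \<zero>\<^bsub>K\<^esub>)"
  "\<one>\<^bsub>UP K\<^esub> = basis_elt K 0"
  "monom (UP K) \<one>\<^bsub>K\<^esub> n = basis_elt K n"
  "p \<in> carrier (UP K) \<Longrightarrow> coeff (UP K) p i = p i"
  by (auto simp: UP_def basis_elt_def)

private lemma monom_mult:
  "monom (UP K) \<one>\<^bsub>K\<^esub> (i + j) = monom (UP K) \<one>\<^bsub>K\<^esub> i \<otimes>\<^bsub>UP K\<^esub> monom (UP K) \<one>\<^bsub>K\<^esub> j"
  by (rule UP.monom_one_mult)

text \<open>The two products are given by different sums. Rather than comparing them, the linear
  extension of the monomials is seen to be a homomorphism fixing every element, which forces the
  products to agree.\<close>

private lemma id_hom: "(\<lambda>p. p) \<in> alg_homs K (UP K) F.F"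
proof -
  let ?\<phi> = "\<lambda>n. monom (UP K) \<one>\<^bsub>K\<^esub> n" let ?L = "lin_ext K (UP K) ?\<phi>"
  have L: "?L \<in> alg_homs K F.F (UP K)"
    by (rule F.lin_ext_hom[OF nc_algebra_UP]) (simp_all add: monom_mult)
  have m: "module K (UP K)" by (rule nc_algebraD(3)[OF nc_algebra_UP])
  have b: "?L (basis_elt K n) = basis_elt K n" for n
    by (subst F.lin_ext_basis[OF m]) (simp_all, simp add: UP_fun)
  have id: "?L p = p" if "p \<in> carrier F.F" for p
    using that
  proof (induction p rule: F.induct)
    case zero
    show ?case
      using lin_maps_zero[OF alg_homs_lin[OF L] F.abelian_group_F nc_algebraD(5)[OF nc_algebra_UP]]
      by (simp add: UP_fun)
  next
    case (add f g)
    then show ?case using alg_homsD(2)[OF L, of f g] by (simp add: UP_fun UP_carrier)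
  next
    case (basis c u)
    then have "?L (\<lambda>w. c \<otimes>\<^bsub>K\<^esub> basis_elt K u w) = c \<odot>\<^bsub>UP K\<^esub> basis_elt K u"
      using alg_homsD(3)[OF L, of c "basis_elt K u"] by (simp add: b)
    then show ?case using basis UP_fun(2)[of c "basis_elt K u"] by (simp add: UP_carrier)
  qed
  show ?thesis
  proof (intro alg_homsI lin_mapsI)
    fix x y assume xy: "x \<in> carrier (UP K)" "y \<in> carrier (UP K)"
    show "x \<otimes>\<^bsub>UP K\<^esub> y = x \<otimes>\<^bsub>F.F\<^esub> y"
      using alg_homsD(4)[OF L, of x y] xy id[of x] id[of y] id[of "x \<otimes>\<^bsub>F.F\<^esub> y"] F.mult_closed_F[of x y]
      by (simp add: UP_carrier)
  qed (simp_all add: UP_fun UP_carrier[THEN iffD1])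
qed

text \<open>The target may be noncommutative. Powers of a single \<open>t\<close> still satisfy the
  law of exponents, so sending \<open>n\<close> to the power \<open>t^n\<close> extends to a
  homomorphism.\<close>

lemma UP_hom_exists:
  assumes B: "nc_algebra K B" and t: "t \<in> carrier B"
  obtains f where "f \<in> alg_homs K (UP K) B" "f (poly_X K) = t"
proof
  interpret B: nc_algebra K B by fact
  let ?L = "lin_ext K B (\<lambda>n::nat. t [^]\<^bsub>B\<^esub> n)"
  have L: "?L \<in> alg_homs K F.F B"
    by (rule F.lin_ext_hom[OF B]) (simp_all add: t B.nat_pow_mult)
  show "(\<lambda>p. ?L p) \<in> alg_homs K (UP K) B" by (rule alg_homs_comp[OF id_hom L])
  show "?L (poly_X K) = t"
    unfolding poly_X_def UP_fun
    by (subst F.lin_ext_basis[OF nc_algebraD(3)[OF B]]) (simp_all add: t)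
qed

lemma UP_generated: "alg_generated K (UP K) {poly_X K}"
  unfolding alg_generated_def
proof (intro allI impI ballI, elim conjE)
  fix P p assume p: "p \<in> carrier (UP K)" and X: "\<forall>g\<in>{poly_X K}. P g" and 1: "P \<one>\<^bsub>UP K\<^esub>"
    and add: "\<forall>x\<in>carrier (UP K). \<forall>y\<in>carrier (UP K). P x \<longrightarrow> P y \<longrightarrow> P (x \<oplus>\<^bsub>UP K\<^esub> y)"
    and mult: "\<forall>x\<in>carrier (UP K). \<forall>y\<in>carrier (UP K). P x \<longrightarrow> P y \<longrightarrow> P (x \<otimes>\<^bsub>UP K\<^esub> y)"
    and smult: "\<forall>c\<in>carrier K. \<forall>x\<in>carrier (UP K). P x \<longrightarrow> P (c \<odot>\<^bsub>UP K\<^esub> x)"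
  have m: "P (monom (UP K) \<one>\<^bsub>K\<^esub> n)" for n
  proof (induction n)
    case 0
    show ?case using 1 by (simp add: UP.monom_one)
  next
    case (Suc n)
    have "P (monom (UP K) \<one>\<^bsub>K\<^esub> n \<otimes>\<^bsub>UP K\<^esub> poly_X K)"
      using Suc mult X poly_X_closed by simp
    then show ?case unfolding poly_X_def UP.monom_one_Suc[of n] .
  qed
  have "p \<in> carrier F.F" using p by (simp add: UP_carrier)
  then show "P p"
  proof (induction p rule: F.induct)
    case zero
    have "\<zero>\<^bsub>K\<^esub> \<odot>\<^bsub>UP K\<^esub> \<one>\<^bsub>UP K\<^esub> = (\<lambda>w. \<zero>\<^bsub>K\<^esub>)"
      using module.smult_l_null[OF nc_algebraD(3)[OF nc_algebra_UP], of "\<one>\<^bsub>UP K\<^esub>"] by (simp add: UP_fun(3))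
    then show ?case using smult[rule_format, OF K.zero_closed UP.UP_one_closed 1] by simp
  next
    case (add f g)
    then show ?case using \<open>\<forall>x\<in>carrier (UP K). \<forall>y\<in>carrier (UP K). P x \<longrightarrow> P y \<longrightarrow> P (x \<oplus>\<^bsub>UP K\<^esub> y)\<close>
      UP_fun(1)[of f g] UP_carrier[of f] UP_carrier[of g] by force
  next
    case (basis c u)
    have c: "monom (UP K) \<one>\<^bsub>K\<^esub> u \<in> carrier (UP K)" by simp
    show ?case using smult[rule_format, OF basis(1) c m]
      unfolding UP_fun(2)[OF basis(1) c] unfolding UP_fun(5) .
  qed
qed

lemma UP_hom_eq:
  assumes f: "f \<in> alg_homs K (UP K) B" and g: "g \<in> alg_homs K (UP K) B"
    and "f (poly_X K) = g (poly_X K)" and p: "p \<in> carrier (UP K)"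
  shows "f p = g p"
  by (rule alg_generated_induct[OF UP_generated p]) (use assms in \<open>auto simp: alg_homsD[OF f] alg_homsD[OF g]\<close>)

lemma coeff_lin: "(\<lambda>p. p i) \<in> lin_maps K (UP K) (base_alg K)"
  by (rule lin_mapsI) (simp_all add: UP_fun base_alg_def, simp add: UP_carrier F.carrier_iff)

lemma poly_X_coeffs:
  "poly_X K 0 = \<zero>\<^bsub>K\<^esub>" "poly_X K (Suc 0) = \<one>\<^bsub>K\<^esub>" "\<one>\<^bsub>UP K\<^esub> 0 = \<one>\<^bsub>K\<^esub>" "\<one>\<^bsub>UP K\<^esub> (Suc 0) = \<zero>\<^bsub>K\<^esub>"
  unfolding poly_X_def UP_fun(4,5) by (simp_all add: basis_elt_def)

text \<open>Linear independence of \<open>1\<close> and \<open>x\<close> over the second factor: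
  contracting with the coefficient functional in degree one isolates \<open>u\<close>, in degree
  zero \<open>v\<close>.\<close>

lemma linear_tensor_eqD:
  assumes V: "nc_algebra K V" and c: "u \<in> carrier V" "v \<in> carrier V" "u' \<in> carrier V" "v' \<in> carrier V"
    and eq: "ten K (UP K) V (poly_X K) u \<oplus>\<^bsub>tensor K (UP K) V\<^esub> ten K (UP K) V \<one>\<^bsub>UP K\<^esub> v =
      ten K (UP K) V (poly_X K) u' \<oplus>\<^bsub>tensor K (UP K) V\<^esub> ten K (UP K) V \<one>\<^bsub>UP K\<^esub> v'"
  shows "u = u'" "v = v'"
proof -
  interpret V: nc_algebra K V by fact
  interpret T: tensor_product K "UP K" V by (intro tensor_productI nc_algebra_UP V)
  have bi: "(\<lambda>p x. p i \<odot>\<^bsub>V\<^esub> x) \<in> bilin_maps K (UP K) V V" for i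
    by (rule scalar_bilin(1)[OF V coeff_lin alg_homs_lin[OF alg_homs_id]])
  have m: "module K V" by (rule nc_algebraD(3)[OF V])
  let ?c = "\<lambda>i. tensor_lift K V (\<lambda>p x. p i \<odot>\<^bsub>V\<^esub> x)"
  have "?c i (ten K (UP K) V (poly_X K) u \<oplus>\<^bsub>T.T\<^esub> ten K (UP K) V \<one>\<^bsub>UP K\<^esub> v) =
    poly_X K i \<odot>\<^bsub>V\<^esub> u \<oplus>\<^bsub>V\<^esub> \<one>\<^bsub>UP K\<^esub> i \<odot>\<^bsub>V\<^esub> v" if "u \<in> carrier V" "v \<in> carrier V" for u v i
    using that by (simp add: lin_mapsD[OF T.tensor_lift_lin[OF bi m]] T.tensor_lift_ten[OF bi m] poly_X_closed)
  from this[OF c(1,2)] this[OF c(3,4)] eq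
  have "poly_X K i \<odot>\<^bsub>V\<^esub> u \<oplus>\<^bsub>V\<^esub> \<one>\<^bsub>UP K\<^esub> i \<odot>\<^bsub>V\<^esub> v = poly_X K i \<odot>\<^bsub>V\<^esub> u' \<oplus>\<^bsub>V\<^esub> \<one>\<^bsub>UP K\<^esub> i \<odot>\<^bsub>V\<^esub> v'" for i
    by metis
  from this[of 0] this[of "Suc 0"] show "u = u'" "v = v'" using c by (simp_all add: poly_X_coeffs)
qed

section \<open>Polynomials of bounded degree\<close>

lemma poly_upto_1:
  assumes "p \<in> poly_upto K 1"
  shows "p = p 1 \<odot>\<^bsub>UP K\<^esub> poly_X K \<oplus>\<^bsub>UP K\<^esub> p 0 \<odot>\<^bsub>UP K\<^esub> \<one>\<^bsub>UP K\<^esub>"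
proof -
  have p: "p \<in> carrier (UP K)" "deg K p \<le> 1" using assms by (auto simp: poly_upto_def)
  have c: "p i \<in> carrier K" for i using p(1) by (simp add: UP_carrier F.carrier_iff)
  have z: "p i = \<zero>\<^bsub>K\<^esub>" if "1 < i" for i using UP.deg_aboveD[of p i] p that by (simp add: UP_fun(6))
  have "p i = (p 1 \<odot>\<^bsub>UP K\<^esub> poly_X K \<oplus>\<^bsub>UP K\<^esub> p 0 \<odot>\<^bsub>UP K\<^esub> \<one>\<^bsub>UP K\<^esub>) i" for i
  proof -
    have "(p 1 \<odot>\<^bsub>UP K\<^esub> poly_X K \<oplus>\<^bsub>UP K\<^esub> p 0 \<odot>\<^bsub>UP K\<^esub> \<one>\<^bsub>UP K\<^esub>) i =
      p 1 \<otimes>\<^bsub>K\<^esub> basis_elt K 1 i \<oplus>\<^bsub>K\<^esub> p 0 \<otimes>\<^bsub>K\<^esub> basis_elt K 0 i"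
      using c[of 1] c[of 0] by (subst UP_fun(1))
        (simp_all add: poly_X_closed, simp add: UP_fun(2) poly_X_closed, simp add: poly_X_def UP_fun)
    then show ?thesis using z[of i] c by (cases "i = 0"; cases "i = 1") (auto simp: basis_elt_def)
  qed
  then show ?thesis by blast
qed

lemma poly_upto_mult_X:
  assumes "p \<in> poly_upto K n"
  shows "p \<otimes>\<^bsub>UP K\<^esub> poly_X K \<in> poly_upto K (Suc n)"
proof -
  have "deg K (p \<otimes>\<^bsub>UP K\<^esub> poly_X K) \<le> deg K p + deg K (poly_X K)"
    using assms by (intro UP.deg_mult_ring) (auto simp: poly_upto_def poly_X_closed)
  moreover have "deg K (poly_X K) \<le> 1" unfolding poly_X_def by (rule UP.deg_monom_le) simp
  ultimately show ?thesis using assms by (simp add: poly_upto_def poly_X_closed)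
qed

text \<open>The degree bound enters through the expansion of \<open>p\<close> into its terms up to
  degree \<open>n\<close>, so only monomials within the bound are tested.\<close>

lemma poly_upto_induct:
  assumes p: "p \<in> poly_upto K n"
    and monom: "\<And>i. i \<le> n \<Longrightarrow> P (monom (UP K) \<one>\<^bsub>K\<^esub> i)"
    and add: "\<And>x y. \<lbrakk>x \<in> carrier (UP K); y \<in> carrier (UP K); P x; P y\<rbrakk> \<Longrightarrow> P (x \<oplus>\<^bsub>UP K\<^esub> y)"
    and smult: "\<And>c x. \<lbrakk>c \<in> carrier K; x \<in> carrier (UP K); P x\<rbrakk> \<Longrightarrow> P (c \<odot>\<^bsub>UP K\<^esub> x)"
  shows "P p"
proof -
  have p: "p \<in> carrier (UP K)" "deg K p \<le> n" using p by (auto simp: poly_upto_def)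
  have c: "coeff (UP K) p i \<in> carrier K" for i using p(1) by simp
  have mc: "P (monom (UP K) (coeff (UP K) p i) i)" if "i \<le> n" for i
    using smult[OF c[of i] _ monom[OF that]] UP.monom_mult_smult[OF c[of i] K.one_closed, of i] c[of i] by simp
  have "j \<le> n \<Longrightarrow> P (\<Oplus>\<^bsub>UP K\<^esub>i\<in>{..j}. monom (UP K) (coeff (UP K) p i) i)" for j
  proof (induction j)
    case 0
    show ?case using mc[of 0] c by simp
  next
    case (Suc j)
    then show ?case using mc[of "Suc j"] c by (simp add: Pi_def add)
  qed
  then show ?thesis using UP.up_repr_le[OF p(2,1)] by fastforce
qed

end

section \<open>Linear spans\<close>

lemma (in module) lin_span_subset: "submodule U R M \<Longrightarrow> S \<subseteq> U \<Longrightarrow> lin_span R M S \<subseteq> U"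
  by (auto simp: lin_span_def)

lemma (in module) lin_span_superset: "S \<subseteq> lin_span R M S"
  by (auto simp: lin_span_def)

lemma (in module) submodule_lin_span:
  assumes "S \<subseteq> carrier M"
  shows "submodule (lin_span R M S) R M"
proof (rule submoduleI)
  show "lin_span R M S \<subseteq> carrier M" using lin_span_subset[OF carrier_is_submodule assms] .
  have "\<zero>\<^bsub>M\<^esub> \<in> U" if "submodule U R M" for U
    using subgroup.one_closed[OF submodule.axioms(1)[OF that]] by simp
  then show "\<zero>\<^bsub>M\<^esub> \<in> lin_span R M S" by (auto simp: lin_span_def)
qed (auto simp: lin_span_def dest: submoduleE)

section \<open>The algebra generated by \<open>a\<close>, \<open>a\<^sup>-\<^sup>1\<close>, \<open>b\<close>\<close>

lemma hopf_of_simps [simp]: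
  "carrier (hopf_of A D e S) = carrier A" "mult (hopf_of A D e S) = mult A" "one (hopf_of A D e S) = one A"
  "zero (hopf_of A D e S) = zero A" "add (hopf_of A D e S) = add A" "smult (hopf_of A D e S) = smult A"
  "comult (hopf_of A D e S) = D" "counit (hopf_of A D e S) = e" "antipode (hopf_of A D e S) = S"
  "a_inv (hopf_of A D e S) = a_inv A"
  by (simp_all add: hopf_of_def a_inv_def m_inv_def fun_eq_iff)

lemma alg_homs_hopf_of [simp]:
  "alg_homs K (hopf_of A D e S) B = alg_homs K A B"
  "alg_homs K B (hopf_of A D e S) = alg_homs K B A"
  "alg_homs K B (opp_alg (hopf_of A D e S)) = alg_homs K B (opp_alg A)"
  by (simp_all add: alg_homs_def ring_hom_def lin_maps_def opp_alg_def hopf_of_def)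

text \<open>The tensor product reads only the algebra structure, so coproducts built over the bare
  algebra have the type and the value required over the Hopf algebra record.\<close>

lemma tensor_hopf_of [simp]:
  "tensor K (hopf_of A D e S) (hopf_of A D e S) = tensor K A A"
  "ten K (hopf_of A D e S) (hopf_of A D e S) = ten K A A"
  by (simp_all add: fun_eq_iff tensor_def ten_def tensor_rels_def DirProd_def)

lemma alg_generated_hopf_of: "alg_generated K A G \<Longrightarrow> alg_generated K (hopf_of A D e S) G"
  by (simp add: alg_generated_def)

text \<open>The existence hypotheses give meaning to the descriptions behind \<open>hom_ext\<close>;
  uniqueness comes from generation by \<open>a\<close>, \<open>a'\<close> and
  \<open>b\<close>.\<close>

lemma affine_bialgebraI:
  fixes A :: "('k, 'a, 'x) module_scheme"
  assumes A: "affine_algebra K A a a' b"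
    and D: "\<exists>D \<in> alg_homs K A (tensor K A A). D a = ten K A A a a \<and>
      D b = ten K A A b a \<oplus>\<^bsub>tensor K A A\<^esub> ten K A A \<one>\<^bsub>A\<^esub> b"
    and e: "\<exists>e \<in> alg_homs K A (base_alg K). e a = \<one>\<^bsub>K\<^esub> \<and> e b = \<zero>\<^bsub>K\<^esub>"
    and S: "\<exists>S \<in> alg_homs K A (opp_alg A). S a = a' \<and> S b = \<ominus>\<^bsub>A\<^esub> (b \<otimes>\<^bsub>A\<^esub> a')"
  shows "affine_bialgebra K (hopf_of A
      (hom_ext K A (tensor K A A) [(a, ten K A A a a), (b, ten K A A b a \<oplus>\<^bsub>tensor K A A\<^esub> ten K A A \<one>\<^bsub>A\<^esub> b)])
      (hom_ext K A (base_alg K) [(a, \<one>\<^bsub>K\<^esub>), (b, \<zero>\<^bsub>K\<^esub>)])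
      (hom_ext K A (opp_alg A) [(a, a'), (b, \<ominus>\<^bsub>A\<^esub> (b \<otimes>\<^bsub>A\<^esub> a'))])) a a' b"
proof -
  interpret affine_algebra K A a a' b by fact
  have N: "nc_algebra K A" by unfold_locales
  have mon: "monoid (tensor K A A)" "monoid (base_alg K)" "monoid (opp_alg A)"
    by (intro nc_algebraD(6)[where K=K] nc_algebra_tensor[OF N N] nc_algebra_base nc_algebra_opp N
        K.field_axioms)+
  have hom: "hom_ext K A B [(a, y), (b, z)] \<in> alg_homs K A B \<and> hom_ext K A B [(a, y), (b, z)] a = y \<and>
    hom_ext K A B [(a, y), (b, z)] b = z"
    if B: "monoid B" and ex: "\<exists>f \<in> alg_homs K A B. f a = y \<and> f b = z"
    for B :: "('k, 'd, 'e) module_scheme" and y z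
  proof -
    obtain f where f: "f \<in> alg_homs K A B" "f a = y" "f b = z" using ex by blast
    show ?thesis unfolding hom_ext[OF B f]
      using alg_homs_cong[OF f(1) _ N, of "restrict f (carrier A)"] f by simp
  qed
  show ?thesis
    using hom[OF mon(1) D] hom[OF mon(2) e] hom[OF mon(3) S]
    by (intro affine_bialgebra.intro affine_algebra.intro nc_algebra_hopf_of[OF N]
        affine_algebra_axioms.intro affine_bialgebra_axioms.intro alg_generated_hopf_of[OF generated])
      simp_all
qed

context
  fixes K :: "('k, 'm) ring_scheme"
  assumes K: "field K"
begin

interpretation K: field K by (rule K)

interpretation W: monoid_algebra K words
  by (intro monoid_algebra.intro K monoidI) (auto simp: words_def)

private lemma words_simps: "carrier words = UNIV" "\<one>\<^bsub>words\<^esub> = []" "u \<otimes>\<^bsub>words\<^esub> v = u @ v"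
  by (simp_all add: words_def)

interpretation P: presentation K words "QA_rels K"
proof (intro presentation.intro presentation_axioms.intro W.monoid_algebra_axioms)
  interpret F: nc_algebra K W.F by (rule W.nc_algebra_F)
  have b: "basis_elt K w \<in> carrier W.F" for w by (rule W.basis_closed) (simp add: words_simps)
  show "QA_rels K \<subseteq> carrier W.F"
    unfolding QA_rels_def Let_def using F.minus_closed[OF b F.one_closed] by blast
qed

text \<open>The universal property of the presentation: any invertible \<open>s\<close> and any
  \<open>t\<close> are admissible values, with no condition linking the two.\<close>

lemma QA_alg_hom_exists:
  assumes B: "nc_algebra K B" and c: "s \<in> carrier B" "s' \<in> carrier B" "t \<in> carrier B"
    and inv: "s \<otimes>\<^bsub>B\<^esub> s' = \<one>\<^bsub>B\<^esub>" "s' \<otimes>\<^bsub>B\<^esub> s = \<one>\<^bsub>B\<^esub>"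
  shows "\<exists>f \<in> alg_homs K (QA_alg K) B. f (qa K) = s \<and> f (qb K) = t"
proof -
  interpret B: nc_algebra K B by fact
  interpret F: nc_algebra K W.F by (rule W.nc_algebra_F)
  define v where "v = (\<lambda>g. case g of Gen_a \<Rightarrow> s | Gen_a_inv \<Rightarrow> s' | Gen_b \<Rightarrow> t)"
  \<comment> \<open>A word is evaluated by multiplying the values of its letters; concatenation
    becomes multiplication, and the two relations become \<open>s s' = 1 = s' s\<close>.\<close>
  define \<phi> where "\<phi> = (\<lambda>w. foldr (\<lambda>g x. v g \<otimes>\<^bsub>B\<^esub> x) w \<one>\<^bsub>B\<^esub>)"
  have v: "v g \<in> carrier B" for g using c by (simp add: v_def split: gen.split)
  have \<phi>c: "\<phi> w \<in> carrier B" for w by (induction w) (simp_all add: \<phi>_def v)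
  have \<phi>_Cons: "\<phi> (g # w) = v g \<otimes>\<^bsub>B\<^esub> \<phi> w" for g w by (simp add: \<phi>_def)
  have \<phi>_Nil: "\<phi> [] = \<one>\<^bsub>B\<^esub>" by (simp add: \<phi>_def)
  have \<phi>m: "\<phi> (u @ w) = \<phi> u \<otimes>\<^bsub>B\<^esub> \<phi> w" for u w
    by (induction u) (simp_all add: \<phi>_Cons \<phi>_Nil \<phi>c v B.m_assoc)
  let ?L = "lin_ext K B \<phi>"
  have L: "?L \<in> alg_homs K W.F B"
    by (rule W.lin_ext_hom[OF B]) (simp_all add: \<phi>c words_simps \<phi>m \<phi>_Nil)
  have Lb: "?L (basis_elt K w) = \<phi> w" for w
    by (rule W.lin_ext_basis[OF nc_algebraD(3)[OF B]]) (simp_all add: words_simps \<phi>c)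
  have b: "basis_elt K w \<in> carrier W.F" for w by (rule W.basis_closed) (simp add: words_simps)
  have rel: "?L (basis_elt K w \<ominus>\<^bsub>W.F\<^esub> \<one>\<^bsub>W.F\<^esub>) = \<zero>\<^bsub>B\<^esub>" if "\<phi> w = \<one>\<^bsub>B\<^esub>" for w
    using lin_maps_diff[OF alg_homs_lin[OF L] F.is_abelian_group B.is_abelian_group b F.one_closed, of w]
      alg_homsD(5)[OF L] that by (simp add: Lb B.r_neg a_minus_def del: W.F_simps)
  obtain f where f: "f \<in> alg_homs K P.P B" "\<And>u. u \<in> carrier words \<Longrightarrow> f (P.e u) = \<phi> u"
  proof (rule P.lift_hom[OF B, of \<phi>])
    show "?L r = \<zero>\<^bsub>B\<^esub>" if "r \<in> QA_rels K" for r
      using that rel[of "[Gen_a, Gen_a_inv]"] rel[of "[Gen_a_inv, Gen_a]"] inv c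
      by (auto simp: QA_rels_def Let_def \<phi>_Cons \<phi>_Nil v_def simp del: W.F_simps)
  qed (simp_all add: \<phi>c words_simps \<phi>m \<phi>_Nil)
  show ?thesis
    using f c by (intro bexI[of _ f]) (simp_all add: QA_alg_def qa_def qb_def words_simps \<phi>_Cons \<phi>_Nil v_def)
qed

text \<open>Invertibility of \<open>a\<close> is read off from the two relations, and generation
  from the fact that a word is the product of its letters.\<close>

lemma affine_algebra_QA_alg: "affine_algebra K (QA_alg K) (qa K) (qa_inv K) (qb K)"
proof -
  interpret F: nc_algebra K W.F by (rule W.nc_algebra_F)
  interpret A: nc_algebra K "QA_alg K" unfolding QA_alg_def by (rule P.nc_algebra_P)
  note e_mult = P.e_mult[unfolded words_simps, simplified, folded QA_alg_def]
    and e_one = P.e_one[unfolded words_simps, folded QA_alg_def]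
    and e_closed = P.e_closed[unfolded words_simps, simplified, folded QA_alg_def]
  have b: "basis_elt K w \<in> carrier W.F" for w by (rule W.basis_closed) (simp add: words_simps)
  have rel: "P.e w = P.e []" if "basis_elt K w \<ominus>\<^bsub>W.F\<^esub> \<one>\<^bsub>W.F\<^esub> \<in> QA_rels K" for w
  proof -
    have "basis_elt K w \<ominus>\<^bsub>W.F\<^esub> basis_elt K [] \<in> Idl\<^bsub>W.F\<^esub> (QA_rels K)"
      using F.genideal_self[OF P.rels] that by (auto simp: words_simps)
    then show ?thesis unfolding presented_elt_def
      using F.quotient_eq_iff_same_a_r_cos[OF P.ideal_rels b b] by blast
  qed
  have inv: "P.e [Gen_a, Gen_a_inv] = \<one>\<^bsub>QA_alg K\<^esub>" "P.e [Gen_a_inv, Gen_a] = \<one>\<^bsub>QA_alg K\<^esub>"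
    unfolding e_one[symmetric] by (rule rel, simp add: QA_rels_def Let_def)+
  have gen: "alg_generated K (QA_alg K) {qa K, qa_inv K, qb K}"
    unfolding alg_generated_def
  proof (intro allI impI ballI, elim conjE)
    fix Q X assume X: "X \<in> carrier (QA_alg K)" and g: "\<forall>g\<in>{qa K, qa_inv K, qb K}. Q g"
      and 1: "Q \<one>\<^bsub>QA_alg K\<^esub>"
      and add: "\<forall>x\<in>carrier (QA_alg K). \<forall>y\<in>carrier (QA_alg K). Q x \<longrightarrow> Q y \<longrightarrow> Q (x \<oplus>\<^bsub>QA_alg K\<^esub> y)"
      and mult: "\<forall>x\<in>carrier (QA_alg K). \<forall>y\<in>carrier (QA_alg K). Q x \<longrightarrow> Q y \<longrightarrow> Q (x \<otimes>\<^bsub>QA_alg K\<^esub> y)"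
      and smult: "\<forall>c\<in>carrier K. \<forall>x\<in>carrier (QA_alg K). Q x \<longrightarrow> Q (c \<odot>\<^bsub>QA_alg K\<^esub> x)"
    have gen: "Q (P.e [h])" for h using g by (cases h) (auto simp: qa_def qa_inv_def qb_def)
    have e: "Q (P.e w)" for w
    proof (induction w)
      case Nil
      then show ?case using 1 by (simp add: e_one)
    next
      case (Cons h w)
      then show ?case using e_mult[of "[h]" w] mult gen[of h] e_closed by simp
    qed
    have z: "Q \<zero>\<^bsub>QA_alg K\<^esub>" using smult 1 A.smult_l_null[OF A.one_closed] K.zero_closed A.one_closed by metis
    show "Q X"
      using X unfolding QA_alg_def
      by (induction X rule: P.P_induct)
        (use z add smult e e_closed in \<open>auto simp: QA_alg_def words_simps\<close>)
  qed
  show ?thesis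
    by (intro affine_algebra.intro A.nc_algebra_axioms affine_algebra_axioms.intro gen)
      (simp_all add: qa_def qa_inv_def qb_def e_closed e_mult[symmetric] inv)
qed

lemma QA_eq:
  "QA K = hopf_of (QA_alg K)
      (hom_ext K (QA_alg K) (tensor K (QA_alg K) (QA_alg K)) [(qa K, ten K (QA_alg K) (QA_alg K) (qa K) (qa K)),
        (qb K, ten K (QA_alg K) (QA_alg K) (qb K) (qa K) \<oplus>\<^bsub>tensor K (QA_alg K) (QA_alg K)\<^esub>
          ten K (QA_alg K) (QA_alg K) \<one>\<^bsub>QA_alg K\<^esub> (qb K))])
      (hom_ext K (QA_alg K) (base_alg K) [(qa K, \<one>\<^bsub>K\<^esub>), (qb K, \<zero>\<^bsub>K\<^esub>)])
      (hom_ext K (QA_alg K) (opp_alg (QA_alg K)) [(qa K, qa_inv K),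
        (qb K, \<ominus>\<^bsub>QA_alg K\<^esub> (qb K \<otimes>\<^bsub>QA_alg K\<^esub> qa_inv K))])"
  by (simp add: QA_def Let_def)

lemma QA_hom_exists:
  assumes "nc_algebra K B" "s \<in> carrier B" "s' \<in> carrier B" "t \<in> carrier B"
    "s \<otimes>\<^bsub>B\<^esub> s' = \<one>\<^bsub>B\<^esub>" "s' \<otimes>\<^bsub>B\<^esub> s = \<one>\<^bsub>B\<^esub>"
  shows "\<exists>f \<in> alg_homs K (QA K) B. f (qa K) = s \<and> f (qb K) = t"
  using QA_alg_hom_exists[OF assms] by (simp add: QA_eq)

text \<open>Each structure map only requires the proposed image of \<open>a\<close> to be
  invertible. The inverses are \<open>a' \<otimes> a'\<close> in the tensor square, \<open>1\<close>
  in the field, and \<open>a\<close> in the opposite algebra.\<close>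

lemma affine_bialgebra_QA: "affine_bialgebra K (QA K) (qa K) (qa_inv K) (qb K)"
  unfolding QA_eq
proof (rule affine_bialgebraI[OF affine_algebra_QA_alg])
  interpret A: affine_algebra K "QA_alg K" "qa K" "qa_inv K" "qb K" by (rule affine_algebra_QA_alg)
  interpret T: tensor_product K "QA_alg K" "QA_alg K" by (intro tensor_productI A.nc_algebra_axioms)
  interpret TT: nc_algebra K T.T by (rule T.nc_algebra_T)
  show "\<exists>D \<in> alg_homs K (QA_alg K) T.T. D (qa K) = T.tp (qa K) (qa K) \<and>
      D (qb K) = T.tp (qb K) (qa K) \<oplus>\<^bsub>T.T\<^esub> T.tp \<one>\<^bsub>QA_alg K\<^esub> (qb K)"
    by (rule QA_alg_hom_exists[where s'="T.tp (qa_inv K) (qa_inv K)"])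
      (simp_all add: T.nc_algebra_T T.ten_mult T.ten_one)
  show "\<exists>e \<in> alg_homs K (QA_alg K) (base_alg K). e (qa K) = \<one>\<^bsub>K\<^esub> \<and> e (qb K) = \<zero>\<^bsub>K\<^esub>"
    by (rule QA_alg_hom_exists[where s'="\<one>\<^bsub>K\<^esub>"]) (rule nc_algebra_base[OF K], simp_all add: base_alg_def)
  show "\<exists>S \<in> alg_homs K (QA_alg K) (opp_alg (QA_alg K)). S (qa K) = qa_inv K \<and>
      S (qb K) = \<ominus>\<^bsub>QA_alg K\<^esub> (qb K \<otimes>\<^bsub>QA_alg K\<^esub> qa_inv K)"
    by (rule QA_alg_hom_exists[where s'="qa K"])
      (rule nc_algebra_opp[OF A.nc_algebra_axioms], simp_all add: opp_alg_def)
qed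

end

section \<open>Coordinate functions on the \<open>ax + b\<close> group\<close>

lemma (in monoid_algebra) F_comm:
  assumes comm: "\<And>u v. \<lbrakk>u \<in> carrier M; v \<in> carrier M\<rbrakk> \<Longrightarrow> u \<otimes>\<^bsub>M\<^esub> v = v \<otimes>\<^bsub>M\<^esub> u"
    and f: "f \<in> carrier F" and g: "g \<in> carrier F"
  shows "f \<otimes>\<^bsub>F\<^esub> g = g \<otimes>\<^bsub>F\<^esub> f"
proof -
  interpret F: nc_algebra K F by (rule nc_algebra_F)
  have z: "(\<lambda>w. \<zero>) \<otimes>\<^bsub>F\<^esub> f = (\<lambda>w. \<zero>)" "f \<otimes>\<^bsub>F\<^esub> (\<lambda>w. \<zero>) = (\<lambda>w. \<zero>)" if "f \<in> carrier F" for f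
    using F.l_null[OF that] F.r_null[OF that] by simp_all
  have 1: "basis_elt K u \<otimes>\<^bsub>F\<^esub> g = g \<otimes>\<^bsub>F\<^esub> basis_elt K u" if "u \<in> carrier M" for u
    using g by (induction g rule: induct)
      (simp_all add: z that F_l_distr F_r_distr F_smult_left F_smult_right basis_mult comm)
  show ?thesis
    using f by (induction f rule: induct)
      (simp_all add: z g F_l_distr F_r_distr F_smult_left F_smult_right 1)
qed

context
  fixes K :: "('k, 'm) ring_scheme"
  assumes K: "field K"
begin

interpretation K: field K by (rule K)

interpretation E: monoid_algebra K exponents
  by (intro monoid_algebra.intro K monoidI) (auto simp: exponents_def)

private lemma exponents_simps:
  "carrier exponents = UNIV" "\<one>\<^bsub>exponents\<^esub> = (0, 0)" "(i, j) \<otimes>\<^bsub>exponents\<^esub> (i', j') = (i + i', j + j')"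
  by (simp_all add: exponents_def)

private lemma basis_OA: "basis_elt K u \<in> carrier (OA_alg K)"
  unfolding OA_alg_def by (rule E.basis_closed) (simp add: exponents_simps)

private lemma basis_OA_mult:
  "basis_elt K (i, j) \<otimes>\<^bsub>OA_alg K\<^esub> basis_elt K (i', j') = basis_elt K (i + i', j + j')"
  unfolding OA_alg_def by (subst E.basis_mult) (simp_all add: exponents_simps)

lemma nc_algebra_OA_alg: "nc_algebra K (OA_alg K)"
  unfolding OA_alg_def by (rule E.nc_algebra_F)

lemma comm_monoid_OA_alg: "comm_monoid (OA_alg K)"
proof -
  interpret A: nc_algebra K "OA_alg K" by (rule nc_algebra_OA_alg)
  show ?thesis
    by (rule A.monoid_comm_monoidI) (auto simp: OA_alg_def exponents_simps intro!: E.F_comm)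
qed

text \<open>Commutativity of \<open>B\<close> is what makes \<open>s^i t^j\<close> multiplicative in
  the pair of exponents.\<close>

lemma OA_alg_hom_exists:
  assumes B: "nc_algebra K B" and comm: "comm_monoid B"
    and c: "s \<in> carrier B" "s' \<in> carrier B" "t \<in> carrier B"
    and inv: "s \<otimes>\<^bsub>B\<^esub> s' = \<one>\<^bsub>B\<^esub>"
  shows "\<exists>f \<in> alg_homs K (OA_alg K) B. f (os K) = s \<and> f (ot K) = t"
proof -
  interpret B: nc_algebra K B by fact
  interpret C: comm_monoid B by fact
  interpret U: group "units_of B" by (rule B.units_group)
  have "s' \<otimes>\<^bsub>B\<^esub> s = \<one>\<^bsub>B\<^esub>" using inv c by (simp add: C.m_comm)
  then have s: "s \<in> carrier (units_of B)" using inv c by (auto simp: units_of_carrier Units_def)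
  \<comment> \<open>Negative exponents are obtained by taking powers in the group of units of
    \<open>B\<close>.\<close>
  define z where "z = (\<lambda>i::int. s [^]\<^bsub>units_of B\<^esub> i)"
  have zc: "z i \<in> carrier B" for i
    using U.int_pow_closed[OF s, of i] by (simp add: z_def units_of_carrier Units_def)
  have zm: "z (i + j) = z i \<otimes>\<^bsub>B\<^esub> z j" for i j
    using U.int_pow_mult[OF s, of i j] by (simp add: z_def units_of_mult)
  have z0: "z 0 = \<one>\<^bsub>B\<^esub>" and z1: "z 1 = s"
    using U.int_pow_1[OF s] by (simp_all add: z_def units_of_one)
  define \<phi> where "\<phi> = (\<lambda>(i, j::nat). z i \<otimes>\<^bsub>B\<^esub> t [^]\<^bsub>B\<^esub> j)"
  have \<phi>: "\<phi> u \<in> carrier B" for u using zc c by (simp add: \<phi>_def case_prod_unfold)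
  have L: "lin_ext K B \<phi> \<in> alg_homs K (OA_alg K) B"
    unfolding OA_alg_def
    by (rule E.lin_ext_hom[where \<phi>=\<phi>, OF B \<phi>])
      (auto simp: exponents_def \<phi>_def zm zc c z0 B.nat_pow_mult[symmetric] C.m_ac)
  have "lin_ext K B \<phi> (basis_elt K u) = \<phi> u" for u
    by (rule E.lin_ext_basis[where \<phi>=\<phi>, OF nc_algebraD(3)[OF B] \<phi>]) (simp add: exponents_simps)
  then show ?thesis using c
    by (intro bexI[OF _ L]) (simp add: os_def ot_def \<phi>_def z0 z1)
qed

lemma affine_algebra_OA_alg: "affine_algebra K (OA_alg K) (os K) (os_inv K) (ot K)"
proof -
  interpret A: nc_algebra K "OA_alg K" by (rule nc_algebra_OA_alg)
  have one: "\<one>\<^bsub>OA_alg K\<^esub> = basis_elt K (0, 0)" by (simp add: OA_alg_def exponents_simps)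
  have gen: "alg_generated K (OA_alg K) {os K, os_inv K, ot K}"
    unfolding alg_generated_def
  proof (intro allI impI ballI, elim conjE)
    fix Q X assume X: "X \<in> carrier (OA_alg K)" and g: "\<forall>g\<in>{os K, os_inv K, ot K}. Q g"
      and 1: "Q \<one>\<^bsub>OA_alg K\<^esub>"
      and add: "\<forall>x\<in>carrier (OA_alg K). \<forall>y\<in>carrier (OA_alg K). Q x \<longrightarrow> Q y \<longrightarrow> Q (x \<oplus>\<^bsub>OA_alg K\<^esub> y)"
      and mult: "\<forall>x\<in>carrier (OA_alg K). \<forall>y\<in>carrier (OA_alg K). Q x \<longrightarrow> Q y \<longrightarrow> Q (x \<otimes>\<^bsub>OA_alg K\<^esub> y)"
      and smult: "\<forall>c\<in>carrier K. \<forall>x\<in>carrier (OA_alg K). Q x \<longrightarrow> Q (c \<odot>\<^bsub>OA_alg K\<^esub> x)"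
    have step: "Q (basis_elt K (i + i', j + j'))" if "Q (basis_elt K (i, j))" "Q (basis_elt K (i', j'))" for i j i' j'
      using mult that basis_OA basis_OA_mult[of i j i' j'] by metis
    have t: "Q (basis_elt K (0, j))" for j
    proof (induction j)
      case 0
      then show ?case using 1 by (simp add: one)
    next
      case (Suc j)
      then show ?case using step[of 0 1 0 j] g by (simp add: ot_def)
    qed
    \<comment> \<open>The exponent of \<open>s\<close> is reached from zero in both directions,
      multiplying by \<open>s\<close> upwards and by its inverse downwards.\<close>
    have b: "Q (basis_elt K (i, j))" for i j
    proof (induction i rule: int_induct[where k=0])
      case base
      show ?case by (rule t)
    next
      case (step1 i)
      then show ?case using step[of i j 1 0] g by (simp add: os_def)
    next
      case (step2 i)
      then show ?case using step[of i j "-1" 0] g by (simp add: os_inv_def)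
    qed
    have z: "Q \<zero>\<^bsub>OA_alg K\<^esub>" using smult 1 A.smult_l_null[OF A.one_closed] K.zero_closed A.one_closed by metis
    have "X \<in> carrier E.F" using X by (simp add: OA_alg_def)
    then show "Q X"
    proof (induction X rule: E.induct)
      case zero
      then show ?case using z by (simp add: OA_alg_def)
    next
      case (add f g)
      then show ?case using \<open>\<forall>x\<in>carrier (OA_alg K). \<forall>y\<in>carrier (OA_alg K). Q x \<longrightarrow> Q y \<longrightarrow> Q (x \<oplus>\<^bsub>OA_alg K\<^esub> y)\<close>
        by (simp add: OA_alg_def)
    next
      case (basis c u)
      obtain i j where u: "u = (i, j)" by (cases u)
      show ?case using smult basis(1) b[of i j] basis_OA[of u] by (simp add: OA_alg_def u)
    qed
  qed
  show ?thesis
    by (intro affine_algebra.intro A.nc_algebra_axioms affine_algebra_axioms.intro gen)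
      (simp_all add: os_def os_inv_def ot_def basis_OA basis_OA_mult one)
qed

lemma OA_eq:
  "OA K = hopf_of (OA_alg K)
      (hom_ext K (OA_alg K) (tensor K (OA_alg K) (OA_alg K)) [(os K, ten K (OA_alg K) (OA_alg K) (os K) (os K)),
        (ot K, ten K (OA_alg K) (OA_alg K) (ot K) (os K) \<oplus>\<^bsub>tensor K (OA_alg K) (OA_alg K)\<^esub>
          ten K (OA_alg K) (OA_alg K) \<one>\<^bsub>OA_alg K\<^esub> (ot K))])
      (hom_ext K (OA_alg K) (base_alg K) [(os K, \<one>\<^bsub>K\<^esub>), (ot K, \<zero>\<^bsub>K\<^esub>)])
      (hom_ext K (OA_alg K) (opp_alg (OA_alg K)) [(os K, os_inv K),
        (ot K, \<ominus>\<^bsub>OA_alg K\<^esub> (ot K \<otimes>\<^bsub>OA_alg K\<^esub> os_inv K))])"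
  by (simp add: OA_def Let_def)

text \<open>The targets now have to be commutative too; the tensor square and the opposite algebra
  inherit this from \<open>OA_alg K\<close>.\<close>

lemma affine_bialgebra_OA: "affine_bialgebra K (OA K) (os K) (os_inv K) (ot K)"
  unfolding OA_eq
proof (rule affine_bialgebraI[OF affine_algebra_OA_alg])
  interpret A: affine_algebra K "OA_alg K" "os K" "os_inv K" "ot K" by (rule affine_algebra_OA_alg)
  interpret C: comm_monoid "OA_alg K" by (rule comm_monoid_OA_alg)
  interpret T: tensor_product K "OA_alg K" "OA_alg K" by (intro tensor_productI A.nc_algebra_axioms)
  interpret TT: nc_algebra K T.T by (rule T.nc_algebra_T)
  have "comm_monoid T.T"
    by (rule TT.monoid_comm_monoidI) (rule T.T_comm[OF comm_monoid_OA_alg comm_monoid_OA_alg])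
  then show "\<exists>D \<in> alg_homs K (OA_alg K) T.T. D (os K) = T.tp (os K) (os K) \<and>
      D (ot K) = T.tp (ot K) (os K) \<oplus>\<^bsub>T.T\<^esub> T.tp \<one>\<^bsub>OA_alg K\<^esub> (ot K)"
    by (intro OA_alg_hom_exists[where s'="T.tp (os_inv K) (os_inv K)"])
      (simp_all add: T.nc_algebra_T T.ten_mult T.ten_one)
  show "\<exists>e \<in> alg_homs K (OA_alg K) (base_alg K). e (os K) = \<one>\<^bsub>K\<^esub> \<and> e (ot K) = \<zero>\<^bsub>K\<^esub>"
    by (rule OA_alg_hom_exists[where s'="\<one>\<^bsub>K\<^esub>", OF nc_algebra_base[OF K]
          monoid.monoid_comm_monoidI[OF nc_algebraD(6)[OF nc_algebra_base[OF K]]]])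
      (simp_all add: base_alg_def K.m_comm)
  show "\<exists>S \<in> alg_homs K (OA_alg K) (opp_alg (OA_alg K)). S (os K) = os_inv K \<and>
      S (ot K) = \<ominus>\<^bsub>OA_alg K\<^esub> (ot K \<otimes>\<^bsub>OA_alg K\<^esub> os_inv K)"
    by (rule OA_alg_hom_exists[where s'="os K", OF nc_algebra_opp[OF A.nc_algebra_axioms]
          monoid.monoid_comm_monoidI[OF nc_algebraD(6)[OF nc_algebra_opp[OF A.nc_algebra_axioms]]]])
      (simp_all add: opp_alg_def C.m_comm)
qed

end

section \<open>The universal coaction\<close>

context
  fixes K :: "('k, 'm) ring_scheme"
  assumes K: "field K"
begin

interpretation K: field K by (rule K)
interpretation Q: affine_bialgebra K "QA K" "qa K" "qa_inv K" "qb K" by (rule affine_bialgebra_QA[OF K])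
interpretation PQ: tensor_product K "UP K" "QA K"
  by (intro tensor_productI nc_algebra_UP[OF K] Q.nc_algebra_axioms)

lemma UP_hom_ext:
  assumes B: "nc_algebra K B" and t: "t \<in> carrier B"
  shows "hom_ext K (UP K) B [(poly_X K, t)] \<in> alg_homs K (UP K) B"
    and "hom_ext K (UP K) B [(poly_X K, t)] (poly_X K) = t"
proof -
  obtain f where f: "f \<in> alg_homs K (UP K) B" "f (poly_X K) = t" by (rule UP_hom_exists[OF K B t])
  have "hom_ext K (UP K) B [(poly_X K, t)] = restrict f (carrier (UP K))"
  proof (rule hom_ext_eqI[OF nc_algebra_UP[OF K] f(1)])
    fix g p assume "g \<in> alg_homs K (UP K) B" "p \<in> carrier (UP K)"
      and "\<And>x y. (x, y) \<in> set [(poly_X K, t)] \<Longrightarrow> g x = y"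
    then show "g p = f p" by - (rule UP_hom_eq[OF K _ f(1)], auto simp: f(2))
  qed (auto simp: f(2) poly_X_closed[OF K])
  then show "hom_ext K (UP K) B [(poly_X K, t)] \<in> alg_homs K (UP K) B"
    "hom_ext K (UP K) B [(poly_X K, t)] (poly_X K) = t"
    using alg_homs_cong[OF f(1) _ nc_algebra_UP[OF K], of "restrict f (carrier (UP K))"] f(2)
      poly_X_closed[OF K] by simp_all
qed

private abbreviation (input) "X \<equiv> poly_X K"
private abbreviation (input) "\<alpha>X \<equiv> ten K (UP K) (QA K) X (qa K) \<oplus>\<^bsub>PQ.T\<^esub> ten K (UP K) (QA K) \<one>\<^bsub>UP K\<^esub> (qb K)"

interpretation TPQ: nc_algebra K PQ.T by (rule PQ.nc_algebra_T)

private lemma \<alpha>X_closed: "\<alpha>X \<in> carrier PQ.T"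
  by (intro TPQ.a_closed PQ.ten_closed poly_X_closed[OF K] Q.gens_closed PQ.A.one_closed)

lemma QA_act_hom: "QA_act K \<in> alg_homs K (UP K) PQ.T"
  unfolding QA_act_def Let_def by (rule UP_hom_ext(1)[OF PQ.nc_algebra_T \<alpha>X_closed])

lemma QA_act_X: "QA_act K X = \<alpha>X"
  unfolding QA_act_def Let_def by (rule UP_hom_ext(2)[OF PQ.nc_algebra_T \<alpha>X_closed])

interpretation PQQ: tensor_product K PQ.T "QA K"
  by (intro tensor_productI PQ.nc_algebra_T Q.nc_algebra_axioms)
interpretation P_QQ: tensor_product K "UP K" Q.HH.T
  by (intro tensor_productI nc_algebra_UP[OF K] Q.nc_HH)
interpretation TPQQ: nc_algebra K PQQ.T by (rule PQQ.nc_algebra_T)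
interpretation TP_QQ: nc_algebra K P_QQ.T by (rule P_QQ.nc_algebra_T)

text \<open>Two homomorphisms on \<open>k[x]\<close> are compared at \<open>x\<close>. The left side
  is \<open>x \<otimes> \<Delta>(a) + 1 \<otimes> \<Delta>(b)\<close>, the right side \<open>x
  \<otimes> a \<otimes> a + 1 \<otimes> b \<otimes> a + 1 \<otimes> 1 \<otimes> b\<close>; the
  coproducts of \<open>a\<close> and \<open>b\<close> are exactly what this comparison
  demands.\<close>

lemma QA_act_coassoc:
  assumes p: "p \<in> carrier (UP K)"
  shows "tensor_map K (UP K) (tensor K (QA K) (QA K)) id (comult (QA K)) (QA_act K p) =
      tensor_assoc K (UP K) (QA K) (QA K) (tensor_map K PQ.T (QA K) (QA_act K) id (QA_act K p))"
proof -
  note NP = nc_algebra_UP[OF K] and NQ = Q.nc_algebra_axioms and NPQ = PQ.nc_algebra_T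
    and NQQ = Q.nc_HH
  note lin = alg_homs_lin[OF id_alg_homs] alg_homs_lin[OF Q.comult_hom] alg_homs_lin[OF QA_act_hom]
  note hr = tensor_map_hom[OF NP NQQ NP NQ id_alg_homs Q.comult_hom]
    and hl = tensor_map_hom[OF NPQ NQ NP NQ QA_act_hom id_alg_homs]
    and ha = tensor_assoc_hom[OF NP NQ NQ]
  note tr = tensor_map_ten[OF NP NQQ NP NQ lin(1,2)] and tl = tensor_map_ten[OF NPQ NQ NP NQ lin(3,1)]
    and ta = tensor_assoc_ten[OF NP NQ NQ]
  note b = bilin_mapsD[OF Q.HH.ten_bilin] bilin_mapsD[OF PQ.ten_bilin] bilin_mapsD[OF PQQ.ten_bilin]
    bilin_mapsD[OF P_QQ.ten_bilin]
  note D = alg_homsD[OF QA_act_hom] alg_homsD[OF hr[unfolded id_def]] alg_homsD[OF hl[unfolded id_def]]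
    alg_homsD[OF ha]
  show ?thesis
    unfolding id_def
  proof (rule UP_hom_eq[OF K _ _ _ p])
    show "(\<lambda>p. tensor_map K (UP K) Q.HH.T (\<lambda>x. x) (comult (QA K)) (QA_act K p)) \<in> alg_homs K (UP K) P_QQ.T"
      by (rule alg_homs_comp[OF QA_act_hom hr[unfolded id_def]])
    show "(\<lambda>p. tensor_assoc K (UP K) (QA K) (QA K) (tensor_map K PQ.T (QA K) (QA_act K) (\<lambda>x. x) (QA_act K p)))
        \<in> alg_homs K (UP K) P_QQ.T"
      by (rule alg_homs_comp[OF alg_homs_comp[OF QA_act_hom hl[unfolded id_def]] ha])
  qed (simp_all add: QA_act_X Q.comult_a Q.comult_b tr[unfolded id_def] tl[unfolded id_def] ta D b
      poly_X_closed[OF K] PQ.ten_one[symmetric] TP_QQ.add.m_assoc)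
qed

lemma QA_act_counit:
  assumes p: "p \<in> carrier (UP K)"
  shows "tensor_lift K (UP K) (\<lambda>q h. counit (QA K) h \<odot>\<^bsub>UP K\<^esub> q) (QA_act K p) = p"
proof -
  note NP = nc_algebra_UP[OF K]
  have bi: "(\<lambda>q h. counit (QA K) h \<odot>\<^bsub>UP K\<^esub> q) \<in> bilin_maps K (UP K) (QA K) (UP K)"
    by (rule scalar_bilin(2)[OF NP alg_homs_lin[OF Q.counit_hom] alg_homs_lin[OF alg_homs_id]])
  have L: "tensor_lift K (UP K) (\<lambda>q h. counit (QA K) h \<odot>\<^bsub>UP K\<^esub> q) \<in> alg_homs K PQ.T (UP K)"
    by (rule PQ.tensor_lift_hom[OF bi NP])
      (simp_all add: Q.counitD PQ.A.smult_mult_left PQ.A.smult_mult_right PQ.A.smult_assoc1[symmetric] K.m_comm)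
  show ?thesis
    by (rule UP_hom_eq[OF K alg_homs_comp[OF QA_act_hom L] alg_homs_id _ p])
      (simp add: QA_act_X alg_homsD[OF L] PQ.tensor_lift_ten[OF bi nc_algebraD(3)[OF NP]]
        Q.counit_a Q.counit_b Q.counitD poly_X_closed[OF K])
qed

section \<open>The universal coaction preserves degree bounds\<close>

private abbreviation (input) "S n \<equiv> {ten K (UP K) (QA K) p h |p h. p \<in> poly_upto K n \<and> h \<in> carrier (QA K)}"

private lemma S_subset: "S n \<subseteq> carrier PQ.T"
  by (auto simp: poly_upto_def)

private lemma S_mono: "m \<le> n \<Longrightarrow> S m \<subseteq> S n"
  by (auto simp: poly_upto_def intro: order_trans)

private lemmas span_sub = TPQ.submoduleE[OF TPQ.submodule_lin_span[OF S_subset]]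

text \<open>Multiplication by \<alpha>(x) raises the bound by one: \<open>(p \<otimes> h) (x
  \<otimes> a + 1 \<otimes> b) = p x \<otimes> h a + p \<otimes> h b\<close>.\<close>

private lemma span_Suc:
  assumes "Y \<in> lin_span K PQ.T (S n)"
  shows "Y \<otimes>\<^bsub>PQ.T\<^esub> \<alpha>X \<in> lin_span K PQ.T (S (Suc n))"
proof -
  let ?V = "lin_span K PQ.T (S (Suc n))"
  \<comment> \<open>The preimage of the larger span under multiplication by \<alpha>(x) is a
    submodule, so it is enough that it contains the elementary tensors in
    \<open>S n\<close>.\<close>
  define U where "U = {Y \<in> carrier PQ.T. Y \<otimes>\<^bsub>PQ.T\<^esub> \<alpha>X \<in> ?V}"
  have c: "\<alpha>X \<in> carrier PQ.T" by (rule \<alpha>X_closed)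
  have "submodule ?V K PQ.T" by (rule TPQ.submodule_lin_span[OF S_subset])
  then have z: "\<zero>\<^bsub>PQ.T\<^esub> \<in> ?V" using subgroup.one_closed[OF submodule.axioms(1)] by fastforce
  have "submodule U K PQ.T"
    by (rule TPQ.submoduleI)
      (auto simp: U_def c z TPQ.l_minus TPQ.l_distr TPQ.smult_mult_left simp del: TPQ.r_distr
        intro: span_sub(3,4,5))
  moreover have "S n \<subseteq> U"
  proof
    fix Y assume "Y \<in> S n"
    then obtain p h where Y: "Y = ten K (UP K) (QA K) p h" and p: "p \<in> poly_upto K n" and h: "h \<in> carrier (QA K)"
      by blast
    have pc: "p \<in> carrier (UP K)" using p by (simp add: poly_upto_def)
    have "p \<in> poly_upto K (Suc n)" using p by (simp add: poly_upto_def)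
    then have 1: "ten K (UP K) (QA K) p (h \<otimes>\<^bsub>QA K\<^esub> qb K) \<in> ?V"
      using h by (intro subsetD[OF TPQ.lin_span_superset]) blast
    have 2: "ten K (UP K) (QA K) (p \<otimes>\<^bsub>UP K\<^esub> X) (h \<otimes>\<^bsub>QA K\<^esub> qa K) \<in> ?V"
      using h poly_upto_mult_X[OF K p] by (intro subsetD[OF TPQ.lin_span_superset]) blast
    have "Y \<otimes>\<^bsub>PQ.T\<^esub> \<alpha>X = ten K (UP K) (QA K) (p \<otimes>\<^bsub>UP K\<^esub> X) (h \<otimes>\<^bsub>QA K\<^esub> qa K) \<oplus>\<^bsub>PQ.T\<^esub>
      ten K (UP K) (QA K) p (h \<otimes>\<^bsub>QA K\<^esub> qb K)"
      using pc h poly_X_closed[OF K] by (simp add: Y TPQ.r_distr PQ.ten_mult)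
    then show "Y \<in> U" using span_sub(5)[OF 2 1] pc h by (simp add: U_def Y)
  qed
  ultimately have "lin_span K PQ.T (S n) \<subseteq> U" by (rule TPQ.lin_span_subset)
  then show ?thesis using assms by (auto simp: U_def)
qed

text \<open>A monomial of degree \<open>i\<close> goes to the \<open>i\<close>-th power of
  \<alpha>(x), and each factor costs one degree. Sums are then taken in the span for
  \<open>n\<close>, which contains the spans for smaller \<open>i\<close>.\<close>

lemma QA_act_poly_upto:
  assumes p: "p \<in> poly_upto K n"
  shows "QA_act K p \<in> lin_span K PQ.T (S n)"
proof -
  interpret UP: UP_cring K "UP K" by (intro UP_cring.intro K.is_cring)
  note D = alg_homsD[OF QA_act_hom]
  have m: "QA_act K (monom (UP K) \<one>\<^bsub>K\<^esub> i) \<in> lin_span K PQ.T (S i)" for i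
  proof (induction i)
    case 0
    have "\<one>\<^bsub>UP K\<^esub> \<in> poly_upto K 0" by (simp add: poly_upto_def)
    then have "ten K (UP K) (QA K) \<one>\<^bsub>UP K\<^esub> \<one>\<^bsub>QA K\<^esub> \<in> S 0" by blast
    then show ?case
      using TPQ.lin_span_superset[of "S 0"] by (auto simp: UP.monom_one D PQ.ten_one)
  next
    case (Suc i)
    have "QA_act K (monom (UP K) \<one>\<^bsub>K\<^esub> (Suc i)) = QA_act K (monom (UP K) \<one>\<^bsub>K\<^esub> i) \<otimes>\<^bsub>PQ.T\<^esub> QA_act K X"
      unfolding UP.monom_one_Suc[of i] unfolding poly_X_def by (rule D(4)) simp_all
    then show ?case using span_Suc[OF Suc] by (simp add: QA_act_X)
  qed
  have mono: "lin_span K PQ.T (S i) \<subseteq> lin_span K PQ.T (S n)" if "i \<le> n" for i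
    using that by (intro TPQ.lin_span_subset TPQ.submodule_lin_span S_subset
        order_trans[OF S_mono TPQ.lin_span_superset])
  show ?thesis
    by (rule poly_upto_induct[OF K p])
      (use m mono in \<open>auto simp: D intro: span_sub(4,5)\<close>)
qed

lemma poly_qtg_QA: "poly_qtg K (QA K, QA_act K)"
  unfolding poly_qtg_def split
  using QA_act_poly_upto
  by (intro conjI allI quantum_transformation_group.intro Q.hopf_algebra nc_algebra_UP[OF K]
      quantum_transformation_group_axioms.intro QA_act_hom QA_act_coassoc QA_act_counit) auto

section \<open>Universality\<close>

lemma QA_universal:
  fixes H :: "('k, 'h, 'x) hopf_scheme"
  assumes "poly_qtg K (H, \<alpha>)"
  shows "\<exists>!\<pi>. \<pi> \<in> qtg_morphisms K (UP K) (H, \<alpha>) (QA K, QA_act K)"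
proof -
  interpret qtg: quantum_transformation_group K "UP K" H \<alpha>
    using assms by (simp add: poly_qtg_def)
  have NP: "nc_algebra K (UP K)" and NH: "nc_algebra K H" by unfold_locales
  interpret H: hopf_algebra K H by unfold_locales
  interpret PH: tensor_product K "UP K" H by (intro tensor_productI NP NH)
  have NPH: "nc_algebra K PH.T" by (rule PH.nc_algebra_T)
  interpret HH: tensor_product K H H by (intro tensor_productI NH)
  have NHH: "nc_algebra K HH.T" by (rule HH.nc_algebra_T)
  interpret TPH: nc_algebra K PH.T by (rule NPH)
  interpret THH: nc_algebra K HH.T by (rule NHH)
  interpret P_HH: tensor_product K "UP K" HH.T by (intro tensor_productI NP NHH)
  interpret TP_HH: nc_algebra K P_HH.T by (rule P_HH.nc_algebra_T)
  interpret PH_H: tensor_product K PH.T H by (intro tensor_productI NPH NH)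
  interpret TPH_H: nc_algebra K PH_H.T by (rule PH_H.nc_algebra_T)
  have X: "X \<in> carrier (UP K)" by (rule poly_X_closed[OF K])
  note b = bilin_mapsD[OF PH.ten_bilin] bilin_mapsD[OF HH.ten_bilin] bilin_mapsD[OF P_HH.ten_bilin]
    bilin_mapsD[OF PH_H.ten_bilin]
  note act = alg_homsD[OF qtg.coact_hom] and C = alg_homsD[OF qtg.H.comult_hom]
  have eps: "counit H x \<in> carrier K" if "x \<in> carrier H" for x
    using alg_homsD(1)[OF qtg.H.counit_hom that] by (simp add: base_alg_def)

  \<comment> \<open>Invariance in degree one only places \<alpha>(x) in a linear span. The explicit
    form is extracted by showing that the tensors of that form make up a submodule containing the
    spanning tensors.\<close>
  have "\<exists>u v. u \<in> carrier H \<and> v \<in> carrier H \<and> \<alpha> X = PH.tp X u \<oplus>\<^bsub>PH.T\<^esub> PH.tp \<one>\<^bsub>UP K\<^esub> v"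
  proof -
    define U where "U = {PH.tp X u \<oplus>\<^bsub>PH.T\<^esub> PH.tp \<one>\<^bsub>UP K\<^esub> v |u v. u \<in> carrier H \<and> v \<in> carrier H}"
    have UI: "PH.tp X u \<oplus>\<^bsub>PH.T\<^esub> PH.tp \<one>\<^bsub>UP K\<^esub> v \<in> U" if "u \<in> carrier H" "v \<in> carrier H" for u v
      using that by (auto simp: U_def)
    have add: "x \<oplus>\<^bsub>PH.T\<^esub> y \<in> U" if xy: "x \<in> U" "y \<in> U" for x y
    proof -
      obtain u v u' v' where e: "x = PH.tp X u \<oplus>\<^bsub>PH.T\<^esub> PH.tp \<one>\<^bsub>UP K\<^esub> v" "y = PH.tp X u' \<oplus>\<^bsub>PH.T\<^esub> PH.tp \<one>\<^bsub>UP K\<^esub> v'"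
        and c: "u \<in> carrier H" "v \<in> carrier H" "u' \<in> carrier H" "v' \<in> carrier H"
        using xy by (auto simp: U_def)
      have "x \<oplus>\<^bsub>PH.T\<^esub> y = PH.tp X (u \<oplus>\<^bsub>H\<^esub> u') \<oplus>\<^bsub>PH.T\<^esub> PH.tp \<one>\<^bsub>UP K\<^esub> (v \<oplus>\<^bsub>H\<^esub> v')"
        using c X by (simp add: e b TPH.add.m_ac)
      then show ?thesis using UI[of "u \<oplus>\<^bsub>H\<^esub> u'" "v \<oplus>\<^bsub>H\<^esub> v'"] c by simp
    qed
    have smult: "k \<odot>\<^bsub>PH.T\<^esub> x \<in> U" if k: "k \<in> carrier K" and x: "x \<in> U" for k x
    proof -
      obtain u v where e: "x = PH.tp X u \<oplus>\<^bsub>PH.T\<^esub> PH.tp \<one>\<^bsub>UP K\<^esub> v" and c: "u \<in> carrier H" "v \<in> carrier H"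
        using x by (auto simp: U_def)
      have "k \<odot>\<^bsub>PH.T\<^esub> x = PH.tp X (k \<odot>\<^bsub>H\<^esub> u) \<oplus>\<^bsub>PH.T\<^esub> PH.tp \<one>\<^bsub>UP K\<^esub> (k \<odot>\<^bsub>H\<^esub> v)"
        using c X k by (simp add: e b TPH.smult_r_distr)
      then show ?thesis using UI[of "k \<odot>\<^bsub>H\<^esub> u" "k \<odot>\<^bsub>H\<^esub> v"] c k by simp
    qed
    have Uc: "U \<subseteq> carrier PH.T" using X by (auto simp: U_def)
    have "submodule U K PH.T"
    proof (rule TPH.submoduleI[OF Uc _ _ add smult])
      have "\<zero>\<^bsub>K\<^esub> \<odot>\<^bsub>PH.T\<^esub> (PH.tp X \<one>\<^bsub>H\<^esub> \<oplus>\<^bsub>PH.T\<^esub> PH.tp \<one>\<^bsub>UP K\<^esub> \<one>\<^bsub>H\<^esub>) \<in> U"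
        by (intro smult UI) simp_all
      then show "\<zero>\<^bsub>PH.T\<^esub> \<in> U" using X by simp
      fix x assume x: "x \<in> U"
      have "(\<ominus>\<^bsub>K\<^esub> \<one>\<^bsub>K\<^esub>) \<odot>\<^bsub>PH.T\<^esub> x \<in> U" by (intro smult x) simp
      then show "\<ominus>\<^bsub>PH.T\<^esub> x \<in> U" using x Uc by (simp add: TPH.smult_l_minus subset_iff)
    qed
    moreover have "PH.tp p h \<in> U" if p: "p \<in> poly_upto K 1" and h: "h \<in> carrier H" for p h
    proof -
      have pc: "p \<in> carrier (UP K)" using p by (simp add: poly_upto_def)
      have c: "p i \<in> carrier K" for i
        using lin_mapsD(1)[OF coeff_lin[OF K] pc, of i] by (simp add: base_alg_def)
      \<comment> \<open>With \<open>p = p 1 x + p 0\<close>, the coefficients are moved across the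
        tensor sign onto \<open>h\<close>.\<close>
      have "PH.tp p h = PH.tp X (p 1 \<odot>\<^bsub>H\<^esub> h) \<oplus>\<^bsub>PH.T\<^esub> PH.tp \<one>\<^bsub>UP K\<^esub> (p 0 \<odot>\<^bsub>H\<^esub> h)"
        by (subst poly_upto_1[OF K p]) (use c X h in \<open>simp add: b\<close>)
      then show ?thesis using UI c h by simp
    qed
    ultimately have "lin_span K PH.T {PH.tp p h |p h. p \<in> poly_upto K 1 \<and> h \<in> carrier H} \<subseteq> U"
      by (intro TPH.lin_span_subset) auto
    moreover have "X \<in> poly_upto K 1"
    proof -
      interpret UP: UP_cring K "UP K" by (intro UP_cring.intro K.is_cring)
      have "deg K X \<le> 1" unfolding poly_X_def by (rule UP.deg_monom_le) simp
      then show ?thesis using X by (simp add: poly_upto_def)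
    qed
    ultimately have "\<alpha> X \<in> U" using assms unfolding poly_qtg_def split by blast
    then show ?thesis by (auto simp: U_def)
  qed
  then obtain u v where uv: "u \<in> carrier H" "v \<in> carrier H"
    and \<alpha>X: "\<alpha> X = PH.tp X u \<oplus>\<^bsub>PH.T\<^esub> PH.tp \<one>\<^bsub>UP K\<^esub> v" by blast

  note idl = alg_homs_lin[OF id_alg_homs] and Cl = alg_homs_lin[OF qtg.H.comult_hom]
    and al = alg_homs_lin[OF qtg.coact_hom]
  note mr = lin_mapsD[OF tensor_map_lin[OF NP NHH NP NH idl Cl, unfolded id_def]]
    and ml = lin_mapsD[OF tensor_map_lin[OF NPH NH NP NH al idl, unfolded id_def]]
    and tr = tensor_map_ten[OF NP NHH NP NH idl Cl, unfolded id_def]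
    and tl = tensor_map_ten[OF NPH NH NP NH al idl, unfolded id_def]
    and ma = alg_homsD[OF tensor_assoc_hom[OF NP NH NH]]
    and ta = tensor_assoc_ten[OF NP NH NH]
  \<comment> \<open>Both sides of the coaction axiom at \<open>x\<close> are brought to the shape of
    \<open>x\<close> tensor something plus \<open>1\<close> tensor something, with entries in
    \<open>H \<otimes> H\<close>, so that they can be compared entry by entry.\<close>
  have "tensor_map K (UP K) HH.T id (comult H) (\<alpha> X) =
      P_HH.tp X (comult H u) \<oplus>\<^bsub>P_HH.T\<^esub> P_HH.tp \<one>\<^bsub>UP K\<^esub> (comult H v)"
    unfolding id_def using uv X by (simp add: \<alpha>X mr tr)
  moreover have "tensor_assoc K (UP K) H H (tensor_map K PH.T H \<alpha> id (\<alpha> X)) =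
      P_HH.tp X (HH.tp u u) \<oplus>\<^bsub>P_HH.T\<^esub> P_HH.tp \<one>\<^bsub>UP K\<^esub> (HH.tp v u \<oplus>\<^bsub>HH.T\<^esub> HH.tp \<one>\<^bsub>H\<^esub> v)"
    unfolding id_def using uv X
    by (simp add: \<alpha>X ml tl ma ta act b PH.ten_one[symmetric] TP_HH.add.m_assoc)
  ultimately have "P_HH.tp X (comult H u) \<oplus>\<^bsub>P_HH.T\<^esub> P_HH.tp \<one>\<^bsub>UP K\<^esub> (comult H v) =
      P_HH.tp X (HH.tp u u) \<oplus>\<^bsub>P_HH.T\<^esub> P_HH.tp \<one>\<^bsub>UP K\<^esub> (HH.tp v u \<oplus>\<^bsub>HH.T\<^esub> HH.tp \<one>\<^bsub>H\<^esub> v)"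
    using qtg.coact_coassoc[OF X] by simp
  from linear_tensor_eqD[OF K NHH _ _ _ _ this]
  have \<Delta>: "comult H u = HH.tp u u" "comult H v = HH.tp v u \<oplus>\<^bsub>HH.T\<^esub> HH.tp \<one>\<^bsub>H\<^esub> v"
    using uv by (simp_all add: C)

  have bi: "(\<lambda>q h. counit H h \<odot>\<^bsub>UP K\<^esub> q) \<in> bilin_maps K (UP K) H (UP K)"
    by (rule scalar_bilin(2)[OF NP alg_homs_lin[OF qtg.H.counit_hom] alg_homs_lin[OF alg_homs_id]])
  \<comment> \<open>The counit axiom at \<open>x\<close> is an equation of polynomials; its
    coefficients in degrees one and zero give the counits of \<open>u\<close> and
    \<open>v\<close>.\<close>
  have cX: "counit H u \<odot>\<^bsub>UP K\<^esub> X \<oplus>\<^bsub>UP K\<^esub> counit H v \<odot>\<^bsub>UP K\<^esub> \<one>\<^bsub>UP K\<^esub> = X"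
    using qtg.coact_counit[OF X] uv X nc_algebraD(3)[OF NP]
    by (simp add: \<alpha>X lin_mapsD[OF PH.tensor_lift_lin[OF bi]] PH.tensor_lift_ten[OF bi])
  have "(counit H u \<odot>\<^bsub>UP K\<^esub> X \<oplus>\<^bsub>UP K\<^esub> counit H v \<odot>\<^bsub>UP K\<^esub> \<one>\<^bsub>UP K\<^esub>) i =
      counit H u \<otimes>\<^bsub>K\<^esub> X i \<oplus>\<^bsub>K\<^esub> counit H v \<otimes>\<^bsub>K\<^esub> \<one>\<^bsub>UP K\<^esub> i" for i
    using lin_mapsD[OF coeff_lin[OF K, of i]] eps uv X by (simp add: base_alg_def)
  then have c: "X i = counit H u \<otimes>\<^bsub>K\<^esub> X i \<oplus>\<^bsub>K\<^esub> counit H v \<otimes>\<^bsub>K\<^esub> \<one>\<^bsub>UP K\<^esub> i" for i unfolding cX .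
  have "counit H u = \<one>\<^bsub>K\<^esub>" using c[of "Suc 0"] eps uv by (simp add: poly_X_coeffs[OF K])
  moreover have "counit H v = \<zero>\<^bsub>K\<^esub>" using c[of 0] eps uv by (simp add: poly_X_coeffs[OF K])
  ultimately have \<epsilon>: "counit H u = \<one>\<^bsub>K\<^esub>" "counit H v = \<zero>\<^bsub>K\<^esub>" .

  have al: "(\<lambda>x y. antipode H x \<otimes>\<^bsub>H\<^esub> y) \<in> bilin_maps K H H H"
    by (rule mult_bilin[OF NH qtg.H.antipode_lin alg_homs_lin[OF alg_homs_id]])
  have ar: "(\<lambda>x y. x \<otimes>\<^bsub>H\<^esub> antipode H y) \<in> bilin_maps K H H H"
    by (rule mult_bilin[OF NH alg_homs_lin[OF alg_homs_id] qtg.H.antipode_lin])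
  \<comment> \<open>For a group-like \<open>u\<close> of counit one, the antipode axioms say that
    \<open>antipode H u\<close> is a two-sided inverse.\<close>
  have inv: "u \<otimes>\<^bsub>H\<^esub> antipode H u = \<one>\<^bsub>H\<^esub>" "antipode H u \<otimes>\<^bsub>H\<^esub> u = \<one>\<^bsub>H\<^esub>"
    using qtg.H.antipode_left[OF uv(1)] qtg.H.antipode_right[OF uv(1)] uv nc_algebraD(3)[OF NH]
    by (simp_all add: \<Delta> \<epsilon> HH.tensor_lift_ten[OF al] HH.tensor_lift_ten[OF ar])

  obtain f where f: "f \<in> alg_homs K (QA K) H" "f (qa K) = u" "f (qb K) = v"
    using QA_hom_exists[OF K NH uv(1) lin_mapsD(1)[OF qtg.H.antipode_lin uv(1)] uv(2) inv] by blast
  have fh: "f \<in> hopf_homs K (QA K) H"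
    by (rule Q.hopf_homsI[OF qtg.H.hopf_algebra_axioms f(1)]) (simp_all add: f(2,3) \<Delta> \<epsilon>)
  have NQ: "nc_algebra K (QA K)" by (rule Q.nc_algebra_axioms)
  have im: "tensor_map K (UP K) H id g \<in> alg_homs K PQ.T PH.T" if "g \<in> alg_homs K (QA K) H" for g
    by (rule tensor_map_hom[OF NP NH NP NQ id_alg_homs that])
  have imX: "tensor_map K (UP K) H id g (QA_act K X) = PH.tp X (g (qa K)) \<oplus>\<^bsub>PH.T\<^esub> PH.tp \<one>\<^bsub>UP K\<^esub> (g (qb K))"
    if g: "g \<in> alg_homs K (QA K) H" for g
    using X alg_homsD(2)[OF im[OF g]] tensor_map_ten[OF NP NH NP NQ idl alg_homs_lin[OF g]]
    by (simp add: QA_act_X id_def)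
  \<comment> \<open>The restriction makes the map \<open>undefined\<close> off the carrier, as
    \<open>qtg_morphisms\<close> demands.\<close>
  define \<pi> where "\<pi> = restrict f (carrier (QA K))"
  have \<pi>: "\<pi> \<in> alg_homs K (QA K) H"
    by (rule alg_homs_cong[OF f(1) _ NQ]) (simp add: \<pi>_def)
  have \<pi>h: "\<pi> \<in> hopf_homs K (QA K) H"
    by (rule Q.hopf_homsI[OF qtg.H.hopf_algebra_axioms \<pi>]) (simp_all add: f(2,3) \<Delta> \<epsilon> \<pi>_def)
  have \<pi>_gens: "\<pi> (qa K) = u" "\<pi> (qb K) = v" by (simp_all add: \<pi>_def f)
  show ?thesis
  proof (rule ex1I[of _ \<pi>])
    have "\<alpha> p = tensor_map K (UP K) H id \<pi> (QA_act K p)" if "p \<in> carrier (UP K)" for p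
      by (rule UP_hom_eq[OF K qtg.coact_hom alg_homs_comp[OF QA_act_hom im[OF \<pi>]] _ that])
        (simp add: imX[OF \<pi>] \<alpha>X \<pi>_gens)
    then show "\<pi> \<in> qtg_morphisms K (UP K) (H, \<alpha>) (QA K, QA_act K)"
      using \<pi>h by (simp add: qtg_morphisms_def \<pi>_def)
  next
    fix g assume "g \<in> qtg_morphisms K (UP K) (H, \<alpha>) (QA K, QA_act K)"
    then have g: "g \<in> alg_homs K (QA K) H" "g \<in> extensional (carrier (QA K))"
      and gX: "\<alpha> X = tensor_map K (UP K) H id g (QA_act K X)"
      using X by (auto simp: qtg_morphisms_def hopf_homs_def)
    \<comment> \<open>A competing morphism is pinned down by the coaction equation at
      \<open>x\<close> alone: comparing entries recovers its values on \<open>a\<close> and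
      \<open>b\<close>.\<close>
    have "PH.tp X (g (qa K)) \<oplus>\<^bsub>PH.T\<^esub> PH.tp \<one>\<^bsub>UP K\<^esub> (g (qb K)) = PH.tp X u \<oplus>\<^bsub>PH.T\<^esub> PH.tp \<one>\<^bsub>UP K\<^esub> v"
      using gX \<alpha>X imX[OF g(1)] by simp
    from linear_tensor_eqD[OF K NH _ _ _ _ this]
    have e: "g (qa K) = u" "g (qb K) = v" using uv alg_homsD(1)[OF g(1)] by simp_all
    show "g = \<pi>"
    proof (rule extensionalityI[OF g(2)])
      show "g x = \<pi> x" if "x \<in> carrier (QA K)" for x
        by (rule Q.hom_eq[OF nc_algebraD(6)[OF NH] g(1) \<pi> _ _ that]) (simp_all add: e \<pi>_gens)
    qed (simp add: \<pi>_def)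
  qed
qed

section \<open>The classical automorphism group as a quantum subgroup\<close>

text \<open>Surjectivity holds because the image is a subalgebra containing \<open>s\<close>,
  \<open>t\<close> and, since homomorphisms preserve inverses, the inverse of \<open>s\<close>. The
  last clause makes precise that the two assignments define the morphism: its values on the carrier
  are forced.\<close>

lemma QA_OA_hom:
  "\<exists>\<pi>. \<pi> \<in> hopf_homs K (QA K) (OA K) \<and> \<pi> (qa K) = os K \<and> \<pi> (qb K) = ot K \<and>
     \<pi> ` carrier (QA K) = carrier (OA K) \<and>
     (\<forall>\<pi>' \<in> hopf_homs K (QA K) (OA K). \<pi>' (qa K) = os K \<longrightarrow> \<pi>' (qb K) = ot K \<longrightarrow>
       (\<forall>h \<in> carrier (QA K). \<pi>' h = \<pi> h))"
proof -
  interpret O: affine_bialgebra K "OA K" "os K" "os_inv K" "ot K" by (rule affine_bialgebra_OA[OF K])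
  obtain f where f: "f \<in> alg_homs K (QA K) (OA K)" "f (qa K) = os K" "f (qb K) = ot K"
    using QA_hom_exists[OF K O.nc_algebra_axioms O.gens_closed O.inv] by blast
  note D = alg_homsD[OF f(1)]
  have fi: "f (qa_inv K) = os_inv K"
    by (rule Q.hom_inverse[OF nc_algebraD(6)[OF O.nc_algebra_axioms] f(1)]) (simp_all add: f(2))
  have "y \<in> f ` carrier (QA K)" if "y \<in> carrier (OA K)" for y
  proof (rule alg_generated_induct[OF O.generated that])
    show "y \<in> f ` carrier (QA K)" if "y \<in> {os K, os_inv K, ot K}" for y
      using that f fi by (auto intro: image_eqI[OF sym])
    show "\<one>\<^bsub>OA K\<^esub> \<in> f ` carrier (QA K)" using D(5) by (auto intro: image_eqI[OF sym])
  qed (auto simp: D(2-4)[symmetric])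
  then have "f ` carrier (QA K) = carrier (OA K)" using D(1) by blast
  moreover have "f \<in> hopf_homs K (QA K) (OA K)"
    by (rule Q.hopf_homsI[OF O.hopf_algebra f(1)])
      (simp_all add: f(2,3) O.comult_a O.comult_b O.counit_a O.counit_b)
  moreover have "\<pi>' h = f h"
    if "\<pi>' \<in> hopf_homs K (QA K) (OA K)" "\<pi>' (qa K) = os K" "\<pi>' (qb K) = ot K" "h \<in> carrier (QA K)" for \<pi>' h
    by (rule Q.hom_eq[OF nc_algebraD(6)[OF O.nc_algebra_axioms] _ f(1) _ _ that(4)])
      (use that f in \<open>auto simp: hopf_homs_def\<close>)
  ultimately show ?thesis using f(2,3) by blast
qed

end

theorem theorem2:
  fixes K :: "('k, 'm) ring_scheme"
  assumes "field K"
  shows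
   "(hopf_algebra K (QA K) \<and>
     comult (QA K) (qa K) = ten K (QA K) (QA K) (qa K) (qa K) \<and>
     comult (QA K) (qb K) = ten K (QA K) (QA K) (qb K) (qa K)
       \<oplus>\<^bsub>tensor K (QA K) (QA K)\<^esub> ten K (QA K) (QA K) \<one>\<^bsub>QA K\<^esub> (qb K) \<and>
     antipode (QA K) (qa K) = qa_inv K \<and>
     antipode (QA K) (qb K) = \<ominus>\<^bsub>QA K\<^esub> (qb K \<otimes>\<^bsub>QA K\<^esub> qa_inv K) \<and>
     counit (QA K) (qa K) = \<one>\<^bsub>K\<^esub> \<and>
     counit (QA K) (qb K) = \<zero>\<^bsub>K\<^esub>) \<and>
    (QA_act K (poly_X K) = ten K (UP K) (QA K) (poly_X K) (qa K)
       \<oplus>\<^bsub>tensor K (UP K) (QA K)\<^esub> ten K (UP K) (QA K) \<one>\<^bsub>UP K\<^esub> (qb K) \<and>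
     poly_qtg K (QA K, QA_act K) \<and>
     (\<forall>(H0 :: ('k, 'h) hopf) \<alpha>0. poly_qtg K (H0, \<alpha>0) \<longrightarrow>
       (\<exists>!\<pi>. \<pi> \<in> qtg_morphisms K (UP K) (H0, \<alpha>0) (QA K, QA_act K)))) \<and>
    (hopf_algebra K (OA K) \<and>
     comult (OA K) (os K) = ten K (OA K) (OA K) (os K) (os K) \<and>
     comult (OA K) (ot K) = ten K (OA K) (OA K) (ot K) (os K)
       \<oplus>\<^bsub>tensor K (OA K) (OA K)\<^esub> ten K (OA K) (OA K) \<one>\<^bsub>OA K\<^esub> (ot K) \<and>
     antipode (OA K) (os K) = os_inv K \<and>
     antipode (OA K) (ot K) = \<ominus>\<^bsub>OA K\<^esub> (ot K \<otimes>\<^bsub>OA K\<^esub> os_inv K) \<and>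
     counit (OA K) (os K) = \<one>\<^bsub>K\<^esub> \<and>
     counit (OA K) (ot K) = \<zero>\<^bsub>K\<^esub>) \<and>
    (\<exists>\<pi>. \<pi> \<in> hopf_homs K (QA K) (OA K) \<and> \<pi> (qa K) = os K \<and> \<pi> (qb K) = ot K \<and>
       \<pi> ` carrier (QA K) = carrier (OA K) \<and>
       (\<forall>\<pi>' \<in> hopf_homs K (QA K) (OA K). \<pi>' (qa K) = os K \<longrightarrow> \<pi>' (qb K) = ot K \<longrightarrow>
         (\<forall>h \<in> carrier (QA K). \<pi>' h = \<pi> h)))"
proof -
  interpret Q: affine_bialgebra K "QA K" "qa K" "qa_inv K" "qb K" by (rule affine_bialgebra_QA[OF assms])
  interpret O: affine_bialgebra K "OA K" "os K" "os_inv K" "ot K" by (rule affine_bialgebra_OA[OF assms])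
  show ?thesis
    by (intro conjI allI impI Q.hopf_algebra Q.comult_a Q.comult_b Q.antipode_a Q.antipode_b Q.counit_a
        Q.counit_b QA_act_X[OF assms] poly_qtg_QA[OF assms] QA_universal[OF assms] O.hopf_algebra
        O.comult_a O.comult_b O.antipode_a O.antipode_b O.counit_a O.counit_b QA_OA_hom[OF assms])
qed

end
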